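(* Suppose the assumptions on $f$ stated in the context hold. Let $\{x_t\}$ be a sequence generated by the ILMNegCur algorithm (see context), where the matrix inverse $(\nabla^2_{yy}f(x_t,y_t))^{-1}$ in $H_t$ is approximated via $\tilde{\mathcal O}(\sqrt\kappa)$ terms of Chebyshev polynomials (see context), and with $$\epsilon_1=\min\Big\{\frac1{32},\frac1{144},\frac{\sqrt{L_2}}{32L_1}\Big\}\epsilon^{3/2},\qquad\epsilon_2=\min\Big\{\frac1{12},\frac1{36}\Big\}\sqrt{L_2}\,\epsilon^{1/2},$$ $\eta_y=1/\ell$, momentum parameter $\frac{\sqrt\kappa-1}{\sqrt\kappa+1}$, and $$N_0\ge 2\sqrt\kappa\ln\frac{\sqrt{\kappa+1}\,\|y_{-1}-y^*(x_0)\|}{A},\qquad N_t\ge 2\sqrt\kappa\ln\frac{\sqrt{\kappa+1}\,(A+\kappa\|s_{t-1}\|)}{A}\ (t\ge1),\qquad A=\min\{\epsilon_1/\ell,\ \epsilon_2/(2L_H)\}.$$ Let $\tilde T(\epsilon)$ be the first iteration $t$ with $\|g_t\|\le\epsilon$ and $\hat\lambda_t\ge-\frac14\sqrt{L_2\epsilon}$. Then, with high probability, $x_{\tilde T(\epsilon)}$ is an $\mathcal O(\epsilon,\sqrt\epsilon)$-second-order stationary point of $P$, and the total number of Hessian-vector products required is at most $\tilde{\mathcal O}(\ell^{2.25}\rho^{0.25}\mu^{-1.75}\epsilon^{-1.75})$.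
   Context: Setting. $f:\mathbb{R}^n\times\mathbb{R}^m\to\mathbb{R}$ is continuously differentiable and, for every $x$, $f(x,\cdot)$ is $\mu$-strongly concave ($\mu>0$). Assumptions: (i) $\|\nabla f(x,y)-\nabla f(x',y')\|\le\ell\|(x,y)-(x',y')\|$ for all $(x,y),(x',y')$; (ii) the second-order partial derivative matrices $\nabla^2_{xx}f,\nabla^2_{xy}f,\nabla^2_{yx}f,\nabla^2_{yy}f$ are $\rho$-Lipschitz continuous in $(x,y)$; (iii) $P(x)=\max_{y\in\mathbb{R}^m}f(x,y)$ is bounded below by a constant $P^*$. $\|\cdot\|$ is the Euclidean norm of vectors and the spectral norm of matrices. Notation. $y^*(x)=\arg\max_{y}f(x,y)$; $\kappa=\ell/\mu$; $L_1=(\kappa+1)\ell$; $L_2=\rho(1+\kappa)^3$; $L_H=\rho(1+\kappa)^2$; $H(x,y)=[\nabla^2_{xx}f-\nabla^2_{xy}f(\nabla^2_{yy}f)^{-1}\nabla^2_{yx}f](x,y)$. $\tilde{\mathcal O}(\cdot)$ hides absolute constants and logarithmic factors (including those in the failure probability); $P(x_0)-P^*$ is also treated as a constant. A point $x$ is an $\mathcal O(\epsilon,\sqrt\epsilon)$-second-order stationary point of $P$ if $\|\nabla P(x)\|\le\xi\epsilon$ and $\nabla^2P(x)\succeq-\theta\sqrt\epsilon I$ for positive constants $\xi,\theta$ independent of $\epsilon$. ILMNegCur algorithm. Input $x_0,y_{-1}$ and parameters $\eta_y,\theta_y$ (momentum), $N_t,\epsilon$. For $t=0,1,2,\dots$: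 (1) set $y^t_0=\tilde y^t_0=y_{t-1}$; for $k=0,\dots,N_t-1$ set $y^t_{k+1}=\tilde y^t_k+\eta_y\nabla_yf(x_t,\tilde y^t_k)$ and $\tilde y^t_{k+1}=y^t_{k+1}+\theta_y(y^t_{k+1}-y^t_k)$; set $y_t=y^t_{N_t}$. (2) Set $g_t=\nabla_xf(x_t,y_t)$, $H_t=H(x_t,y_t)$. (3) By the randomized Lanczos procedure (Lanczos from a random starting vector) applied to $H_t$, compute, up to a prescribed small failure probability, a number $\hat\lambda_t$ and a unit vector $u_t$ with $\hat\lambda_t\le\lambda_{\min}(H_t)+\frac14\sqrt{L_2\max\{\|g_t\|,\epsilon\}}$, $\hat\lambda_t=u_t^\top H_tu_t$, $g_t^\top u_t\le0$. If $\hat\lambda_t\le-\frac14\sqrt{L_2\max\{\|g_t\|,\epsilon\}}$, set $s_t=\frac12\sqrt{\max\{\|g_t\|,\epsilon\}/L_2}\,u_t$. Otherwise, if $\|g_t\|\ge\epsilon$, apply the conjugate gradient method to $(H_t+\sqrt{L_2\|g_t\|}I)s=-g_t$ to obtain $s_t$ with $\|g_t+(H_t+\sqrt{L_2\|g_t\|}I)s_t\|\le\frac14\min\{\|g_t\|,\frac12\sqrt{L_2\|g_t\|}\,\|s_t\|\}$; otherwise stop. (4) Set $x_{t+1}=x_t+s_t$. Chebyshev approximation. In place of $H_t$ the algorithm uses $\hat H_t=\nabla^2_{xx}f(x_t,y_t)+\nabla^2_{xy}f(x_t,y_t)\,C_t\,\nabla^2_{yx}f(x_t,y_t)$ with $C_t\approx-(\nabla^2_{yy}f(x_t,y_t))^{-1}$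 obtained by truncating, after $\tilde{\mathcal O}(\sqrt\kappa)$ terms, the Chebyshev expansion of the inverse: with $X=-\nabla^2_{yy}f(x_t,y_t)$, $Z=\frac{2}{\ell-\mu}X-\frac{\ell+\mu}{\ell-\mu}I$, $q=\frac{\sqrt\ell-\sqrt\mu}{\sqrt\ell+\sqrt\mu}$ and $T_k$ the Chebyshev polynomials of the first kind, $X^{-1}=\frac1{\sqrt{\ell\mu}}\big(I+2\sum_{k\ge1}(-q)^kT_k(Z)\big)$. The number of terms is chosen so that $\|\hat H_t-\nabla^2P(x_t)\|\le\epsilon_2$. A Hessian-vector product is the multiplication of one of $\nabla^2_{xx}f,\nabla^2_{xy}f,\nabla^2_{yx}f,\nabla^2_{yy}f$ at a point by a vector. "With high probability" means: for any $\hat\xi\in(0,1)$, the failure probability of the Lanczos procedure can be set so that the conclusion holds with probability at least $1-\hat\xi$, $\hat\xi$ entering the bound only through logarithmic factors.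
   Formalization: The bound fails for large ε (it tends to 0, yet at least one Hessian-vector product is used), so the formal theorem assumes the small-accuracy regime ε ≤ 1, √(L₂ε) ≤ L₁ and ε^{3/2} ≤ √L₂; also ρ > 0, with factor 1+P(x₀)−P* and the logarithms made explicit. *)

theory Defs
  imports "HOL-Analysis.Analysis" "HOL-Probability.Probability" "HOL-Probability.Stopping_Time"
begin

section \<open>Derivatives and the minimax problem\<close>

definition grad :: "('a::real_inner \<Rightarrow> real) \<Rightarrow> 'a \<Rightarrow> 'a" where
  "grad \<phi> z = (THE d. GDERIV \<phi> z :> d)"

definition hess :: "(real^'n \<Rightarrow> real) \<Rightarrow> real^'n \<Rightarrow> real^'n^'n" where
  "hess \<phi> x = jacobian (grad \<phi>) (at x)"

definition grad_x :: "((real^'n) \<times> (real^'m) \<Rightarrow> real) \<Rightarrow> real^'n \<Rightarrow> real^'m \<Rightarrow> real^'n" where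
  "grad_x f x y = fst (grad f (x, y))"

definition grad_y :: "((real^'n) \<times> (real^'m) \<Rightarrow> real) \<Rightarrow> real^'n \<Rightarrow> real^'m \<Rightarrow> real^'m" where
  "grad_y f x y = snd (grad f (x, y))"

definition hess_xx :: "((real^'n) \<times> (real^'m) \<Rightarrow> real) \<Rightarrow> (real^'n) \<times> (real^'m) \<Rightarrow> real^'n^'n" where
  "hess_xx f z = jacobian (\<lambda>x. grad_x f x (snd z)) (at (fst z))"

definition hess_xy :: "((real^'n) \<times> (real^'m) \<Rightarrow> real) \<Rightarrow> (real^'n) \<times> (real^'m) \<Rightarrow> real^'m^'n" where
  "hess_xy f z = jacobian (\<lambda>y. grad_x f (fst z) y) (at (snd z))"

definition hess_yx :: "((real^'n) \<times> (real^'m) \<Rightarrow> real) \<Rightarrow> (real^'n) \<times> (real^'m) \<Rightarrow> real^'n^'m" where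
  "hess_yx f z = jacobian (\<lambda>x. grad_y f x (snd z)) (at (fst z))"

definition hess_yy :: "((real^'n) \<times> (real^'m) \<Rightarrow> real) \<Rightarrow> (real^'n) \<times> (real^'m) \<Rightarrow> real^'m^'m" where
  "hess_yy f z = jacobian (\<lambda>y. grad_y f (fst z) y) (at (snd z))"

definition spectral_norm :: "real^'n^'m \<Rightarrow> real" where
  "spectral_norm A = onorm ((*v) A)"

definition max_fun :: "((real^'n) \<times> (real^'m) \<Rightarrow> real) \<Rightarrow> real^'n \<Rightarrow> real" where
  "max_fun f x = (SUP y. f (x, y))"

definition y_star :: "((real^'n) \<times> (real^'m) \<Rightarrow> real) \<Rightarrow> real^'n \<Rightarrow> real^'m" where
  "y_star f x = arg_max (\<lambda>y. f (x, y)) (\<lambda>_. True)"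

locale minimax_problem =
  fixes f :: "(real^'n) \<times> (real^'m) \<Rightarrow> real" and l \<mu> \<rho> Pstar :: real
  assumes mu_pos: "0 < \<mu>" and rho_pos: "0 < \<rho>"
    and differentiable: "\<And>z. f differentiable (at z)"
    and continuous_grad: "continuous_on UNIV (grad f)"
    and strongly_concave: "\<And>x. concave_on UNIV (\<lambda>y. f (x, y) + \<mu> / 2 * (norm y)\<^sup>2)"
    and grad_lipschitz: "\<And>z z'. norm (grad f z - grad f z') \<le> l * norm (z - z')"
    and differentiable_xx: "\<And>x y. (\<lambda>x'. grad_x f x' y) differentiable (at x)"
    and differentiable_xy: "\<And>x y. (\<lambda>y'. grad_x f x y') differentiable (at y)"
    and differentiable_yx: "\<And>x y. (\<lambda>x'. grad_y f x' y) differentiable (at x)"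
    and differentiable_yy: "\<And>x y. (\<lambda>y'. grad_y f x y') differentiable (at y)"
    and lipschitz_xx: "\<And>z z'. spectral_norm (hess_xx f z - hess_xx f z') \<le> \<rho> * norm (z - z')"
    and lipschitz_xy: "\<And>z z'. spectral_norm (hess_xy f z - hess_xy f z') \<le> \<rho> * norm (z - z')"
    and lipschitz_yx: "\<And>z z'. spectral_norm (hess_yx f z - hess_yx f z') \<le> \<rho> * norm (z - z')"
    and lipschitz_yy: "\<And>z z'. spectral_norm (hess_yy f z - hess_yy f z') \<le> \<rho> * norm (z - z')"
    and bounded_below: "\<And>x. Pstar \<le> max_fun f x"

definition kappa :: "real \<Rightarrow> real \<Rightarrow> real" where "kappa l \<mu> = l / \<mu>"

definition L1 :: "real \<Rightarrow> real \<Rightarrow> real" where "L1 l \<mu> = (kappa l \<mu> + 1) * l"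

definition L2 :: "real \<Rightarrow> real \<Rightarrow> real \<Rightarrow> real" where "L2 l \<mu> \<rho> = \<rho> * (1 + kappa l \<mu>) ^ 3"

definition LH :: "real \<Rightarrow> real \<Rightarrow> real \<Rightarrow> real" where "LH l \<mu> \<rho> = \<rho> * (1 + kappa l \<mu>)\<^sup>2"

definition eps1 :: "real \<Rightarrow> real \<Rightarrow> real \<Rightarrow> real \<Rightarrow> real" where
  "eps1 l \<mu> \<rho> \<epsilon> = Min {1/32, 1/144, sqrt (L2 l \<mu> \<rho>) / (32 * L1 l \<mu>)} * \<epsilon> powr (3/2)"

definition eps2 :: "real \<Rightarrow> real \<Rightarrow> real \<Rightarrow> real \<Rightarrow> real" where
  "eps2 l \<mu> \<rho> \<epsilon> = Min {1/12, 1/36} * sqrt (L2 l \<mu> \<rho>) * \<epsilon> powr (1/2)"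

definition inner_accuracy :: "real \<Rightarrow> real \<Rightarrow> real \<Rightarrow> real \<Rightarrow> real" where
  "inner_accuracy l \<mu> \<rho> \<epsilon> = min (eps1 l \<mu> \<rho> \<epsilon> / l) (eps2 l \<mu> \<rho> \<epsilon> / (2 * LH l \<mu> \<rho>))"

text \<open>The first line makes the gradient and Hessian below genuine derivatives.\<close>

definition second_order_stationary ::
    "(real^'n \<Rightarrow> real) \<Rightarrow> real \<Rightarrow> real \<Rightarrow> real \<Rightarrow> real^'n \<Rightarrow> bool" where
  "second_order_stationary \<phi> \<xi> \<theta> \<epsilon> x \<longleftrightarrow>
     (\<forall>z. \<phi> differentiable (at z)) \<and> grad \<phi> differentiable (at x) \<and>
     norm (grad \<phi> x) \<le> \<xi> * \<epsilon> \<and>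
     (\<forall>v. v \<bullet> (hess \<phi> x *v v) \<ge> - \<theta> * sqrt \<epsilon> * (v \<bullet> v))"


section \<open>Subroutines\<close>

text \<open>State \<open>(y\<^sub>k, y'\<^sub>k)\<close> of accelerated gradient ascent on \<open>f (x, _)\<close>, with \<open>y'\<^sub>k\<close> the extrapolated point.\<close>

fun agd :: "((real^'n) \<times> (real^'m) \<Rightarrow> real) \<Rightarrow> real \<Rightarrow> real \<Rightarrow> real^'n \<Rightarrow> real^'m \<Rightarrow> nat
    \<Rightarrow> (real^'m) \<times> (real^'m)" where
  "agd f \<eta> \<theta> x y0 0 = (y0, y0)"
| "agd f \<eta> \<theta> x y0 (Suc k) =
     (let (y, y') = agd f \<eta> \<theta> x y0 k; ynew = y' + \<eta> *\<^sub>R grad_y f x y'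
      in (ynew, ynew + \<theta> *\<^sub>R (ynew - y)))"

fun chebyshev :: "real^'m^'m \<Rightarrow> nat \<Rightarrow> real^'m^'m" where
  "chebyshev Z 0 = mat 1"
| "chebyshev Z (Suc 0) = Z"
| "chebyshev Z (Suc (Suc k)) = 2 *\<^sub>R (Z ** chebyshev Z (Suc k)) - chebyshev Z k"

text \<open>Chebyshev expansion of \<open>X\<^sup>-\<^sup>1\<close> for symmetric \<open>X\<close> with spectrum in \<open>[\<mu>, l]\<close>, truncated after
  \<open>T\<^sub>K\<close>. If \<open>l = \<mu>\<close> then \<open>X\<close> is \<open>l\<close> times the identity; the divisions by zero make \<open>Z = 0\<close>, \<open>q = 0\<close>
  and the formula returns the exact inverse.\<close>

definition chebyshev_inverse :: "real \<Rightarrow> real \<Rightarrow> nat \<Rightarrow> real^'m^'m \<Rightarrow> real^'m^'m" where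
  "chebyshev_inverse l \<mu> K X =
     (let Z = (2 / (l - \<mu>)) *\<^sub>R X - ((l + \<mu>) / (l - \<mu>)) *\<^sub>R mat 1;
          q = (sqrt l - sqrt \<mu>) / (sqrt l + sqrt \<mu>)
      in (1 / sqrt (l * \<mu>)) *\<^sub>R (mat 1 + 2 *\<^sub>R (\<Sum>k=1..K. (- q) ^ k *\<^sub>R chebyshev Z k)))"

definition approx_hess :: "((real^'n) \<times> (real^'m) \<Rightarrow> real) \<Rightarrow> real \<Rightarrow> real \<Rightarrow> nat
    \<Rightarrow> (real^'n) \<times> (real^'m) \<Rightarrow> real^'n^'n" where
  "approx_hess f l \<mu> K z =
     hess_xx f z + hess_xy f z ** chebyshev_inverse l \<mu> K (- hess_yy f z) ** hess_yx f z"

text \<open>Lanczos three-term recurrence with state \<open>(q\<^sub>k\<^sub>-\<^sub>1, q\<^sub>k, \<beta>\<^sub>k)\<close>; \<open>sgn r\<close> is \<open>r / norm r\<close>. After a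
  breakdown (\<open>r = 0\<close>) all further vectors are \<open>0\<close>, so the span stays at the invariant Krylov space.\<close>

fun lanczos_state :: "real^'n^'n \<Rightarrow> real^'n \<Rightarrow> nat \<Rightarrow> (real^'n) \<times> (real^'n) \<times> real" where
  "lanczos_state A b 0 = (0, sgn b, 0)"
| "lanczos_state A b (Suc k) =
     (let (p, q, \<beta>) = lanczos_state A b k;
          r = A *v q - \<beta> *\<^sub>R p - (q \<bullet> (A *v q)) *\<^sub>R q
      in (q, sgn r, norm r))"

definition lanczos_vector :: "real^'n^'n \<Rightarrow> real^'n \<Rightarrow> nat \<Rightarrow> real^'n" where
  "lanczos_vector A b k = fst (snd (lanczos_state A b k))"

text \<open>Output of \<open>j\<close> Lanczos steps: a least Ritz pair, i.e. the least eigenvalue of the tridiagonal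
  matrix with entries \<open>q\<^sub>i \<bullet> A q\<^sub>k\<close> and a unit eigenvector, lifted to the span of \<open>q\<^sub>0, ..., q\<^sub>j\<^sub>-\<^sub>1\<close>.\<close>

definition lanczos_output :: "real^'n^'n \<Rightarrow> real^'n \<Rightarrow> nat \<Rightarrow> real \<Rightarrow> real^'n \<Rightarrow> bool" where
  "lanczos_output A b j lam u \<longleftrightarrow>
     (let V = span (lanczos_vector A b ` {..<j})
      in u \<in> V \<and> norm u = 1 \<and> lam = u \<bullet> (A *v u) \<and>
         (\<forall>v\<in>V. norm v = 1 \<longrightarrow> lam \<le> v \<bullet> (A *v v)))"

definition lambda_min :: "real^'n^'n \<Rightarrow> real" where
  "lambda_min A = Min {lam. \<exists>v. v \<noteq> 0 \<and> A *v v = lam *\<^sub>R v}"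

definition uniform_sphere :: "(real^'n) measure" where
  "uniform_sphere = distr (uniform_measure lborel (ball 0 1)) borel sgn"

text \<open>Number of steps prescribed for the randomized Lanczos procedure: the fewest steps that, for
  every symmetric matrix of spectral norm at most \<open>B\<close>, estimate the least eigenvalue within
  \<open>tol\<close> with failure probability at most \<open>\<delta>\<close>. It does not depend on the matrix at hand.\<close>

definition lanczos_steps :: "'n::finite itself \<Rightarrow> real \<Rightarrow> real \<Rightarrow> real \<Rightarrow> nat" where
  "lanczos_steps _ B tol \<delta> =
     (LEAST j. 1 \<le> j \<and>
        (\<forall>A :: real^'n^'n. transpose A = A \<and> spectral_norm A \<le> B \<longrightarrow>
           measure uniform_sphere
             {b. \<exists>lam u. lanczos_output A b j lam u \<and> lam \<le> lambda_min A + tol} \<ge> 1 - \<delta>))"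

text \<open>Conjugate gradients for \<open>B s = - g\<close> from \<open>s = 0\<close>, state \<open>(s, r, p)\<close> with residual
  \<open>r = - g - B s\<close> and search direction \<open>p\<close>.\<close>

fun cg :: "real^'n^'n \<Rightarrow> real^'n \<Rightarrow> nat \<Rightarrow> (real^'n) \<times> (real^'n) \<times> (real^'n)" where
  "cg B g 0 = (0, - g, - g)"
| "cg B g (Suc k) =
     (let (s, r, p) = cg B g k;
          \<alpha> = (r \<bullet> r) / (p \<bullet> (B *v p));
          r' = r - \<alpha> *\<^sub>R (B *v p)
      in (s + \<alpha> *\<^sub>R p, r', r' + ((r' \<bullet> r') / (r \<bullet> r)) *\<^sub>R p))"

definition cg_shift :: "real \<Rightarrow> real^'n^'n \<Rightarrow> real^'n \<Rightarrow> real^'n^'n" where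
  "cg_shift L H g = H + sqrt (L * norm g) *\<^sub>R mat 1"

definition cg_accepts :: "real \<Rightarrow> real^'n^'n \<Rightarrow> real^'n \<Rightarrow> nat \<Rightarrow> bool" where
  "cg_accepts L H g k \<longleftrightarrow>
     (let B = cg_shift L H g; s = fst (cg B g k)
      in norm (g + B *v s) \<le> 1/4 * min (norm g) (1/2 * sqrt (L * norm g) * norm s))"

definition cg_iterations :: "real \<Rightarrow> real^'n^'n \<Rightarrow> real^'n \<Rightarrow> nat" where
  "cg_iterations L H g = (LEAST k. cg_accepts L H g k)"


section \<open>The algorithm\<close>

definition curvature_threshold :: "real \<Rightarrow> real \<Rightarrow> real^'n \<Rightarrow> real" where
  "curvature_threshold L \<epsilon> g = 1/4 * sqrt (L * max (norm g) \<epsilon>)"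

definition stops :: "real \<Rightarrow> real \<Rightarrow> real^'n \<Rightarrow> real \<Rightarrow> bool" where
  "stops L \<epsilon> g lam \<longleftrightarrow> \<not> lam \<le> - curvature_threshold L \<epsilon> g \<and> \<not> norm g \<ge> \<epsilon>"

definition lanczos_budget :: "real \<Rightarrow> real \<Rightarrow> real \<Rightarrow> real \<Rightarrow> real \<Rightarrow> real^'n \<Rightarrow> nat" where
  "lanczos_budget l \<mu> \<rho> \<epsilon> \<delta> (g :: real^'n) =
     lanczos_steps TYPE('n) (L1 l \<mu> + eps2 l \<mu> \<rho> \<epsilon>) (curvature_threshold (L2 l \<mu> \<rho>) \<epsilon> g) \<delta>"

text \<open>One iteration, with previous inner iterate \<open>yp\<close>, Lanczos starting vector \<open>b\<close> and \<open>K\<close> Chebyshev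
  terms. If no conjugate gradient iterate meets the tolerance, which can only happen when the Lanczos
  estimate has failed, the step \<open>s\<close> is left unspecified. The Lanczos norm bound is valid because
  \<open>hess (max_fun f)\<close> has spectral norm at most \<open>L1\<close>.\<close>

definition ilm_step :: "((real^'n) \<times> (real^'m) \<Rightarrow> real) \<Rightarrow> real \<Rightarrow> real \<Rightarrow> real \<Rightarrow> real \<Rightarrow> real
    \<Rightarrow> real^'n \<Rightarrow> real^'m \<Rightarrow> nat \<Rightarrow> nat \<Rightarrow> real^'n \<Rightarrow> real^'m \<Rightarrow> real \<Rightarrow> real^'n \<Rightarrow> real^'n \<Rightarrow> real^'n
    \<Rightarrow> bool" where
  "ilm_step f l \<mu> \<rho> \<epsilon> \<delta> b yp N K x y lam u s x' \<longleftrightarrow>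
     (let \<kappa> = kappa l \<mu>; L = L2 l \<mu> \<rho>; g = grad_x f x y; H = approx_hess f l \<mu> K (x, y) in
       y = fst (agd f (1 / l) ((sqrt \<kappa> - 1) / (sqrt \<kappa> + 1)) x yp N) \<and>
       spectral_norm (H - hess (max_fun f) x) \<le> eps2 l \<mu> \<rho> \<epsilon> \<and>
       lanczos_output H b (lanczos_budget l \<mu> \<rho> \<epsilon> \<delta> g) lam u \<and> g \<bullet> u \<le> 0 \<and>
       (if lam \<le> - curvature_threshold L \<epsilon> g then
          s = (1/2 * sqrt (max (norm g) \<epsilon> / L)) *\<^sub>R u
        else if norm g \<ge> \<epsilon> then
          (\<exists>k. cg_accepts L H g k) \<longrightarrow> s = fst (cg (cg_shift L H g) g (cg_iterations L H g))
        else True) \<and>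
       (\<not> stops L \<epsilon> g lam \<longrightarrow> x' = x + s))"

text \<open>A single trajectory; nothing is required of the sequences once the algorithm has stopped.\<close>

definition ilm_run :: "((real^'n) \<times> (real^'m) \<Rightarrow> real) \<Rightarrow> real \<Rightarrow> real \<Rightarrow> real \<Rightarrow> real \<Rightarrow> real
    \<Rightarrow> real^'n \<Rightarrow> real^'m \<Rightarrow> (nat \<Rightarrow> real^'n) \<Rightarrow> (nat \<Rightarrow> nat) \<Rightarrow> (nat \<Rightarrow> nat)
    \<Rightarrow> (nat \<Rightarrow> real^'n) \<Rightarrow> (nat \<Rightarrow> real^'m) \<Rightarrow> (nat \<Rightarrow> real) \<Rightarrow> (nat \<Rightarrow> real^'n) \<Rightarrow> (nat \<Rightarrow> real^'n)
    \<Rightarrow> bool" where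
  "ilm_run f l \<mu> \<rho> \<epsilon> \<delta> x0 ym1 b N K x y lam u s \<longleftrightarrow>
     (let \<kappa> = kappa l \<mu>; a = inner_accuracy l \<mu> \<rho> \<epsilon> in
       x 0 = x0 \<and>
       (\<forall>t. (\<forall>\<tau><t. \<not> stops (L2 l \<mu> \<rho>) \<epsilon> (grad_x f (x \<tau>) (y \<tau>)) (lam \<tau>)) \<longrightarrow>
          real (N t) \<ge>
            (if t = 0 then 2 * sqrt \<kappa> * ln (sqrt (\<kappa> + 1) * norm (ym1 - y_star f x0) / a)
             else 2 * sqrt \<kappa> * ln (sqrt (\<kappa> + 1) * (a + \<kappa> * norm (s (t - 1))) / a)) \<and>
          ilm_step f l \<mu> \<rho> \<epsilon> \<delta> (b t) (if t = 0 then ym1 else y (t - 1)) (N t) (K t)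
            (x t) (y t) (lam t) (u t) (s t) (x (Suc t))))"

text \<open>The random process. \<open>F t\<close> is the information available when the \<open>t\<close>-th Lanczos starting
  vector \<open>b t\<close> is drawn, which is uniform on the unit sphere and independent of \<open>F t\<close>.\<close>

definition ilm_process :: "((real^'n) \<times> (real^'m) \<Rightarrow> real) \<Rightarrow> real \<Rightarrow> real \<Rightarrow> real \<Rightarrow> real \<Rightarrow> real
    \<Rightarrow> real^'n \<Rightarrow> real^'m \<Rightarrow> 'w measure \<Rightarrow> (nat \<Rightarrow> 'w measure) \<Rightarrow> (nat \<Rightarrow> 'w \<Rightarrow> real^'n)
    \<Rightarrow> (nat \<Rightarrow> 'w \<Rightarrow> nat) \<Rightarrow> (nat \<Rightarrow> 'w \<Rightarrow> nat) \<Rightarrow> (nat \<Rightarrow> 'w \<Rightarrow> real^'n) \<Rightarrow> (nat \<Rightarrow> 'w \<Rightarrow> real^'m)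
    \<Rightarrow> (nat \<Rightarrow> 'w \<Rightarrow> real) \<Rightarrow> (nat \<Rightarrow> 'w \<Rightarrow> real^'n) \<Rightarrow> (nat \<Rightarrow> 'w \<Rightarrow> real^'n) \<Rightarrow> bool" where
  "ilm_process f l \<mu> \<rho> \<epsilon> \<delta> x0 ym1 M F b N K x y lam u s \<longleftrightarrow>
     prob_space M \<and> filtration (space M) F \<and> (\<forall>t. subalgebra M (F t)) \<and>
     (\<forall>t. x t \<in> borel_measurable (F t) \<and> y t \<in> borel_measurable (F t) \<and>
          K t \<in> measurable (F t) (count_space UNIV) \<and> b t \<in> borel_measurable (F (Suc t))) \<and>
     (\<forall>t. distr M borel (b t) = uniform_sphere \<and>
          prob_space.indep_set M (sets (F t)) {b t -` B \<inter> space M | B. B \<in> sets borel}) \<and>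
     (AE \<omega> in M. ilm_run f l \<mu> \<rho> \<epsilon> \<delta> x0 ym1 (\<lambda>t. b t \<omega>) (\<lambda>t. N t \<omega>) (\<lambda>t. K t \<omega>)
        (\<lambda>t. x t \<omega>) (\<lambda>t. y t \<omega>) (\<lambda>t. lam t \<omega>) (\<lambda>t. u t \<omega>) (\<lambda>t. s t \<omega>))"

definition reaches_target :: "real \<Rightarrow> real \<Rightarrow> real^'n \<Rightarrow> real \<Rightarrow> bool" where
  "reaches_target L \<epsilon> g lam \<longleftrightarrow> norm g \<le> \<epsilon> \<and> lam \<ge> - (1/4 * sqrt (L * \<epsilon>))"

text \<open>Hessian-vector products spent until \<open>T\<close> is recognised as the target iteration. Multiplying
  \<open>approx_hess\<close> by a vector takes one product with each of the \<open>xx\<close>, \<open>yx\<close>, \<open>xy\<close> blocks and \<open>K\<close>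
  products with the \<open>yy\<close> block (three-term Chebyshev recurrence). Every Lanczos step and every
  conjugate gradient iteration performs one such multiplication.\<close>

definition hessian_vector_products :: "((real^'n) \<times> (real^'m) \<Rightarrow> real) \<Rightarrow> real \<Rightarrow> real \<Rightarrow> real \<Rightarrow> real
    \<Rightarrow> real \<Rightarrow> (nat \<Rightarrow> nat) \<Rightarrow> (nat \<Rightarrow> real^'n) \<Rightarrow> (nat \<Rightarrow> real^'m) \<Rightarrow> (nat \<Rightarrow> real) \<Rightarrow> nat \<Rightarrow> nat" where
  "hessian_vector_products f l \<mu> \<rho> \<epsilon> \<delta> K x y lam T =
     (let L = L2 l \<mu> \<rho>; g = (\<lambda>t. grad_x f (x t) (y t)) in
       (\<Sum>t\<le>T. (K t + 3) * lanczos_budget l \<mu> \<rho> \<epsilon> \<delta> (g t)) +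
       (\<Sum>t<T. if \<not> lam t \<le> - curvature_threshold L \<epsilon> (g t) \<and> norm (g t) \<ge> \<epsilon>
          then (K t + 3) * cg_iterations L (approx_hess f l \<mu> (K t) (x t, y t)) (g t) else 0))"

text \<open>The logarithmic factors hidden by the soft-O notation; \<open>n\<close> is the dimension of \<open>x\<close>, \<open>\<Delta>\<close> the
  initial gap and \<open>p\<close> the overall failure probability.\<close>

definition log_factor :: "nat \<Rightarrow> real \<Rightarrow> real \<Rightarrow> real \<Rightarrow> real \<Rightarrow> real \<Rightarrow> real \<Rightarrow> real" where
  "log_factor n l \<mu> \<rho> \<Delta> \<epsilon> p =
     1 + ln (real n) + \<bar>ln l\<bar> + \<bar>ln \<mu>\<bar> + \<bar>ln \<rho>\<bar> + ln (1 + \<Delta>) + \<bar>ln \<epsilon>\<bar> + ln (1 / p)"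

end

theory Submission
  imports Defs
begin

text \<open>Implicit differentiation of \<open>grad_y f x (y_star f x) = 0\<close> gives the maximal function \<open>P\<close> an
  \<open>L1\<close>-Lipschitz gradient and an \<open>L2\<close>-Lipschitz Hessian. A negative curvature step lowers \<open>P\<close> by a multiple
  of \<open>\<epsilon>\<^bsup>3/2\<^esup> / sqrt L2\<close>, and so does an inexact Newton step unless it halves the gradient, which can happen
  only logarithmically often in a row. A potential that adds the number of remaining halvings to a multiple
  of \<open>P - Pstar\<close> therefore bounds the number of iterations.

  The cost per iteration rests on the Lyapunov function of momentum gradient descent. It controls the inner
  loop directly; it bounds conjugate gradients, which are optimal in a Krylov space containing the momentum
  iterates; and applied to each eigencomponent it yields a good Krylov vector for the Lanczos procedure
  whenever the starting vector is not almost orthogonal to a least eigenvector. The exceptional starting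
  vectors fill a thin slab of the ball. As the starting vector is independent of the current matrix, Fubini
  bounds the failure probability of a single iteration, and a union bound that of the whole run.\<close>

text \<open>The rate is a product of three factors: of order
  \<open>sqrt L2 / \<epsilon> powr (3/2)\<close> iterations, \<open>sqrt \<kappa>\<close> Chebyshev
  terms per multiplication, and, for both Krylov methods, the root of a condition number of order
  \<open>L1 / sqrt (L2 * \<epsilon>)\<close>. With \<open>L1\<close> of order
  \<open>\<kappa> l\<close> and \<open>L2\<close> of order \<open>\<rho> \<kappa>^3\<close> the
  exponents of the target follow. The two smallness conditions on \<epsilon> make the first factor
  and the condition number at least 1, so that additive constants can be absorbed.

  The obstacle is probabilistic. Matrices and tolerances depend on all earlier starting vectors, and
  once the run has stopped nothing controls them. The failure event of iteration t is therefore
  defined for every t, guarded only by a norm bound on the matrix. The number of Lanczos steps is a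
  Borel function of the tolerance alone, so matrix and step count are fixed before the starting
  vector is integrated out. The iteration bound in the union bound does not involve \<delta>, so
  \<delta> can be computed from it without circularity and reappears only inside logarithms.\<close>

section \<open>Accelerated gradient descent\<close>

text \<open>With \<open>q\<^sup>2 = L / m\<close> and \<open>v = z + q (z - y)\<close>, one step contracts the Lyapunov function
  \<open>h y - h xs + m/2 |v - xs|\<^sup>2\<close> by the factor \<open>1 - 1/q\<close>.\<close>

lemma accelerated_gradient_step:
  fixes h :: "'a::real_inner \<Rightarrow> real" and G :: "'a \<Rightarrow> 'a"
  assumes m: "0 < m" and q: "1 \<le> q"
    and sc: "\<And>u w. h u + G u \<bullet> (w - u) + m/2 * ((w - u) \<bullet> (w - u)) \<le> h w"
    and sm: "\<And>u w. h w \<le> h u + G u \<bullet> (w - u) + (q\<^sup>2 * m)/2 * ((w - u) \<bullet> (w - u))"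
    and y': "y' = z - (1/(q\<^sup>2 * m)) *\<^sub>R G z"
    and z': "z' = y' + ((q - 1)/(q + 1)) *\<^sub>R (y' - y)"
    and v: "v = z + q *\<^sub>R (z - y)" and v': "v' = z' + q *\<^sub>R (z' - y')"
  shows "h y' - h xs + m/2 * ((v' - xs) \<bullet> (v' - xs))
           \<le> (1 - 1/q) * (h y - h xs + m/2 * ((v - xs) \<bullet> (v - xs)))"
proof -
  define e d g where "e = z - xs" and "d = z - y" and "g = G z"
  define a where "a = 1 / (q * m)"
  have q0: "q > 0" using q by simp
  have vx: "v - xs = e + q *\<^sub>R d" by (simp add: v e_def d_def)
  have "z' - y' = ((q - 1)/(q + 1)) *\<^sub>R (y' - y)" by (simp add: z')
  then have "v' = y' + (1 + q) *\<^sub>R (((q - 1)/(q + 1)) *\<^sub>R (y' - y))"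
    unfolding v' z' by (simp only: add_diff_cancel_left' scaleR_add_left scaleR_one add.assoc)
  also have "\<dots> = y' + ((1 + q) * ((q - 1)/(q + 1))) *\<^sub>R (y' - y)" by (simp only: scaleR_scaleR)
  also have "(1 + q) * ((q - 1)/(q + 1)) = q - 1" using q0 by (simp add: field_simps)
  finally have "v' - xs = e - (1/(q\<^sup>2 * m)) *\<^sub>R g + (q - 1) *\<^sub>R (d - (1/(q\<^sup>2 * m)) *\<^sub>R g)"
    by (simp add: y' e_def d_def g_def algebra_simps)
  also have "\<dots> = e + (q - 1) *\<^sub>R d - (q * (1/(q\<^sup>2 * m))) *\<^sub>R g"
    unfolding left_diff_distrib scaleR_diff_right scaleR_diff_left by simp
  also have "q * (1/(q\<^sup>2 * m)) = a" using q0 m by (simp add: a_def field_simps power2_eq_square)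
  finally have vx': "v' - xs = e + (q - 1) *\<^sub>R d - a *\<^sub>R g" .
  have E1: "(v - xs) \<bullet> (v - xs) = e \<bullet> e + 2 * q * (e \<bullet> d) + q\<^sup>2 * (d \<bullet> d)"
    unfolding vx by (simp add: algebra_simps inner_commute power2_eq_square)
  have E2: "(v' - xs) \<bullet> (v' - xs) = e \<bullet> e + 2 * (q - 1) * (e \<bullet> d) + (q - 1)\<^sup>2 * (d \<bullet> d)
      - 2 * a * (g \<bullet> e + (q - 1) * (g \<bullet> d)) + a\<^sup>2 * (g \<bullet> g)"
    unfolding vx' by (simp add: algebra_simps inner_commute power2_eq_square)
  have "h y' \<le> h z - (1/(2 * q\<^sup>2 * m)) * (g \<bullet> g)"
  proof -
    have "h y' \<le> h z + g \<bullet> (y' - z) + (q\<^sup>2 * m)/2 * ((y' - z) \<bullet> (y' - z))"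
      using sm[of y' z] by (simp add: g_def)
    moreover have "y' - z = - (1/(q\<^sup>2 * m)) *\<^sub>R g" by (simp add: y' g_def)
    ultimately show ?thesis using q0 m by (simp add: field_simps power2_eq_square)
  qed
  \<comment> \<open>The gain of the gradient step equals the squared-gradient term of the new
    distance, so the two cancel in \<open>up\<close>.\<close>
  moreover have "m/2 * (a\<^sup>2 * (g \<bullet> g)) = (1/(2 * q\<^sup>2 * m)) * (g \<bullet> g)"
    using q0 m by (simp add: a_def field_simps power2_eq_square)
  moreover have "m/2 * (2 * a * (g \<bullet> e + (q - 1) * (g \<bullet> d))) = (1/q) * (g \<bullet> e) + (1 - 1/q) * (g \<bullet> d)"
    using q0 m by (simp add: a_def field_simps)
  ultimately have up: "h y' + m/2 * ((v' - xs) \<bullet> (v' - xs))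
      \<le> h z + m/2 * (e \<bullet> e + 2 * (q - 1) * (e \<bullet> d) + (q - 1)\<^sup>2 * (d \<bullet> d))
         - ((1/q) * (g \<bullet> e) + (1 - 1/q) * (g \<bullet> d))"
    unfolding E2 by (simp add: algebra_simps)
  \<comment> \<open>Strong convexity at \<open>z\<close> is tested against \<open>xs\<close> with
    weight \<open>1/q\<close> and against \<open>y\<close> with weight \<open>1 - 1/q\<close>; these
    weights reproduce the linear terms of \<open>up\<close>.\<close>
  have s1: "(1/q) * (h z - g \<bullet> e + m/2 * (e \<bullet> e)) \<le> (1/q) * h xs"
    using sc[of z xs] q0 by (intro mult_left_mono) (auto simp: g_def e_def algebra_simps inner_commute)
  have s2: "(1 - 1/q) * (h z - g \<bullet> d + m/2 * (d \<bullet> d)) \<le> (1 - 1/q) * h y"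
    using sc[of z y] q by (intro mult_left_mono) (auto simp: g_def d_def algebra_simps inner_commute)
  have "m/2 * (e \<bullet> e + 2 * (q - 1) * (e \<bullet> d) + (q - 1)\<^sup>2 * (d \<bullet> d))
      \<le> (1 - 1/q) * (m/2 * (e \<bullet> e + 2 * q * (e \<bullet> d) + q\<^sup>2 * (d \<bullet> d)))
         + (1/q) * (m/2 * (e \<bullet> e)) + (1 - 1/q) * (m/2 * (d \<bullet> d))"
  proof -
    have "(1 - 1/q) * (m/2 * (e \<bullet> e + 2 * q * (e \<bullet> d) + q\<^sup>2 * (d \<bullet> d)))
         + (1/q) * (m/2 * (e \<bullet> e)) + (1 - 1/q) * (m/2 * (d \<bullet> d))
         - m/2 * (e \<bullet> e + 2 * (q - 1) * (e \<bullet> d) + (q - 1)\<^sup>2 * (d \<bullet> d))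
        = m/2 * (d \<bullet> d) * ((q - 1) + (1 - 1/q))"
      using q0 by (simp add: field_simps power2_eq_square)
    moreover have "\<dots> \<ge> 0"
    proof -
      have "1/q \<le> 1" using q by simp
      then have "(q - 1) + (1 - 1/q) \<ge> 0" using q by linarith
      then show ?thesis using m by (intro mult_nonneg_nonneg) auto
    qed
    ultimately show ?thesis by linarith
  qed
  then show ?thesis using up s1 s2 unfolding E1 by (simp add: algebra_simps)
qed

text \<open>Iterates the contraction from \<open>v 0 = y 0\<close>, using that
  \<open>1 - 1/q\<close> is at most \<open>exp (- 1/q)\<close>. The gap form serves conjugate
  gradients, which are optimal for the objective; the distance form serves the inner loop and the
  scalar eigencomponents of Lanczos.\<close>

lemma accelerated_gradient_rate:
  fixes h :: "'a::real_inner \<Rightarrow> real" and G :: "'a \<Rightarrow> 'a" and y z :: "nat \<Rightarrow> 'a"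
  assumes m: "0 < m" and mL: "m \<le> L"
    and sc: "\<And>u w. h u + G u \<bullet> (w - u) + m/2 * ((w - u) \<bullet> (w - u)) \<le> h w"
    and sm: "\<And>u w. h w \<le> h u + G u \<bullet> (w - u) + L/2 * ((w - u) \<bullet> (w - u))"
    and crit: "G xs = 0"
    and z0: "z 0 = y 0"
    and yS: "\<And>k. y (Suc k) = z k - (1/L) *\<^sub>R G (z k)"
    and zS: "\<And>k. z (Suc k) = y (Suc k)
               + ((sqrt (L/m) - 1)/(sqrt (L/m) + 1)) *\<^sub>R (y (Suc k) - y k)"
  shows "h (y k) - h xs \<le> exp (- real k / sqrt (L/m)) * ((L + m)/2 * ((y 0 - xs) \<bullet> (y 0 - xs)))"
    and "(y k - xs) \<bullet> (y k - xs)
           \<le> (L/m + 1) * exp (- real k / sqrt (L/m)) * ((y 0 - xs) \<bullet> (y 0 - xs))"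
proof -
  define q where "q = sqrt (L/m)"
  have q: "1 \<le> q" using m mL by (simp add: q_def)
  have L: "L = q\<^sup>2 * m" using m mL by (simp add: q_def)
  define v where "v k = z k + q *\<^sub>R (z k - y k)" for k
  define V where "V k = h (y k) - h xs + m/2 * ((v k - xs) \<bullet> (v k - xs))" for k
  define D where "D = (L + m)/2 * ((y 0 - xs) \<bullet> (y 0 - xs))"
  have step: "V (Suc k) \<le> (1 - 1/q) * V k" for k
    unfolding V_def
    by (rule accelerated_gradient_step[OF m q sc sm[unfolded L] yS[unfolded L]
          zS[folded q_def] v_def v_def])
  have hlow: "m/2 * ((y k - xs) \<bullet> (y k - xs)) \<le> h (y k) - h xs" for k
    using sc[of xs "y k"] crit by simp
  have "V 0 \<le> D"
    using sm[of "y 0" xs] crit by (simp add: V_def v_def z0 D_def field_simps)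
  then have pow: "V k \<le> (1 - 1/q) ^ k * D" for k
  proof (induction k)
    case (Suc k)
    have "V (Suc k) \<le> (1 - 1/q) * ((1 - 1/q) ^ k * D)"
      using step[of k] Suc q by (meson diff_ge_0_iff_ge divide_le_eq_1_pos le_numeral_extra(4)
          mult_left_mono order_trans less_le_trans zero_less_one)
    then show ?case by simp
  qed simp
  have D0: "D \<ge> 0" using m mL by (simp add: D_def)
  have "(1 - 1/q) ^ k \<le> exp (- real k / q)"
  proof -
    have "(1 - 1/q) ^ k \<le> exp (- 1/q) ^ k"
      using exp_ge_add_one_self[of "- 1/q"] q by (intro power_mono) auto
    then show ?thesis by (simp add: exp_of_nat_mult[symmetric])
  qed
  from mult_right_mono[OF this D0] pow[of k]
  have bnd: "V k \<le> exp (- real k / q) * D" by linarith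
  have "h (y k) - h xs \<le> V k" using m by (simp add: V_def)
  with bnd show one: "h (y k) - h xs \<le> exp (- real k / sqrt (L/m)) * ((L + m)/2 * ((y 0 - xs) \<bullet> (y 0 - xs)))"
    unfolding q_def D_def by linarith
  have "m/2 * ((y k - xs) \<bullet> (y k - xs))
      \<le> m/2 * ((L/m + 1) * exp (- real k / sqrt (L/m)) * ((y 0 - xs) \<bullet> (y 0 - xs)))"
  proof -
    define w where "w = (y 0 - xs) \<bullet> (y 0 - xs) * exp (- real k / sqrt (L/m))"
    have "(L + m)/2 * w = m/2 * ((L/m + 1) * w)" using m by (simp add: field_simps)
    moreover have "m/2 * ((y k - xs) \<bullet> (y k - xs)) \<le> (L + m)/2 * w"
      using order_trans[OF hlow[of k] one] by (simp add: w_def mult_ac)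
    ultimately have "m/2 * ((y k - xs) \<bullet> (y k - xs)) \<le> m/2 * ((L/m + 1) * w)" by (simp only:)
    then show ?thesis by (simp only: w_def mult_ac)
  qed
  then show "(y k - xs) \<bullet> (y k - xs)
           \<le> (L/m + 1) * exp (- real k / sqrt (L/m)) * ((y 0 - xs) \<bullet> (y 0 - xs))"
    using m by simp
qed

section \<open>Symmetric matrices\<close>

lemma symmetric_inner:
  fixes A :: "real^'n^'n"
  assumes "transpose A = A"
  shows "(A *v x) \<bullet> y = x \<bullet> (A *v y)"
  by (metis assms dot_lmul_matrix transpose_matrix_vector)

lemma transpose_eqI:
  fixes A :: "real^'n^'m"
  assumes "\<And>x y. (A *v x) \<bullet> y = x \<bullet> (B *v y)"
  shows "transpose A = B"
proof -
  have "x \<bullet> (transpose A *v y) = x \<bullet> (B *v y)" for x y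
    using assms[of x y] by (metis dot_lmul_matrix inner_commute transpose_matrix_vector)
  then show ?thesis
    by (metis matrix_eq vector_eq_ldot)
qed

lemma spectral_norm_bound: "norm (A *v x) \<le> spectral_norm A * norm x"
  unfolding spectral_norm_def by (rule onorm) (simp add: matrix_vector_mul_bounded_linear)

lemma spectral_norm_le:
  assumes "\<And>x. norm (A *v x) \<le> b * norm x"
  shows "spectral_norm A \<le> b"
  unfolding spectral_norm_def by (rule onorm_le) (use assms in auto)

lemma spectral_norm_nonneg: "0 \<le> spectral_norm (A :: real^'n^'m)"
  unfolding spectral_norm_def by (rule onorm_pos_le) (simp add: matrix_vector_mul_bounded_linear)

lemma spectral_norm_quadratic: "\<bar>x \<bullet> (A *v x)\<bar> \<le> spectral_norm A * (x \<bullet> x)"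
proof -
  have "\<bar>x \<bullet> (A *v x)\<bar> \<le> norm x * norm (A *v x)" by (rule Cauchy_Schwarz_ineq2)
  also have "\<dots> \<le> norm x * (spectral_norm A * norm x)"
    by (intro mult_left_mono spectral_norm_bound) auto
  also have "\<dots> = spectral_norm A * (x \<bullet> x)"
    by (simp add: power2_norm_eq_inner[symmetric] power2_eq_square)
  finally show ?thesis .
qed

text \<open>Moving from \<open>e\<close> along \<open>w = A e - l e\<close> changes the shifted
  quadratic form by \<open>2 t |w|^2 + t^2 c\<close>. This is nonnegative for both signs of t, which
  forces \<open>w = 0\<close>. Working inside an invariant subspace prepares deflation.\<close>

lemma rayleigh_min_eigenvector:
  fixes A :: "real^'n^'n"
  assumes sym: "transpose A = A" and S: "subspace S" and inv: "\<And>x. x \<in> S \<Longrightarrow> A *v x \<in> S"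
    and e: "e \<in> S" "norm e = 1"
    and min: "\<And>x. x \<in> S \<Longrightarrow> norm x = 1 \<Longrightarrow> e \<bullet> (A *v e) \<le> x \<bullet> (A *v x)"
  shows "A *v e = (e \<bullet> (A *v e)) *\<^sub>R e"
proof -
  define l where "l = e \<bullet> (A *v e)"
  have nonneg: "0 \<le> x \<bullet> (A *v x) - l * (x \<bullet> x)" if "x \<in> S" for x
  proof (cases "x = 0")
    case False
    have "l \<le> (x /\<^sub>R norm x) \<bullet> (A *v (x /\<^sub>R norm x))"
      unfolding l_def using False S that by (intro min) (auto simp: subspace_scale)
    also have "\<dots> = (x \<bullet> (A *v x)) / (x \<bullet> x)"
      by (simp add: matrix_vector_mult_scaleR power2_norm_eq_inner[symmetric] power2_eq_square field_simps)
    finally show ?thesis using False by (simp add: pos_le_divide_eq)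
  qed simp
  define w where "w = A *v e - l *\<^sub>R e"
  have wS: "w \<in> S" unfolding w_def using e S inv by (auto intro: subspace_diff subspace_scale)
  have ee: "e \<bullet> e = 1" using e by (simp add: power2_norm_eq_inner[symmetric])
  define c where "c = w \<bullet> (A *v w) - l * (w \<bullet> w)"
  have Aew: "w \<bullet> (A *v e) = w \<bullet> w + l * (w \<bullet> e)" by (simp add: w_def algebra_simps)
  have Awe: "e \<bullet> (A *v w) = w \<bullet> w + l * (w \<bullet> e)"
    using Aew symmetric_inner[OF sym, of w e] symmetric_inner[OF sym, of e w] by (simp add: inner_commute)
  have "0 \<le> 2 * t * (w \<bullet> w) + t\<^sup>2 * c" for t
  proof -
    have "e + t *\<^sub>R w \<in> S" using e wS S by (auto intro: subspace_add subspace_scale)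
    from nonneg[OF this]
    have "0 \<le> (e + t *\<^sub>R w) \<bullet> (A *v e + t *\<^sub>R (A *v w)) - l * ((e + t *\<^sub>R w) \<bullet> (e + t *\<^sub>R w))"
      by (simp add: matrix_vector_right_distrib matrix_vector_mult_scaleR)
    also have "\<dots> = 2 * t * (w \<bullet> w) + t\<^sup>2 * c"
      by (simp add: inner_add_left inner_add_right Aew Awe ee c_def l_def[symmetric]
          algebra_simps power2_eq_square inner_commute[of e w])
    finally show ?thesis .
  qed
  note quad = this
  have "w \<bullet> w = 0"
  proof (rule ccontr)
    assume "w \<bullet> w \<noteq> 0"
    then have W: "w \<bullet> w > 0" by (simp add: order_less_le)
    define t where "t = - (w \<bullet> w) / (\<bar>c\<bar> + 1)"
    have t: "t < 0" using W by (simp add: t_def divide_neg_pos)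
    have "\<bar>t\<bar> * c \<le> w \<bullet> w"
    proof -
      have "\<bar>t\<bar> * c \<le> \<bar>t\<bar> * (\<bar>c\<bar> + 1)" by (intro mult_left_mono) auto
      also have "\<dots> = w \<bullet> w" using W by (simp add: t_def)
      finally show ?thesis .
    qed
    then have "2 * (w \<bullet> w) - \<bar>t\<bar> * c > 0" using W by linarith
    then have "t * (2 * (w \<bullet> w) + t * c) < 0" using t by (simp add: mult_neg_pos)
    then show False using quad[of t] by (simp add: algebra_simps power2_eq_square)
  qed
  then show ?thesis by (simp add: w_def l_def)
qed

text \<open>Spectral theorem by deflation: a minimiser of the Rayleigh quotient on the unit sphere
  of \<open>S\<close> is an eigenvector, and by symmetry its orthogonal complement in
  \<open>S\<close> is again invariant, of smaller dimension.\<close>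

lemma symmetric_eigenbasis_subspace:
  fixes A :: "real^'n^'n"
  assumes sym: "transpose A = A"
  shows "subspace S \<Longrightarrow> (\<And>x. x \<in> S \<Longrightarrow> A *v x \<in> S) \<Longrightarrow>
    \<exists>E. finite E \<and> pairwise orthogonal E \<and> (\<forall>e\<in>E. norm e = 1 \<and> A *v e = (e \<bullet> (A *v e)) *\<^sub>R e) \<and> span E = S"
proof (induction "dim S" arbitrary: S rule: less_induct)
  case less
  show ?case
  proof (cases "S \<subseteq> {0}")
    case True
    then have "S = {0}" using less.prems(1) subspace_0 by blast
    then show ?thesis by (intro exI[of _ "{}"]) auto
  next
    case False
    then obtain x0 where x0: "x0 \<in> S" "x0 \<noteq> 0" by auto
    have "compact (S \<inter> sphere 0 1)"
      using less.prems(1) by (intro closed_Int_compact closed_subspace) auto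
    moreover have "x0 /\<^sub>R norm x0 \<in> S \<inter> sphere 0 1"
      using x0 less.prems(1) by (auto simp: subspace_scale)
    then have "S \<inter> sphere 0 1 \<noteq> {}" by blast
    moreover have "continuous_on (S \<inter> sphere 0 1) (\<lambda>x. x \<bullet> (A *v x))"
      by (intro continuous_intros)
    ultimately obtain e where e: "e \<in> S" "norm e = 1"
      and min: "\<And>x. x \<in> S \<Longrightarrow> norm x = 1 \<Longrightarrow> e \<bullet> (A *v e) \<le> x \<bullet> (A *v x)"
      using continuous_attains_inf[of "S \<inter> sphere 0 1" "\<lambda>x. x \<bullet> (A *v x)"] by force
    have eig: "A *v e = (e \<bullet> (A *v e)) *\<^sub>R e"
      by (rule rayleigh_min_eigenvector[OF sym less.prems e min])
    define T where "T = S \<inter> {x. e \<bullet> x = 0}"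
    have subT: "subspace T" unfolding T_def
      by (intro subspace_inter less.prems subspace_hyperplane)
    have ee: "e \<bullet> e = 1" using e by (simp add: power2_norm_eq_inner[symmetric])
    have invT: "A *v x \<in> T" if "x \<in> T" for x
    proof -
      have "e \<bullet> (A *v x) = (A *v e) \<bullet> x" using symmetric_inner[OF sym] by simp
      also have "\<dots> = 0" using that by (subst eig) (simp add: T_def)
      finally show ?thesis using that less.prems by (simp add: T_def)
    qed
    have "e \<notin> T" by (simp add: T_def ee)
    then have "T \<subset> S" using e unfolding T_def by blast
    then have "dim T < dim S"
      using subT less.prems(1) by (metis dim_subset le_neq_implies_less psubset_eq subspace_dim_equal order_refl)
    from less.hyps[OF this subT invT]
    obtain E where E: "finite E" "pairwise orthogonal E"
      "\<forall>e\<in>E. norm e = 1 \<and> A *v e = (e \<bullet> (A *v e)) *\<^sub>R e" "span E = T" by blast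
    have ET: "E \<subseteq> T" using E(4) span_superset by blast
    have "span (insert e E) = S"
    proof
      show "span (insert e E) \<subseteq> S"
        using e ET less.prems(1) by (intro span_minimal) (auto simp: T_def)
      show "S \<subseteq> span (insert e E)"
      proof
        fix x assume x: "x \<in> S"
        have "x - (e \<bullet> x) *\<^sub>R e \<in> T"
          using x e less.prems(1) ee by (auto simp: T_def subspace_diff subspace_scale algebra_simps)
        then have "x - (e \<bullet> x) *\<^sub>R e \<in> span E" using E(4) by simp
        then show "x \<in> span (insert e E)" by (auto simp: span_breakdown_eq)
      qed
    qed
    moreover have "pairwise orthogonal (insert e E)"
      using E(2) ET by (auto simp: pairwise_insert T_def orthogonal_def inner_commute)
    moreover have "\<forall>e'\<in>insert e E. norm e' = 1 \<and> A *v e' = (e' \<bullet> (A *v e')) *\<^sub>R e'"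
      using E(3) e(2) eig by blast
    ultimately show ?thesis using E(1) by blast
  qed
qed

text \<open>Completeness is put in Parseval form, which turns quadratic forms of \<open>A\<close>
  into weighted sums of squares.\<close>

lemma symmetric_eigenbasis:
  fixes A :: "real^'n^'n"
  assumes "transpose A = A"
  obtains E ev where "finite E" "\<And>e. e \<in> E \<Longrightarrow> norm e = 1" "\<And>e. e \<in> E \<Longrightarrow> A *v e = ev e *\<^sub>R e"
    "\<And>x y. x \<bullet> y = (\<Sum>e\<in>E. (x \<bullet> e) * (y \<bullet> e))"
proof -
  obtain E where E: "finite E" "pairwise orthogonal E"
    "\<forall>e\<in>E. norm e = 1 \<and> A *v e = (e \<bullet> (A *v e)) *\<^sub>R e" "span E = UNIV"
    using symmetric_eigenbasis_subspace[OF assms, of UNIV] subspace_UNIV by blast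
  have ortho: "e' \<bullet> e = (if e' = e then 1 else 0)" if "e \<in> E" "e' \<in> E" for e e'
  proof -
    have "norm e = 1" using E(3) that by blast
    then show ?thesis using E(2) that by (auto simp: pairwise_def orthogonal_def norm_eq_1)
  qed
  have expand: "x = (\<Sum>e\<in>E. (x \<bullet> e) *\<^sub>R e)" for x
  proof -
    define d where "d = x - (\<Sum>e\<in>E. (x \<bullet> e) *\<^sub>R e)"
    have "d \<bullet> e = 0" if "e \<in> E" for e
    proof -
      have "(\<Sum>e'\<in>E. (x \<bullet> e') * (e' \<bullet> e)) = (\<Sum>e'\<in>E. if e' = e then x \<bullet> e' else 0)"
        using ortho that by (intro sum.cong) auto
      then show ?thesis using that E(1) by (simp add: d_def inner_diff_left inner_sum_left)
    qed
    moreover have "d \<in> span E" using E(4) by simp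
    ultimately have "orthogonal d d"
      by (intro orthogonal_to_span[of d E d]) (auto simp: orthogonal_def)
    then have "d = 0" by (simp add: orthogonal_def)
    then show ?thesis unfolding d_def by (rule eq_iff_diff_eq_0[THEN iffD2])
  qed
  have "x \<bullet> y = (\<Sum>e\<in>E. (x \<bullet> e) * (y \<bullet> e))" for x y
  proof -
    have "x \<bullet> y = (\<Sum>e\<in>E. (x \<bullet> e) *\<^sub>R e) \<bullet> y"
      by (rule arg_cong[where f="\<lambda>u. u \<bullet> y", OF expand])
    also have "\<dots> = (\<Sum>e\<in>E. (x \<bullet> e) * (y \<bullet> e))"
      by (simp only: inner_sum_left inner_scaleR_left inner_commute[of y])
    finally show ?thesis .
  qed
  moreover have "norm e = 1" "A *v e = (e \<bullet> (A *v e)) *\<^sub>R e" if "e \<in> E" for e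
    using E(3) that by blast+
  ultimately show ?thesis using that[of E "\<lambda>e. e \<bullet> (A *v e)"] E(1) by blast
qed

section \<open>Conjugate gradients\<close>

context
  fixes B :: "real^'n^'n" and g :: "real^'n"
  assumes sym: "transpose B = B" and pos: "\<And>x. x \<noteq> 0 \<Longrightarrow> 0 < x \<bullet> (B *v x)"
begin

section \<open>Recurrences, orthogonality and conjugacy\<close>

private definition sk where "sk k = fst (cg B g k)"
private definition rk where "rk k = fst (snd (cg B g k))"
private definition pk where "pk k = snd (snd (cg B g k))"
private definition alpha where "alpha k = (rk k \<bullet> rk k) / (pk k \<bullet> (B *v pk k))"
private definition beta where "beta k = (rk (Suc k) \<bullet> rk (Suc k)) / (rk k \<bullet> rk k)"

private lemma cg_0: "sk 0 = 0" "rk 0 = - g" "pk 0 = - g"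
  by (simp_all add: sk_def rk_def pk_def)

private lemma cg_Suc:
  "sk (Suc k) = sk k + alpha k *\<^sub>R pk k"
  "rk (Suc k) = rk k - alpha k *\<^sub>R (B *v pk k)"
  "pk (Suc k) = rk (Suc k) + beta k *\<^sub>R pk k"
  by (simp_all add: sk_def rk_def pk_def alpha_def beta_def split_beta Let_def)

text \<open>With \<open>0 / 0 = 0\<close> the recurrence runs on harmlessly after the exact
  solution: later residuals, directions and step lengths all vanish, so termination is never a
  special case.\<close>

private lemma cg_direction_zero:
  assumes "rk k = 0" shows "pk k = 0"
proof (cases k)
  case 0
  then show ?thesis using assms cg_0(2,3) by simp
next
  case (Suc j)
  then have "beta j = 0" using assms by (simp add: beta_def)
  then show ?thesis using cg_Suc(3)[of j] assms Suc by simp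
qed

private lemma cg_residual: "rk k = - g - B *v sk k"
proof (induction k)
  case 0
  show ?case by (simp add: cg_0)
next
  case (Suc k)
  have "rk (Suc k) = - g - B *v sk k - alpha k *\<^sub>R (B *v pk k)" using cg_Suc(2)[of k] Suc by simp
  also have "\<dots> = - g - B *v sk (Suc k)"
    by (simp add: cg_Suc(1) matrix_vector_right_distrib matrix_vector_mult_scaleR)
  finally show ?case .
qed

private lemma cg_alpha_zero:
  assumes "alpha k = 0" shows "pk k = 0"
proof (rule ccontr)
  assume "pk k \<noteq> 0"
  then have "pk k \<bullet> (B *v pk k) \<noteq> 0" "rk k \<noteq> 0" using pos[of "pk k"] cg_direction_zero[of k] by auto
  then show False using assms by (simp add: alpha_def)
qed

text \<open>The relations need a simultaneous induction: \<open>alpha\<close> makes the new residual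
  orthogonal to the last direction, \<open>beta\<close> makes the new direction conjugate to it, and
  earlier indices follow from the symmetry of \<open>B\<close> and from \<open>Bp\<close>.\<close>

private lemma cg_orthogonality:
  "(\<forall>i<k. rk k \<bullet> pk i = 0) \<and> (\<forall>i<k. rk k \<bullet> rk i = 0) \<and> (\<forall>i<k. pk k \<bullet> (B *v pk i) = 0)
     \<and> rk k \<bullet> pk k = rk k \<bullet> rk k"
proof (induction k)
  case 0
  show ?case by (simp add: cg_0)
next
  case (Suc k)
  have alpha: "alpha k * (pk k \<bullet> (B *v pk k)) = rk k \<bullet> rk k"
  proof (cases "pk k = 0")
    case True
    then have "rk k \<bullet> rk k = 0" using Suc by (metis inner_zero_right)
    then show ?thesis using True by simp
  next
    case False
    then show ?thesis using pos[of "pk k"] by (simp add: alpha_def)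
  qed
  have a: "rk (Suc k) \<bullet> pk i = 0" if "i < Suc k" for i
  proof (cases "i = k")
    case True
    then show ?thesis using alpha Suc
      by (simp add: cg_Suc inner_diff_left inner_commute[of "B *v pk k"])
  next
    case False
    then have "i < k" using that by simp
    moreover have "(B *v pk k) \<bullet> pk i = pk k \<bullet> (B *v pk i)" by (rule symmetric_inner[OF sym])
    ultimately show ?thesis using Suc by (simp add: cg_Suc inner_diff_left)
  qed
  have b: "rk (Suc k) \<bullet> rk i = 0" if "i < Suc k" for i
  proof (cases i)
    case 0
    then show ?thesis using a[of 0] by (simp add: cg_0)
  next
    case (Suc j)
    have "rk i = pk i - beta j *\<^sub>R pk j" by (simp add: Suc cg_Suc)
    then show ?thesis using a[of i] a[of j] that Suc by (simp add: inner_diff_right)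
  qed
  have c: "rk (Suc k) \<bullet> pk (Suc k) = rk (Suc k) \<bullet> rk (Suc k)"
    using a[of k] by (simp add: cg_Suc(3)[of k] inner_add_right)
  \<comment> \<open>The image of a direction is a multiple of a difference of residuals, which
    reduces conjugacy to orthogonality of residuals.\<close>
  have Bp: "alpha i *\<^sub>R (B *v pk i) = rk i - rk (Suc i)" for i by (simp add: cg_Suc)
  have d: "pk (Suc k) \<bullet> (B *v pk i) = 0" if i: "i < Suc k" for i
  proof (cases "alpha i = 0")
    case True
    then show ?thesis by (simp add: cg_alpha_zero)
  next
    case False
    have eq: "alpha i * (rk (Suc k) \<bullet> (B *v pk i)) = rk (Suc k) \<bullet> rk i - rk (Suc k) \<bullet> rk (Suc i)"
      using arg_cong[OF Bp[of i], of "\<lambda>u. rk (Suc k) \<bullet> u"] by (simp add: inner_diff_right)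
    show ?thesis
    proof (cases "i = k")
      case True
      have r: "rk k \<bullet> rk k \<noteq> 0" using False True by (auto simp: alpha_def)
      have "alpha k * (pk (Suc k) \<bullet> (B *v pk k))
          = alpha k * (rk (Suc k) \<bullet> (B *v pk k)) + beta k * (alpha k * (pk k \<bullet> (B *v pk k)))"
        by (simp add: cg_Suc(3)[of k] inner_add_left algebra_simps)
      also have "\<dots> = 0" using eq b[of k] True alpha r by (simp add: beta_def)
      finally show ?thesis using False True by simp
    next
      case False2: False
      then have "i < k" using i by simp
      then have "alpha i * (rk (Suc k) \<bullet> (B *v pk i)) = 0"
        using eq b[of i] b[of "Suc i"] by simp
      then have "rk (Suc k) \<bullet> (B *v pk i) = 0" using False by simp
      then show ?thesis using Suc \<open>i < k\<close> by (simp add: cg_Suc(3)[of k] inner_add_left)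
    qed
  qed
  show ?case using a b c d by blast
qed

section \<open>Krylov spaces and optimality\<close>

private definition Vk where "Vk k = span (pk ` {..<k})"

private lemma Vk_mono: "i \<le> k \<Longrightarrow> Vk i \<subseteq> Vk k"
  unfolding Vk_def by (intro span_mono image_mono) auto

private lemma pk_in_Vk: "i < k \<Longrightarrow> pk i \<in> Vk k"
  unfolding Vk_def by (intro span_base) auto

private lemma Vk_add: "x \<in> Vk k \<Longrightarrow> y \<in> Vk k \<Longrightarrow> x + y \<in> Vk k"
  and Vk_diff: "x \<in> Vk k \<Longrightarrow> y \<in> Vk k \<Longrightarrow> x - y \<in> Vk k"
  and Vk_scale: "x \<in> Vk k \<Longrightarrow> c *\<^sub>R x \<in> Vk k"
  unfolding Vk_def by (auto intro: span_add span_diff span_scale)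

private lemma rk_in_Vk: "i < k \<Longrightarrow> rk i \<in> Vk k"
proof (cases i)
  case (Suc j)
  assume "i < k"
  have "rk i = pk i - beta j *\<^sub>R pk j" by (simp add: Suc cg_Suc)
  then show ?thesis using \<open>i < k\<close> Suc by (auto intro!: Vk_diff Vk_scale pk_in_Vk)
next
  case 0
  assume "i < k"
  then show ?thesis using pk_in_Vk[of 0 k] 0 by (simp add: cg_0)
qed

private lemma sk_in_Vk: "sk k \<in> Vk k"
proof (induction k)
  case 0
  show ?case by (simp add: cg_0 Vk_def)
next
  case (Suc k)
  then have "sk k \<in> Vk (Suc k)" using Vk_mono[of k "Suc k"] by auto
  then show ?case by (auto simp: cg_Suc intro!: Vk_add Vk_scale pk_in_Vk)
qed

text \<open>The span of the directions grows like a Krylov space, because \<open>B p_i\<close> is a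
  multiple of \<open>r_i - r_(i+1)\<close>; when \<open>alpha i = 0\<close> the direction itself is
  zero.\<close>

private lemma B_Vk: "x \<in> Vk k \<Longrightarrow> B *v x \<in> Vk (Suc k)"
  unfolding Vk_def[of k]
proof (induction rule: span_induct_alt)
  case base
  show ?case by (simp add: Vk_def span_zero)
next
  case (step c x y)
  then obtain i where i: "i < k" "x = pk i" by auto
  have "B *v pk i \<in> Vk (Suc k)"
  proof (cases "alpha i = 0")
    case True
    then show ?thesis by (simp add: cg_alpha_zero Vk_def span_zero)
  next
    case False
    then have "B *v pk i = (1 / alpha i) *\<^sub>R (rk i - rk (Suc i))" by (simp add: cg_Suc)
    then show ?thesis using i by (auto intro!: Vk_scale Vk_diff rk_in_Vk)
  qed
  then show ?case using step i
    by (auto simp: matrix_vector_right_distrib matrix_vector_mult_scaleR intro!: Vk_add Vk_scale)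
qed

private definition obj where "obj x = (x \<bullet> (B *v x)) / 2 + g \<bullet> x"

private lemma obj_expand:
  "obj w = obj u + (g + B *v u) \<bullet> (w - u) + ((w - u) \<bullet> (B *v (w - u))) / 2"
proof -
  have "u \<bullet> (B *v w) = w \<bullet> (B *v u)" using symmetric_inner[OF sym, of u w] by (simp add: inner_commute)
  then show ?thesis unfolding obj_def
    by (simp add: matrix_vector_mult_diff_distrib inner_diff_left inner_diff_right inner_add_left
        inner_commute[of "B *v u"] field_simps)
qed

text \<open>The residual is the negative gradient of \<open>obj\<close> and orthogonal to
  \<open>Vk k\<close>, so the linear term of the exact expansion about \<open>sk k\<close>
  vanishes.\<close>

private lemma cg_optimal:
  assumes "w \<in> Vk k" shows "obj (sk k) \<le> obj w"
proof -
  have "w - sk k \<in> span (pk ` {..<k})" using Vk_diff[OF assms sk_in_Vk] by (simp add: Vk_def)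
  then have "orthogonal (rk k) (w - sk k)"
    by (rule orthogonal_to_span) (use cg_orthogonality[of k] in \<open>auto simp: orthogonal_def\<close>)
  then have "(g + B *v sk k) \<bullet> (w - sk k) = 0"
    using cg_residual[of k] by (simp add: orthogonal_def inner_diff_left inner_add_left)
  moreover have "0 \<le> (w - sk k) \<bullet> (B *v (w - sk k))"
    using pos[of "w - sk k"] by (cases "w - sk k = 0") auto
  ultimately show ?thesis using obj_expand[of w "sk k"] by simp
qed

text \<open>Momentum descent on \<open>obj\<close> from 0 stays in \<open>Vk k\<close>, so its
  objective gap bounds that of conjugate gradients. Passing from the energy of the error to the
  squared residual costs a factor \<open>L\<close>, and \<open>|xs|\<close> is at most
  \<open>|g| / m\<close>.\<close>

lemma cg_residual_bound:
  fixes k :: nat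
  assumes m: "0 < m" and mL: "m \<le> L"
    and low: "\<And>x. m * (x \<bullet> x) \<le> x \<bullet> (B *v x)" and up: "\<And>x. x \<bullet> (B *v x) \<le> L * (x \<bullet> x)"
  defines "r \<equiv> g + B *v fst (cg B g k)"
  shows "r \<bullet> r \<le> (L/m) * (L/m + 1) * exp (- real k / sqrt (L/m)) * (g \<bullet> g)"
proof -
  have "linear ((*v) B)" "inj ((*v) B)"
    using pos by (auto simp: linear_injective_0) (metis inner_zero_right less_irrefl)
  then have "surj ((*v) B)" by (rule linear_inj_imp_surj)
  then obtain xs where xs: "B *v xs = - g" by (metis surjD)
  define step where "step = (\<lambda>(y::real^'n, z::real^'n).
      let y' = z - (1/L) *\<^sub>R (g + B *v z)
      in (y', y' + ((sqrt (L/m) - 1)/(sqrt (L/m) + 1)) *\<^sub>R (y' - y)))"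
  define yz where "yz k = (step ^^ k) (0, 0)" for k
  define y z where "y k = fst (yz k)" and "z k = snd (yz k)" for k
  have y0: "y 0 = 0" "z 0 = 0" by (simp_all add: y_def z_def yz_def)
  have yS: "y (Suc k) = z k - (1/L) *\<^sub>R (g + B *v z k)" for k
    by (simp add: y_def z_def yz_def step_def split_beta Let_def)
  have zS: "z (Suc k) = y (Suc k) + ((sqrt (L/m) - 1)/(sqrt (L/m) + 1)) *\<^sub>R (y (Suc k) - y k)" for k
    by (simp add: y_def z_def yz_def step_def split_beta Let_def)
  have "y k \<in> Vk k \<and> z k \<in> Vk k" for k
  proof (induction k)
    case 0
    show ?case by (simp add: y0 Vk_def)
  next
    case (Suc k)
    have "g \<in> Vk (Suc k)" using Vk_scale[OF pk_in_Vk[of 0 "Suc k"], of "-1"] by (simp add: cg_0)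
    then have "y (Suc k) \<in> Vk (Suc k)" unfolding yS
      using Suc Vk_mono[of k "Suc k"] by (auto intro!: Vk_diff Vk_scale Vk_add B_Vk)
    then show ?case unfolding zS
      using Suc Vk_mono[of k "Suc k"] by (auto intro!: Vk_diff Vk_scale Vk_add)
  qed
  then have "obj (sk k) \<le> obj (y k)" by (intro cg_optimal) auto
  also have "obj (y k) - obj xs
      \<le> exp (- real k / sqrt (L/m)) * ((L + m)/2 * ((y 0 - xs) \<bullet> (y 0 - xs)))"
  proof (rule accelerated_gradient_rate(1)[OF m mL, where y = y and z = z and G = "\<lambda>u. g + B *v u"])
    show "obj u + (g + B *v u) \<bullet> (w - u) + m/2 * ((w - u) \<bullet> (w - u)) \<le> obj w" for u w
      using obj_expand[of w u] low[of "w - u"] by simp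
    show "obj w \<le> obj u + (g + B *v u) \<bullet> (w - u) + L/2 * ((w - u) \<bullet> (w - u))" for u w
      using obj_expand[of w u] up[of "w - u"] by simp
  qed (rule yS zS | simp add: xs y0)+
  finally have gap: "obj (sk k) - obj xs \<le> exp (- real k / sqrt (L/m)) * ((L + m)/2 * (xs \<bullet> xs))"
    by (simp add: y0)
  define e where "e = sk k - xs"
  have r: "r = B *v e" by (simp add: r_def e_def sk_def xs matrix_vector_mult_diff_distrib)
  have obj_e: "obj (sk k) - obj xs = (e \<bullet> (B *v e)) / 2"
    using obj_expand[of "sk k" xs] by (simp add: xs e_def)
  have rr: "r \<bullet> r \<le> L * (e \<bullet> (B *v e))"
  proof -
    have L: "L > 0" using m mL by simp
    \<comment> \<open>Positivity of \<open>B\<close> at \<open>L e - B e\<close>, together with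
      \<open>up\<close> at \<open>r\<close>, yields \<open>|B e|^2 \<le> L (e \<bullet> B e)\<close>
      without a square root of \<open>B\<close>.\<close>
    define u where "u = L *\<^sub>R e - r"
    have "0 \<le> u \<bullet> (B *v u)" using pos[of u] by (cases "u = 0") auto
    also have "B *v u = L *\<^sub>R r - B *v r"
      by (simp add: u_def r matrix_vector_mult_diff_distrib matrix_vector_mult_scaleR)
    also have "u \<bullet> (L *\<^sub>R r - B *v r) = L\<^sup>2 * (e \<bullet> r) - L * (e \<bullet> (B *v r)) - L * (r \<bullet> r) + r \<bullet> (B *v r)"
      by (simp add: u_def inner_diff_left inner_diff_right algebra_simps power2_eq_square)
    also have "e \<bullet> (B *v r) = r \<bullet> r" using symmetric_inner[OF sym, of e r] by (simp add: r)
    also have "L\<^sup>2 * (e \<bullet> r) - L * (r \<bullet> r) - L * (r \<bullet> r) + r \<bullet> (B *v r) \<le> L * (L * (e \<bullet> r) - r \<bullet> r)"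
      using up[of r] by (simp add: algebra_simps power2_eq_square)
    finally show ?thesis using L by (simp add: zero_le_mult_iff r)
  qed
  have xs_le: "xs \<bullet> xs \<le> (g \<bullet> g) / m\<^sup>2"
  proof -
    have "m * (norm xs * norm xs) \<le> xs \<bullet> (- g)"
      using low[of xs] by (simp add: xs dot_square_norm power2_eq_square)
    also have "\<dots> \<le> norm xs * norm g" using Cauchy_Schwarz_ineq2[of xs "- g"] by simp
    finally have "m * norm xs \<le> norm g" by (cases "xs = 0") auto
    then have "(m * norm xs)\<^sup>2 \<le> (norm g)\<^sup>2" using m by (intro power_mono) auto
    then show ?thesis using m by (simp add: power_mult_distrib power2_norm_eq_inner field_simps)
  qed
  have L: "L > 0" using m mL by simp
  have r_le: "r \<bullet> r \<le> L * (2 * (exp (- real k / sqrt (L/m)) * ((L + m)/2 * ((g \<bullet> g) / m\<^sup>2))))"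
  proof -
    have "e \<bullet> (B *v e) \<le> 2 * (exp (- real k / sqrt (L/m)) * ((L + m)/2 * (xs \<bullet> xs)))"
      using gap obj_e by simp
    also have "\<dots> \<le> 2 * (exp (- real k / sqrt (L/m)) * ((L + m)/2 * ((g \<bullet> g) / m\<^sup>2)))"
      using xs_le m mL by (intro mult_left_mono) auto
    finally show ?thesis by (rule order_trans[OF rr mult_left_mono[OF _ less_imp_le[OF L]]])
  qed
  have eq: "L * (2 * (E * ((L + m)/2 * (G / m\<^sup>2)))) = (L/m) * (L/m + 1) * E * G" for E G
    using m by (simp add: field_simps power2_eq_square)
  show ?thesis by (rule order_trans[OF r_le eq_refl[OF eq]])
qed

end

text \<open>With \<open>\<sigma> = sqrt (L * norm g)\<close>, the shift lifts the curvature from at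
  least \<open>- \<sigma>/2\<close> to at least \<open>\<sigma>/2\<close>, so \<kappa> bounds the
  condition number. The factor \<open>(6 * \<kappa>)^2\<close> pushes the residual below
  \<open>|g| / (6 * \<kappa>)\<close>. As \<open>s\<close> then has length at least
  \<open>11/12 |g| / (b + \<sigma>)\<close>, both parts of the tolerance are met.\<close>

lemma cg_accepts_after:
  fixes H :: "real^'n^'n" and g :: "real^'n" and b :: real
  assumes sym: "transpose H = H" and g: "g \<noteq> 0" and L: "0 < L"
    and low: "\<And>x. - (1/2 * sqrt (L * norm g)) * (x \<bullet> x) \<le> x \<bullet> (H *v x)"
    and up: "spectral_norm H \<le> b"
  defines "\<kappa> \<equiv> 2 * (b + sqrt (L * norm g)) / sqrt (L * norm g)"
  assumes k: "\<kappa> * (\<kappa> + 1) * (6 * \<kappa>)\<^sup>2 \<le> exp (real k / sqrt \<kappa>)"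
  shows "cg_accepts L H g k"
proof -
  define \<sigma> where "\<sigma> = sqrt (L * norm g)"
  have s: "\<sigma> > 0" using g L by (simp add: \<sigma>_def)
  define B where "B = cg_shift L H g"
  have b: "b \<ge> 0" using up spectral_norm_nonneg[of H] by linarith
  have Bv: "B *v x = H *v x + \<sigma> *\<^sub>R x" for x
    by (simp add: B_def cg_shift_def \<sigma>_def matrix_vector_mult_add_rdistrib scaleR_matrix_vector_assoc[symmetric])
  have lowB: "\<sigma>/2 * (x \<bullet> x) \<le> x \<bullet> (B *v x)" for x
    using low[of x] by (simp add: Bv inner_add_right \<sigma>_def[symmetric] algebra_simps)
  have upH: "x \<bullet> (H *v x) \<le> b * (x \<bullet> x)" for x
    using spectral_norm_quadratic[of x H] mult_right_mono[OF up, of "x \<bullet> x"] by simp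
  have upB: "x \<bullet> (B *v x) \<le> (b + \<sigma>) * (x \<bullet> x)" for x
    using upH[of x] by (simp add: Bv inner_add_right algebra_simps)
  have posB: "0 < x \<bullet> (B *v x)" if "x \<noteq> 0" for x
    using lowB[of x] s that by (smt (verit) inner_gt_zero_iff mult_pos_pos half_gt_zero)
  have symB: "transpose B = B"
    by (rule transpose_eqI) (simp add: Bv inner_add_left inner_add_right symmetric_inner[OF sym])
  have kap: "\<kappa> = (b + \<sigma>) / (\<sigma>/2)" by (simp add: \<kappa>_def \<sigma>_def)
  have k2: "2 \<le> \<kappa>" using s b by (simp add: kap field_simps)
  define s where "s = fst (cg B g k)"
  define r where "r = g + B *v s"
  have "r \<bullet> r \<le> \<kappa> * (\<kappa> + 1) * exp (- real k / sqrt \<kappa>) * (g \<bullet> g)"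
    unfolding r_def s_def kap
    by (rule cg_residual_bound[OF symB posB _ _ lowB upB]) (use s b in auto)
  also have "\<dots> \<le> (1 / (6 * \<kappa>))\<^sup>2 * (g \<bullet> g)"
  proof (rule mult_right_mono)
    have "\<kappa> * (\<kappa> + 1) * exp (- real k / sqrt \<kappa>) = (\<kappa> * (\<kappa> + 1)) / exp (real k / sqrt \<kappa>)"
      by (simp add: exp_minus divide_inverse)
    also have "\<dots> \<le> 1 / (6 * \<kappa>)\<^sup>2"
      using k k2 by (simp add: pos_divide_le_eq pos_le_divide_eq)
    finally show "\<kappa> * (\<kappa> + 1) * exp (- real k / sqrt \<kappa>) \<le> (1 / (6 * \<kappa>))\<^sup>2"
      by (simp add: power_one_over)
  qed simp
  finally have "(norm r)\<^sup>2 \<le> (norm g / (6 * \<kappa>))\<^sup>2"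
    by (simp add: power2_norm_eq_inner power_divide power_mult_distrib)
  then have r: "norm r \<le> norm g / (6 * \<kappa>)"
    using k2 by (auto intro: power2_le_imp_le[of "norm r"])
  also have "\<dots> \<le> norm g / 12" using k2 by (intro divide_left_mono) auto
  finally have r12: "norm r \<le> norm g / 12" .
  have "norm (B *v s) \<le> (b + \<sigma>) * norm s"
  proof -
    have "norm (H *v s) \<le> b * norm s"
      using spectral_norm_bound[of H s] mult_right_mono[OF up, of "norm s"] by simp
    then show ?thesis using norm_triangle_ineq[of "H *v s" "\<sigma> *\<^sub>R s"] \<open>\<sigma> > 0\<close>
      by (simp add: Bv algebra_simps)
  qed
  moreover have "norm g - norm r \<le> norm (B *v s)"
    using norm_triangle_ineq4[of r "B *v s"] by (simp add: r_def)
  ultimately have "11/12 * norm g \<le> (b + \<sigma>) * norm s" using r12 by linarith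
  \<comment> \<open>Since \<open>\<kappa>/2 = (b + \<sigma>)/\<sigma>\<close>, this factor turns
    \<open>(b + \<sigma>) * norm s\<close> into \<open>\<sigma>/8 * norm s\<close>, the second part
    of the tolerance.\<close>
  then have "11/12 * norm g * (1/8 / (\<kappa>/2)) \<le> ((b + \<sigma>) * norm s) * (1/8 / (\<kappa>/2))"
    using k2 by (intro mult_right_mono) auto
  also have "\<dots> = 1/4 * (1/2 * \<sigma> * norm s)"
    using \<open>\<sigma> > 0\<close> b by (simp add: kap field_simps)
  finally have "norm r \<le> 1/4 * (1/2 * \<sigma> * norm s)"
  proof -
    assume a: "11/12 * norm g * (1/8 / (\<kappa>/2)) \<le> 1/4 * (1/2 * \<sigma> * norm s)"
    have "norm g / (6 * \<kappa>) \<le> 11/12 * norm g * (1/8 / (\<kappa>/2))"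
      using k2 by (simp add: field_simps)
    then show ?thesis using r a by linarith
  qed
  moreover have "norm r \<le> 1/4 * norm g" using r12 norm_ge_zero[of g] by linarith
  ultimately show ?thesis
    unfolding cg_accepts_def Let_def B_def[symmetric] s_def[symmetric] r_def[symmetric] \<sigma>_def[symmetric]
    by (simp add: min_def)
qed

section \<open>Gradients and Taylor bounds\<close>

lemma GDERIV_unique:
  assumes "GDERIV \<phi> z :> d" "GDERIV \<phi> z :> d'" shows "d = d'"
proof -
  have eq: "(\<lambda>h. h \<bullet> d) = (\<lambda>h. h \<bullet> d')"
    using assms has_derivative_unique unfolding gderiv_def by blast
  have "(d - d') \<bullet> (d - d') = 0" using fun_cong[OF eq, of "d - d'"] by (simp add: inner_diff_right)
  then show ?thesis by simp
qed

lemma grad_eqI: "GDERIV \<phi> z :> d \<Longrightarrow> grad \<phi> z = d"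
  unfolding grad_def by (rule the_equality) (auto intro: GDERIV_unique)

lemma GDERIV_grad:
  fixes \<phi> :: "'a::euclidean_space \<Rightarrow> real"
  assumes "\<phi> differentiable (at z)" shows "GDERIV \<phi> z :> grad \<phi> z"
proof -
  obtain D where D: "(\<phi> has_derivative D) (at z)" using assms by (auto simp: differentiable_def)
  interpret D: bounded_linear D using D by (rule has_derivative_bounded_linear)
  have "D h = h \<bullet> (\<Sum>b\<in>Basis. D b *\<^sub>R b)" for h
  proof -
    have "D h = D (\<Sum>b\<in>Basis. (h \<bullet> b) *\<^sub>R b)" by (simp add: euclidean_representation)
    also have "\<dots> = h \<bullet> (\<Sum>b\<in>Basis. D b *\<^sub>R b)"
      by (simp add: D.sum D.scaleR inner_sum_right mult.commute)
    finally show ?thesis .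
  qed
  then have "D = (\<lambda>h. h \<bullet> (\<Sum>b\<in>Basis. D b *\<^sub>R b))" by (rule ext)
  then have d: "GDERIV \<phi> z :> (\<Sum>b\<in>Basis. D b *\<^sub>R b)" using D unfolding gderiv_def by simp
  show ?thesis unfolding grad_eqI[OF d] by (rule d)
qed

section \<open>Restriction to segments and Taylor bounds\<close>

lemma GDERIV_line:
  assumes "GDERIV \<phi> (u + t *\<^sub>R d) :> g"
  shows "((\<lambda>t. \<phi> (u + t *\<^sub>R d)) has_real_derivative g \<bullet> d) (at t)"
proof -
  have "((\<lambda>t. u + t *\<^sub>R d) has_derivative (\<lambda>s. s *\<^sub>R d)) (at t)"
    by (auto intro!: derivative_eq_intros)
  from has_derivative_compose[OF this] assms
  have "((\<lambda>t. \<phi> (u + t *\<^sub>R d)) has_derivative (\<lambda>s. (s *\<^sub>R d) \<bullet> g)) (at t)"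
    unfolding gderiv_def by blast
  then show ?thesis
    by (rule has_derivative_imp_has_field_derivative) (simp add: inner_commute mult.commute)
qed

text \<open>The difference of the two sides along the segment from \<open>u\<close> to
  \<open>w\<close> has nonpositive derivative. The higher Taylor bounds use the same device in place
  of integrals.\<close>

lemma lipschitz_gradient_upper:
  assumes deriv: "\<And>z. GDERIV \<phi> z :> G z"
    and lip: "\<And>z w. norm (G z - G w) \<le> L * norm (z - w)"
  shows "\<phi> w \<le> \<phi> u + G u \<bullet> (w - u) + L/2 * ((w - u) \<bullet> (w - u))"
proof -
  define d where "d = w - u"
  define \<psi> where "\<psi> t = \<phi> (u + t *\<^sub>R d) - t * (G u \<bullet> d) - L/2 * t\<^sup>2 * (d \<bullet> d)" for t
  have der: "(\<psi> has_real_derivative (G (u + t *\<^sub>R d) \<bullet> d - G u \<bullet> d - L * t * (d \<bullet> d))) (at t)" for t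
    unfolding \<psi>_def by (rule derivative_eq_intros GDERIV_line deriv refl | simp)+
  have "\<psi> 1 \<le> \<psi> 0"
  proof (rule DERIV_nonpos_imp_nonincreasing[OF zero_le_one])
    fix t :: real assume t: "0 \<le> t" "t \<le> 1"
    have "(G (u + t *\<^sub>R d) - G u) \<bullet> d \<le> norm (G (u + t *\<^sub>R d) - G u) * norm d"
      by (rule norm_cauchy_schwarz)
    also have "\<dots> \<le> (L * norm (t *\<^sub>R d)) * norm d"
      using lip[of "u + t *\<^sub>R d" u] by (intro mult_right_mono) auto
    also have "\<dots> = L * t * (d \<bullet> d)"
      using t by (simp add: power2_norm_eq_inner[symmetric] power2_eq_square)
    finally show "\<exists>y. (\<psi> has_real_derivative y) (at t) \<and> y \<le> 0"
      using der[of t] by (intro exI conjI) (auto simp: inner_diff_left)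
  qed
  then show ?thesis by (simp add: \<psi>_def d_def)
qed

lemma lipschitz_gradient_lower:
  assumes deriv: "\<And>z. GDERIV \<phi> z :> G z"
    and lip: "\<And>z w. norm (G z - G w) \<le> L * norm (z - w)"
  shows "\<phi> u + G u \<bullet> (w - u) - L/2 * ((w - u) \<bullet> (w - u)) \<le> \<phi> w"
  using lipschitz_gradient_upper[of "\<lambda>z. - \<phi> z" "\<lambda>z. - G z" L w u] GDERIV_minus[OF deriv] lip
  by (simp add: norm_minus_commute)

text \<open>Tangent inequality for the convex function \<open>k\<close>, the negated regularised
  objective on a line; expanding the squared norm leaves the term with
  \<open>\<mu>/2\<close>.\<close>

lemma concave_gradient_upper:
  assumes conc: "concave_on UNIV (\<lambda>y. \<psi> y + \<mu>/2 * (norm y)\<^sup>2)" and deriv: "GDERIV \<psi> y :> g"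
  shows "\<psi> w \<le> \<psi> y + g \<bullet> (w - y) - \<mu>/2 * ((w - y) \<bullet> (w - y))"
proof -
  define d where "d = w - y"
  define k where "k t = - (\<psi> (y + t *\<^sub>R d) + \<mu>/2 * (norm (y + t *\<^sub>R d))\<^sup>2)" for t
  have "convex_on UNIV k"
  proof (rule convex_onI)
    fix t a b :: real assume t: "0 < t" "t < 1"
    have "y + ((1 - t) *\<^sub>R a + t *\<^sub>R b) *\<^sub>R d = (1 - t) *\<^sub>R (y + a *\<^sub>R d) + t *\<^sub>R (y + b *\<^sub>R d)"
      by (simp add: algebra_simps)
    then show "k ((1 - t) *\<^sub>R a + t *\<^sub>R b) \<le> (1 - t) * k a + t * k b"
      using convex_onD[OF conc[unfolded concave_on_def], of t "y + a *\<^sub>R d" "y + b *\<^sub>R d"] t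
      by (simp only: k_def) simp
  qed simp
  moreover have "(k has_real_derivative - (g \<bullet> d + \<mu> * (y \<bullet> d))) (at 0)"
  proof -
    have "((\<lambda>t. \<psi> (y + t *\<^sub>R d)) has_real_derivative g \<bullet> d) (at 0)"
      by (rule GDERIV_line) (simp add: deriv)
    moreover have "((\<lambda>t. (norm (y + t *\<^sub>R d))\<^sup>2) has_real_derivative 2 * (y \<bullet> d)) (at 0)"
      unfolding power2_norm_eq_inner inner_add_left inner_add_right inner_scaleR_left inner_scaleR_right
      by (rule derivative_eq_intros refl | simp add: inner_commute)+
    from DERIV_minus[OF DERIV_add[OF calculation DERIV_cmult[OF this, of "\<mu>/2"]]]
    show ?thesis unfolding k_def by simp
  qed
  ultimately have "- (g \<bullet> d + \<mu> * (y \<bullet> d)) * (1 - 0) \<le> k 1 - k 0"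
    by (intro convex_on_imp_above_tangent[where A = UNIV]) auto
  moreover have "(norm (y + d))\<^sup>2 = (norm y)\<^sup>2 + 2 * (y \<bullet> d) + d \<bullet> d"
    by (simp add: power2_norm_eq_inner inner_add_left inner_add_right inner_commute)
  ultimately show ?thesis by (simp add: k_def d_def field_simps)
qed

text \<open>Schwarz's theorem from differentiability of \<open>G\<close> at one point. The second
  difference \<open>S u v t\<close> is symmetric in \<open>u\<close> and \<open>v\<close>, and a
  mean value argument in the direction \<open>u\<close> shows it to be
  \<open>t^2 (D v \<bullet> u) + o(t^2)\<close>.\<close>

lemma hessian_symmetric:
  fixes \<phi> :: "'a::euclidean_space \<Rightarrow> real"
  assumes deriv: "\<And>z. GDERIV \<phi> z :> G z" and D: "(G has_derivative D) (at z)"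
  shows "D u \<bullet> v = u \<bullet> D v"
proof -
  interpret D: bounded_linear D using D by (rule has_derivative_bounded_linear)
  define S where "S u v t = \<phi> (z + t *\<^sub>R u + t *\<^sub>R v) - \<phi> (z + t *\<^sub>R u) - \<phi> (z + t *\<^sub>R v) + \<phi> z"
    for u v and t :: real
  define c where "c = norm u + norm v + 1"
  have c: "c > 0" by (simp add: c_def add_nonneg_pos)
  have main: "\<bar>S u v t - t\<^sup>2 * (D v \<bullet> u)\<bar> \<le> t\<^sup>2 * (2 * e * c\<^sup>2)"
    if t: "0 < t" "t * c < d" and e: "e > 0" and uv: "norm u + norm v + 1 = c"
      and d: "\<And>w. norm w < d \<Longrightarrow> norm (G (z + w) - G z - D w) \<le> e * norm w"
    for u v t d and e :: real
  proof -
    define g where "g s = \<phi> (z + t *\<^sub>R v + s *\<^sub>R u) - \<phi> (z + s *\<^sub>R u)" for s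
    have "(g has_real_derivative G (z + t *\<^sub>R v + s *\<^sub>R u) \<bullet> u - G (z + s *\<^sub>R u) \<bullet> u) (at s)" for s
      unfolding g_def by (intro derivative_intros GDERIV_line deriv)
    from MVT2[OF t(1) this]
    obtain s where s: "0 < s" "s < t"
      and gs: "g t - g 0 = t * ((G (z + t *\<^sub>R v + s *\<^sub>R u) - G (z + s *\<^sub>R u)) \<bullet> u)"
      by (auto simp: inner_diff_left)
    define w1 w2 where "w1 = t *\<^sub>R v + s *\<^sub>R u" and "w2 = s *\<^sub>R u"
    have "norm w1 \<le> t * norm v + s * norm u"
      unfolding w1_def using t s norm_triangle_ineq[of "t *\<^sub>R v" "s *\<^sub>R u"] by simp
    also have "\<dots> \<le> t * norm v + t * norm u" using s by (intro add_mono mult_right_mono) auto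
    also have "\<dots> \<le> t * c" using t unfolding uv[symmetric] by (simp add: algebra_simps)
    finally have w1: "norm w1 \<le> t * c" .
    have "norm w2 \<le> t * norm u" unfolding w2_def using s by (auto intro!: mult_right_mono)
    also have "\<dots> \<le> t * c" using t unfolding uv[symmetric] by (intro mult_left_mono) auto
    finally have w2: "norm w2 \<le> t * c" .
    define err where "err = (G (z + w1) - G z - D w1) - (G (z + w2) - G z - D w2)"
    have "norm err \<le> e * norm w1 + e * norm w2"
      unfolding err_def using d[of w1] d[of w2] w1 w2 t
      by (intro order_trans[OF norm_triangle_ineq4 add_mono]) linarith+
    also have "\<dots> \<le> e * (t * c) + e * (t * c)"
      using w1 w2 e by (intro add_mono mult_left_mono) auto
    finally have err: "norm err \<le> 2 * e * t * c" by (simp add: mult_ac)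
    have "D w1 - D w2 = t *\<^sub>R D v" by (simp add: w1_def w2_def D.add D.scaleR)
    then have "G (z + w1) - G (z + w2) = t *\<^sub>R D v + err" by (simp add: err_def algebra_simps)
    then have "g t - g 0 = t * ((t *\<^sub>R D v + err) \<bullet> u)"
      using gs by (simp add: w1_def w2_def add.assoc)
    moreover have "S u v t = g t - g 0" by (simp add: S_def g_def algebra_simps)
    ultimately have "S u v t - t\<^sup>2 * (D v \<bullet> u) = t * (err \<bullet> u)"
      by (simp add: inner_add_left power2_eq_square algebra_simps)
    moreover have "\<bar>err \<bullet> u\<bar> \<le> (2 * e * t * c) * c"
    proof -
      have "norm u \<le> c" using uv norm_ge_zero[of v] by linarith
      then have "norm err * norm u \<le> (2 * e * t * c) * c"
        using err e t c by (intro mult_mono) auto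
      then show ?thesis using Cauchy_Schwarz_ineq2[of err u] by linarith
    qed
    then have "t * \<bar>err \<bullet> u\<bar> \<le> t * ((2 * e * t * c) * c)" using t by (intro mult_left_mono) auto
    ultimately show ?thesis using t by (simp add: abs_mult power2_eq_square mult_ac)
  qed
  have "\<bar>D v \<bullet> u - D u \<bullet> v\<bar> \<le> 0 + e'" if e': "e' > 0" for e'
  proof -
    define e where "e = e' / (4 * c\<^sup>2)"
    have e: "e > 0" using e' c by (simp add: e_def)
    obtain d where d0: "d > 0"
      and d: "\<And>y. norm (y - z) < d \<Longrightarrow> norm (G y - G z - D (y - z)) \<le> e * norm (y - z)"
      using D e unfolding has_derivative_at_alt by blast
    have d': "norm (G (z + w) - G z - D w) \<le> e * norm w" if "norm w < d" for w
      using d[of "z + w"] that by simp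
    define t where "t = d / (2 * c)"
    have t: "0 < t" "t * c < d" using d0 c by (auto simp: t_def)
    have "\<bar>S u v t - t\<^sup>2 * (D v \<bullet> u)\<bar> \<le> t\<^sup>2 * (2 * e * c\<^sup>2)"
      by (rule main[OF t e _ d']) (simp_all add: c_def)
    moreover have "\<bar>S v u t - t\<^sup>2 * (D u \<bullet> v)\<bar> \<le> t\<^sup>2 * (2 * e * c\<^sup>2)"
      by (rule main[OF t e _ d']) (simp_all add: c_def)
    moreover have "S u v t = S v u t" by (simp add: S_def algebra_simps)
    ultimately have "\<bar>t\<^sup>2 * (D v \<bullet> u) - t\<^sup>2 * (D u \<bullet> v)\<bar> \<le> t\<^sup>2 * (4 * e * c\<^sup>2)" by linarith
    also have "t\<^sup>2 * (D v \<bullet> u) - t\<^sup>2 * (D u \<bullet> v) = t\<^sup>2 * (D v \<bullet> u - D u \<bullet> v)" by (simp add: algebra_simps)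
    finally have "t\<^sup>2 * \<bar>D v \<bullet> u - D u \<bullet> v\<bar> \<le> t\<^sup>2 * (4 * e * c\<^sup>2)" by (simp add: abs_mult)
    then have "\<bar>D v \<bullet> u - D u \<bullet> v\<bar> \<le> 4 * e * c\<^sup>2" using t by simp
    also have "\<dots> = e'" using c by (simp add: e_def)
    finally show ?thesis by simp
  qed
  then have "\<bar>D v \<bullet> u - D u \<bullet> v\<bar> \<le> 0" by (rule field_le_epsilon)
  then show ?thesis by (simp add: inner_commute)
qed

text \<open>Pairing with a fixed \<open>v\<close> reduces the vector remainder to a scalar function
  on a segment. Later \<open>v\<close> is the remainder itself or the increment
  \<open>s\<close>.\<close>

lemma lipschitz_jacobian_remainder:
  fixes G :: "real^'n \<Rightarrow> real^'k"
  assumes A: "\<And>x. (G has_derivative (*v) (A x)) (at x)"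
    and lip: "\<And>x x' h. norm (A x *v h - A x' *v h) \<le> M * norm (x - x') * norm h"
  shows "v \<bullet> (G (x + s) - G x - A x *v s) \<le> M/2 * (norm s)\<^sup>2 * norm v"
proof -
  define \<psi> where "\<psi> t = v \<bullet> G (x + t *\<^sub>R s) - t * (v \<bullet> (A x *v s)) - M/2 * t\<^sup>2 * (norm s)\<^sup>2 * norm v" for t
  have line: "((\<lambda>t. v \<bullet> G (x + t *\<^sub>R s)) has_real_derivative v \<bullet> (A (x + t *\<^sub>R s) *v s)) (at t)" for t
  proof -
    have "((\<lambda>t. x + t *\<^sub>R s) has_derivative (\<lambda>r. r *\<^sub>R s)) (at t)"
      by (auto intro!: derivative_eq_intros)
    from has_derivative_inner_right[OF has_derivative_compose[OF this A], of v]
    show ?thesis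
      by (rule has_derivative_imp_has_field_derivative) (simp add: matrix_vector_mult_scaleR mult.commute)
  qed
  have der: "(\<psi> has_real_derivative (v \<bullet> (A (x + t *\<^sub>R s) *v s) - v \<bullet> (A x *v s)
      - M * t * (norm s)\<^sup>2 * norm v)) (at t)" for t
    unfolding \<psi>_def by (rule derivative_eq_intros line refl | simp)+
  have "\<psi> 1 \<le> \<psi> 0"
  proof (rule DERIV_nonpos_imp_nonincreasing[OF zero_le_one])
    fix t :: real assume t: "0 \<le> t" "t \<le> 1"
    have "v \<bullet> (A (x + t *\<^sub>R s) *v s - A x *v s) \<le> norm v * norm (A (x + t *\<^sub>R s) *v s - A x *v s)"
      by (rule norm_cauchy_schwarz)
    also have "\<dots> \<le> norm v * (M * norm (t *\<^sub>R s) * norm s)"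
      using lip[of "x + t *\<^sub>R s" s x] by (intro mult_left_mono) auto
    also have "\<dots> = M * t * (norm s)\<^sup>2 * norm v" using t by (simp add: power2_eq_square)
    finally show "\<exists>y. (\<psi> has_real_derivative y) (at t) \<and> y \<le> 0"
      using der[of t] by (intro exI conjI) (auto simp: inner_diff_right)
  qed
  then show ?thesis by (simp add: \<psi>_def inner_diff_right)
qed

lemma lipschitz_jacobian_norm:
  fixes G :: "real^'n \<Rightarrow> real^'k"
  assumes A: "\<And>x. (G has_derivative (*v) (A x)) (at x)"
    and lip: "\<And>x x' h. norm (A x *v h - A x' *v h) \<le> M * norm (x - x') * norm h"
  shows "norm (G (x + s) - G x - A x *v s) \<le> M/2 * (norm s)\<^sup>2"
proof -
  define e where "e = G (x + s) - G x - A x *v s"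
  have "norm e * norm e \<le> (M/2 * (norm s)\<^sup>2) * norm e"
    using lipschitz_jacobian_remainder[OF A lip, of e x s]
    by (simp add: e_def[symmetric] dot_square_norm power2_eq_square)
  moreover have "0 \<le> M/2 * (norm s)\<^sup>2"
  proof (cases "s = 0")
    case False
    have "0 \<le> M * norm (s - 0) * norm s" using lip[of s s 0] norm_ge_zero order_trans by blast
    then show ?thesis by (simp add: power2_eq_square mult.assoc)
  qed simp
  ultimately show ?thesis unfolding e_def[symmetric]
    by (cases "e = 0") (auto simp: mult_le_cancel_right)
qed

lemma lipschitz_hessian_upper:
  fixes \<phi> :: "real^'n \<Rightarrow> real"
  assumes deriv: "\<And>z. GDERIV \<phi> z :> G z"
    and A: "\<And>x. (G has_derivative (*v) (A x)) (at x)"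
    and lip: "\<And>x x' h. norm (A x *v h - A x' *v h) \<le> M * norm (x - x') * norm h"
  shows "\<phi> (x + s) \<le> \<phi> x + G x \<bullet> s + 1/2 * (s \<bullet> (A x *v s)) + M/6 * norm s ^ 3"
proof -
  define \<psi> where "\<psi> t = \<phi> (x + t *\<^sub>R s) - t * (G x \<bullet> s) - t\<^sup>2/2 * (s \<bullet> (A x *v s)) - M/6 * t^3 * norm s ^ 3" for t
  have der: "(\<psi> has_real_derivative (G (x + t *\<^sub>R s) \<bullet> s - G x \<bullet> s - t * (s \<bullet> (A x *v s))
      - M/2 * t\<^sup>2 * norm s ^ 3)) (at t)" for t
    unfolding \<psi>_def by (rule derivative_eq_intros GDERIV_line deriv refl | simp)+
  have "\<psi> 1 \<le> \<psi> 0"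
  proof (rule DERIV_nonpos_imp_nonincreasing[OF zero_le_one])
    fix t :: real assume t: "0 \<le> t" "t \<le> 1"
    have "s \<bullet> (G (x + t *\<^sub>R s) - G x - A x *v (t *\<^sub>R s)) \<le> M/2 * (norm (t *\<^sub>R s))\<^sup>2 * norm s"
      by (rule lipschitz_jacobian_remainder[OF A lip])
    then have "G (x + t *\<^sub>R s) \<bullet> s - G x \<bullet> s - t * (s \<bullet> (A x *v s)) \<le> M/2 * t\<^sup>2 * norm s ^ 3"
      using t by (simp add: inner_diff_right inner_commute matrix_vector_mult_scaleR power_mult_distrib
          power2_eq_square power3_eq_cube algebra_simps)
    then show "\<exists>y. (\<psi> has_real_derivative y) (at t) \<and> y \<le> 0"
      using der[of t] by (intro exI conjI) auto
  qed
  then show ?thesis by (simp add: \<psi>_def)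
qed

text \<open>The passage from partial to joint differentiability rests on joint continuity of one
  partial derivative. The Lipschitz bound supplies it for \<open>B\<close>, read as a map into
  bounded linear functions.\<close>

lemma has_derivative_partials_lipschitz:
  fixes F :: "(real^'n) \<times> (real^'m) \<Rightarrow> real^'k"
  assumes A: "((\<lambda>x'. F (x', y)) has_derivative (*v) A) (at x)"
    and B: "\<And>x y. ((\<lambda>y'. F (x, y')) has_derivative (*v) (B (x, y))) (at y)"
    and lip: "\<And>z z'. spectral_norm (B z - B z') \<le> \<rho> * norm (z - z')"
  shows "(F has_derivative (\<lambda>(h, k). A *v h + B (x, y) *v k)) (at (x, y))"
proof -
  define C where "C x y = Blinfun ((*v) (B (x, y)))" for x y
  have C: "blinfun_apply (C x y) = (*v) (B (x, y))" for x y
    unfolding C_def by (rule bounded_linear_Blinfun_apply) (rule matrix_vector_mul_bounded_linear)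
  have CC: "norm (C a b - C x y) \<le> \<bar>\<rho>\<bar> * norm ((a, b) - (x, y))" for a b x y
  proof -
    have "norm (C a b - C x y) = spectral_norm (B (a, b) - B (x, y))"
    proof -
      have "blinfun_apply (C a b - C x y) = (*v) (B (a, b) - B (x, y))"
        by (rule ext) (simp add: blinfun.diff_left C matrix_vector_mult_diff_rdistrib)
      then show ?thesis unfolding norm_blinfun.rep_eq spectral_norm_def by simp
    qed
    also have "\<dots> \<le> \<rho> * norm ((a, b) - (x, y))" by (rule lip)
    also have "\<dots> \<le> \<bar>\<rho>\<bar> * norm ((a, b) - (x, y))" by (intro mult_right_mono) auto
    finally show ?thesis .
  qed
  have "continuous (at (x, y) within UNIV \<times> UNIV) (\<lambda>(x, y). C x y)"
  proof -
    have "((\<lambda>z. norm ((case z of (a, b) \<Rightarrow> C a b) - C x y)) \<longlongrightarrow> 0) (at (x, y))"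
    proof (rule Lim_null_comparison)
      show "\<forall>\<^sub>F z in at (x, y). norm (norm ((case z of (a, b) \<Rightarrow> C a b) - C x y)) \<le> \<bar>\<rho>\<bar> * norm (z - (x, y))"
        using CC by (intro always_eventually) (auto simp: split_beta)
      show "((\<lambda>z. \<bar>\<rho>\<bar> * norm (z - (x, y))) \<longlongrightarrow> 0) (at (x, y))"
        by (auto intro!: tendsto_eq_intros)
    qed
    then show ?thesis
      unfolding continuous_within by (simp add: LIM_zero_iff tendsto_norm_zero_iff)
  qed
  from has_derivative_partialsI[where f = "\<lambda>x y. F (x, y)" and fy = C, OF _ _ this, of "(*v) A"]
  have "((\<lambda>(x, y). F (x, y)) has_derivative (\<lambda>(h, k). A *v h + blinfun_apply (C x y) k)) (at (x, y) within UNIV \<times> UNIV)"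
    using A B by (simp add: C)
  then show ?thesis by (simp add: C)
qed

section \<open>The maximal function\<close>

lemma norm_fst: "norm (fst z) \<le> norm z"
  by (cases z) (simp add: norm_fst_le)

lemma norm_snd: "norm (snd z) \<le> norm z"
  by (cases z) (simp add: norm_snd_le)

text \<open>A bound on increments passes to the derivative for small t. The one-sided form with an
  inner product covers operator norms, with \<open>v = D h\<close>, as well as the negative
  definiteness of \<open>Fyy\<close>.\<close>

lemma directional_inner_bound:
  fixes G :: "'a::real_normed_vector \<Rightarrow> 'b::real_inner"
  assumes D: "(G has_derivative D) (at z)"
    and bnd: "\<And>t. (G (z + t *\<^sub>R h) - G z) \<bullet> (t *\<^sub>R v) \<le> B * t\<^sup>2"
  shows "D h \<bullet> v \<le> B"
proof (rule field_le_epsilon)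
  fix e' :: real assume e': "e' > 0"
  interpret D: bounded_linear D using D by (rule has_derivative_bounded_linear)
  define c where "c = (norm h + 1) * (norm v + 1)"
  have c: "c > 0" unfolding c_def by (intro mult_pos_pos) (auto simp: add_nonneg_pos)
  define e where "e = e' / c"
  have e: "e > 0" using e' c by (simp add: e_def)
  obtain d where d0: "d > 0"
    and d: "\<And>y. norm (y - z) < d \<Longrightarrow> norm (G y - G z - D (y - z)) \<le> e * norm (y - z)"
    using D e unfolding has_derivative_at_alt by blast
  define t where "t = d / (2 * (norm h + 1))"
  have h1: "norm h + 1 > 0" by (simp add: add_nonneg_pos)
  have t: "t > 0" using d0 h1 by (simp add: t_def)
  have "norm (t *\<^sub>R h) < d"
  proof -
    have "norm (t *\<^sub>R h) \<le> t * (norm h + 1)" using t by simp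
    also have "\<dots> = d / 2" using h1 by (simp add: t_def field_simps)
    finally show ?thesis using d0 by simp
  qed
  then have err: "norm (G (z + t *\<^sub>R h) - G z - t *\<^sub>R D h) \<le> e * (t * norm h)"
    using d[of "z + t *\<^sub>R h"] t by (simp add: D.scaleR)
  define r where "r = G (z + t *\<^sub>R h) - G z - t *\<^sub>R D h"
  have "t *\<^sub>R D h = (G (z + t *\<^sub>R h) - G z) - r" by (simp add: r_def)
  then have "t\<^sup>2 * (D h \<bullet> v) = (G (z + t *\<^sub>R h) - G z) \<bullet> (t *\<^sub>R v) - t * (r \<bullet> v)"
  proof -
    have "t\<^sup>2 * (D h \<bullet> v) = (t *\<^sub>R D h) \<bullet> (t *\<^sub>R v)" by (simp add: power2_eq_square)
    also have "\<dots> = (G (z + t *\<^sub>R h) - G z) \<bullet> (t *\<^sub>R v) - r \<bullet> (t *\<^sub>R v)"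
      by (simp only: \<open>t *\<^sub>R D h = _\<close> inner_diff_left)
    finally show ?thesis by simp
  qed
  also have "\<dots> \<le> B * t\<^sup>2 + t * (e * (t * norm h) * norm v)"
  proof -
    have "- (r \<bullet> v) \<le> norm r * norm v" using norm_cauchy_schwarz[of "- r" v] by simp
    also have "\<dots> \<le> e * (t * norm h) * norm v" using err unfolding r_def[symmetric] by (intro mult_right_mono) auto
    finally have "t * (- (r \<bullet> v)) \<le> t * (e * (t * norm h) * norm v)" using t by (intro mult_left_mono) auto
    then show ?thesis using bnd[of t] by simp
  qed
  also have "\<dots> = t\<^sup>2 * (B + e * (norm h * norm v))" by (simp add: power2_eq_square algebra_simps)
  finally have "D h \<bullet> v \<le> B + e * (norm h * norm v)" using t by simp
  also have "e * (norm h * norm v) \<le> e * c"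
    using e unfolding c_def by (intro mult_left_mono mult_mono) auto
  also have "e * c = e'" using c by (simp add: e_def)
  finally show "D h \<bullet> v \<le> B + e'" by simp
qed

lemma directional_bound:
  fixes G :: "'a::real_normed_vector \<Rightarrow> 'b::real_inner"
  assumes D: "(G has_derivative D) (at z)"
    and lip: "\<And>t. norm (G (z + t *\<^sub>R h) - G z) \<le> B * \<bar>t\<bar>"
  shows "norm (D h) \<le> B"
proof -
  have bnd: "(G (z + t *\<^sub>R h) - G z) \<bullet> (t *\<^sub>R D h) \<le> (B * norm (D h)) * t\<^sup>2" for t
  proof -
    have "(G (z + t *\<^sub>R h) - G z) \<bullet> (t *\<^sub>R D h) \<le> norm (G (z + t *\<^sub>R h) - G z) * norm (t *\<^sub>R D h)"
      by (rule norm_cauchy_schwarz)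
    moreover have "norm (G (z + t *\<^sub>R h) - G z) * norm (t *\<^sub>R D h) \<le> (B * \<bar>t\<bar>) * norm (t *\<^sub>R D h)"
      by (rule mult_right_mono[OF lip norm_ge_zero])
    moreover have "(B * \<bar>t\<bar>) * norm (t *\<^sub>R D h) = B * norm (D h) * t\<^sup>2"
      by (simp add: power2_eq_square mult_ac)
    ultimately show ?thesis by linarith
  qed
  have "D h \<bullet> D h \<le> B * norm (D h)" by (rule directional_inner_bound[OF D bnd])
  moreover have "0 \<le> B" using order_trans[OF norm_ge_zero lip[of 1]] by simp
  ultimately show ?thesis
    by (cases "D h = 0") (auto simp: dot_square_norm power2_eq_square)
qed

context minimax_problem
begin

section \<open>First-order consequences of smoothness and strong concavity\<close>

lemma grad_f: "GDERIV f z :> grad f z"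
  by (rule GDERIV_grad[OF differentiable])

lemma grad_y_deriv: "GDERIV (\<lambda>y. f (x, y)) y :> grad_y f x y"
proof -
  have "((\<lambda>y. (x, y)) has_derivative (\<lambda>h. (0, h))) (at y)" by (auto intro!: derivative_eq_intros)
  from has_derivative_compose[OF this grad_f[unfolded gderiv_def]]
  show ?thesis unfolding gderiv_def grad_y_def by (simp add: inner_prod_def)
qed

lemma grad_x_deriv: "GDERIV (\<lambda>x. f (x, y)) x :> grad_x f x y"
proof -
  have "((\<lambda>x. (x, y)) has_derivative (\<lambda>h. (h, 0))) (at x)" by (auto intro!: derivative_eq_intros)
  from has_derivative_compose[OF this grad_f[unfolded gderiv_def]]
  show ?thesis unfolding gderiv_def grad_x_def by (simp add: inner_prod_def)
qed

lemma grad_y_lipschitz: "norm (grad_y f x y - grad_y f x' y') \<le> l * norm ((x, y) - (x', y'))"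
  unfolding grad_y_def
  using norm_snd[of "grad f (x, y) - grad f (x', y')"] grad_lipschitz[of "(x, y)" "(x', y')"]
  by simp

lemma grad_x_lipschitz: "norm (grad_x f x y - grad_x f x' y') \<le> l * norm ((x, y) - (x', y'))"
  unfolding grad_x_def
  using norm_fst[of "grad f (x, y) - grad f (x', y')"] grad_lipschitz[of "(x, y)" "(x', y')"]
  by simp

lemma concave_upper:
  "f (x, w) \<le> f (x, y) + grad_y f x y \<bullet> (w - y) - \<mu>/2 * ((w - y) \<bullet> (w - y))"
  by (rule concave_gradient_upper[OF strongly_concave grad_y_deriv])

lemma smooth_lower_y:
  "f (x, y) + grad_y f x y \<bullet> (w - y) - l/2 * ((w - y) \<bullet> (w - y)) \<le> f (x, w)"
proof (rule lipschitz_gradient_lower[where \<phi> = "\<lambda>y. f (x, y)" and G = "grad_y f x", OF grad_y_deriv])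
  show "norm (grad_y f x z - grad_y f x w) \<le> l * norm (z - w)" for z w
    using grad_y_lipschitz[of x z x w] by (simp add: norm_Pair)
qed

lemma strong_monotone:
  "(grad_y f x y - grad_y f x w) \<bullet> (y - w) \<le> - \<mu> * ((y - w) \<bullet> (y - w))"
proof -
  have "(w - y) \<bullet> (w - y) = (y - w) \<bullet> (y - w)" by (simp add: inner_diff_left inner_diff_right)
  then show ?thesis using concave_upper[of x w y] concave_upper[of x y w]
    by (simp add: inner_diff_left inner_diff_right algebra_simps)
qed

lemma mu_le_l: "\<mu> \<le> l"
proof -
  obtain w :: "real^'m" where w: "w \<bullet> w = 1"
    using vector_choose_size[of 1] by (metis zero_le_one norm_eq_1)
  show ?thesis using concave_upper[of 0 w 0] smooth_lower_y[of 0 0 w] by (simp add: w)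
qed

lemma l_pos: "0 < l" using mu_pos mu_le_l by simp

lemma kappa_ge_1: "1 \<le> kappa l \<mu>" using mu_pos mu_le_l by (simp add: kappa_def)

section \<open>Maximisers and the gradient of the maximal function\<close>

lemma maximizer_exists: "\<exists>y. \<forall>w. f (x, w) \<le> f (x, y)"
proof -
  \<comment> \<open>Beyond this radius the strong concavity term outweighs the linear term at the
    origin, so a maximiser over the ball is a global one.\<close>
  define r where "r = 2 * norm (grad_y f x 0) / \<mu>"
  have r: "0 \<le> r" using mu_pos by (simp add: r_def)
  have "continuous_on UNIV f"
    using differentiable by (simp add: continuous_on_eq_continuous_at differentiable_imp_continuous_within)
  then have "continuous_on (cball 0 r) (\<lambda>y. f (x, y))"
    by (rule continuous_on_compose2) (auto intro!: continuous_intros)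
  then obtain y where y: "\<And>w. norm w \<le> r \<Longrightarrow> f (x, w) \<le> f (x, y)"
    using continuous_attains_sup[of "cball 0 r" "\<lambda>y. f (x, y)"] r by force
  have "f (x, w) \<le> f (x, y)" for w
  proof (cases "norm w \<le> r")
    case False
    have "f (x, w) \<le> f (x, 0) + grad_y f x 0 \<bullet> w - \<mu>/2 * (w \<bullet> w)" using concave_upper[of x w 0] by simp
    also have "grad_y f x 0 \<bullet> w \<le> norm (grad_y f x 0) * norm w" by (rule norm_cauchy_schwarz)
    also have "norm (grad_y f x 0) * norm w \<le> \<mu>/2 * norm w * norm w"
      using False mu_pos by (intro mult_right_mono) (auto simp: r_def field_simps)
    also have "\<dots> = \<mu>/2 * (w \<bullet> w)" by (simp add: dot_square_norm power2_eq_square)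
    finally show ?thesis using y[of 0] r by simp
  qed (use y in simp)
  then show ?thesis by blast
qed

lemma y_star_max: "f (x, w) \<le> f (x, y_star f x)"
proof -
  obtain y where "\<forall>w. f (x, w) \<le> f (x, y)" using maximizer_exists by blast
  then have "is_arg_max (\<lambda>y. f (x, y)) (\<lambda>_. True) y" by (simp add: is_arg_max_linorder)
  then have "is_arg_max (\<lambda>y. f (x, y)) (\<lambda>_. True) (y_star f x)"
    unfolding y_star_def arg_max_def by (rule someI)
  then show ?thesis by (simp add: is_arg_max_linorder)
qed

lemma max_fun_eq: "max_fun f x = f (x, y_star f x)"
  unfolding max_fun_def by (rule cSup_eq_maximum) (auto intro: y_star_max)

lemma max_fun_upper: "f (x, y) \<le> max_fun f x"
  using y_star_max by (simp add: max_fun_eq)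

text \<open>A gradient step of length \<open>1/l\<close> from the maximiser would raise
  \<open>f\<close> by at least \<open>|g|^2 / (2 l)\<close>.\<close>

lemma grad_y_y_star: "grad_y f x (y_star f x) = 0"
proof -
  define y g where "y = y_star f x" and "g = grad_y f x y"
  have "f (x, y) + g \<bullet> ((1/l) *\<^sub>R g) - l/2 * (((1/l) *\<^sub>R g) \<bullet> ((1/l) *\<^sub>R g)) \<le> f (x, y)"
    using smooth_lower_y[of x y "y + (1/l) *\<^sub>R g"] y_star_max[of x "y + (1/l) *\<^sub>R g"]
    by (simp add: y_def g_def)
  then have "(g \<bullet> g) / (2 * l) \<le> 0" using l_pos by (simp add: field_split_simps)
  then have "g \<bullet> g \<le> 0" using l_pos by (smt (verit) mult_pos_pos divide_pos_pos)
  then have "g = 0" by (metis inner_gt_zero_iff not_le)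
  then show ?thesis by (simp add: g_def y_def)
qed

text \<open>The y-gradient vanishes at both maximisers, so strong monotonicity in y is paid for by
  the Lipschitz change of the y-gradient in x alone.\<close>

lemma y_star_lipschitz: "norm (y_star f x - y_star f x') \<le> kappa l \<mu> * norm (x - x')"
proof -
  define y y' where "y = y_star f x" and "y' = y_star f x'"
  have "\<mu> * ((y - y') \<bullet> (y - y')) \<le> (grad_y f x y' - grad_y f x y) \<bullet> (y - y')"
    using strong_monotone[of x y y'] by (simp add: inner_diff_left)
  also have "\<dots> = (grad_y f x y' - grad_y f x' y') \<bullet> (y - y')"
    using grad_y_y_star by (simp add: y_def y'_def)
  also have "\<dots> \<le> norm (grad_y f x y' - grad_y f x' y') * norm (y - y')" by (rule norm_cauchy_schwarz)
  also have "\<dots> \<le> (l * norm (x - x')) * norm (y - y')"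
    using grad_y_lipschitz[of x y' x' y'] by (intro mult_right_mono) (auto simp: norm_Pair)
  finally have "\<mu> * norm (y - y') * norm (y - y') \<le> (l * norm (x - x')) * norm (y - y')"
    by (simp add: dot_square_norm power2_eq_square)
  then have "\<mu> * norm (y - y') \<le> l * norm (x - x')"
    using l_pos by (cases "y = y'") (auto simp: mult_le_cancel_right)
  then show ?thesis using mu_pos by (simp add: y_def y'_def kappa_def field_simps)
qed

lemma y_star_pair_lipschitz:
  "norm ((x, y_star f x) - (x', y_star f x')) \<le> (1 + kappa l \<mu>) * norm (x - x')"
  using norm_Pair_le[of "x - x'" "y_star f x - y_star f x'"] y_star_lipschitz[of x x']
  by (simp add: algebra_simps)

lemma grad_x_y_star_lipschitz:
  "norm (grad_x f x (y_star f x) - grad_x f x' (y_star f x')) \<le> L1 l \<mu> * norm (x - x')"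
proof -
  have "norm (grad_x f x (y_star f x) - grad_x f x' (y_star f x'))
      \<le> l * norm ((x, y_star f x) - (x', y_star f x'))" by (rule grad_x_lipschitz)
  also have "\<dots> \<le> l * ((1 + kappa l \<mu>) * norm (x - x'))"
    using y_star_pair_lipschitz l_pos by (intro mult_left_mono) auto
  finally show ?thesis by (simp add: L1_def algebra_simps)
qed

text \<open>Danskin's theorem by a sandwich: freezing the maximiser of \<open>x\<close> bounds the
  increment from below, freezing that of \<open>x'\<close> bounds it from above. The two frozen
  gradients at \<open>x\<close> differ by a multiple of \<open>|x' - x|\<close>, so the remainder is
  quadratic.\<close>

lemma max_fun_deriv: "GDERIV (max_fun f) x :> grad_x f x (y_star f x)"
proof -
  define g where "g = grad_x f x (y_star f x)"
  define c where "c = L1 l \<mu> + l"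
  have L1: "L1 l \<mu> > 0" using l_pos kappa_ge_1 by (simp add: L1_def)
  have c: "c > 0" using l_pos L1 by (simp add: c_def)
  have lipx: "norm (grad_x f z y - grad_x f w y) \<le> l * norm (z - w)" for z w y
    using grad_x_lipschitz[of z y w y] by (simp add: norm_Pair)
  have rem: "norm (max_fun f x' - max_fun f x - (x' - x) \<bullet> g) \<le> c * (norm (x' - x))\<^sup>2" for x'
  proof -
    have lo: "(x' - x) \<bullet> g - l/2 * ((x' - x) \<bullet> (x' - x)) \<le> max_fun f x' - max_fun f x"
      using lipschitz_gradient_lower[OF grad_x_deriv lipx, of x "y_star f x" x']
        max_fun_upper[of x' "y_star f x"] max_fun_eq[of x] by (simp add: g_def inner_commute)
    define g' where "g' = grad_x f x (y_star f x')"
    have "norm (g' - g) \<le> L1 l \<mu> * norm (x' - x)"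
    proof -
      have "norm (g' - g) \<le> l * (kappa l \<mu> * norm (x' - x))"
        unfolding g'_def g_def
        by (rule order_trans[OF grad_x_lipschitz])
          (use y_star_lipschitz[of x' x] l_pos in \<open>auto simp: norm_Pair intro!: mult_left_mono\<close>)
      also have "\<dots> \<le> L1 l \<mu> * norm (x' - x)"
        using l_pos by (simp add: L1_def algebra_simps)
      finally show ?thesis .
    qed
    then have "(x' - x) \<bullet> (g' - g) \<le> L1 l \<mu> * (norm (x' - x))\<^sup>2"
      using norm_cauchy_schwarz[of "x' - x" "g' - g"] mult_left_mono[of "norm (g' - g)" _ "norm (x' - x)"]
      by (force simp: power2_eq_square algebra_simps)
    moreover have "max_fun f x' - max_fun f x \<le> (x' - x) \<bullet> g' + l/2 * ((x' - x) \<bullet> (x' - x))"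
      using lipschitz_gradient_upper[OF grad_x_deriv lipx, of x' "y_star f x'" x]
        max_fun_upper[of x "y_star f x'"] max_fun_eq[of x'] by (simp add: g'_def inner_commute)
    moreover have "(x' - x) \<bullet> (x' - x) = (norm (x' - x))\<^sup>2" by (simp add: power2_norm_eq_inner)
    moreover have "0 \<le> l * (norm (x' - x))\<^sup>2" "0 \<le> L1 l \<mu> * (norm (x' - x))\<^sup>2" using l_pos L1 by auto
    ultimately show ?thesis using lo
      by (simp add: c_def inner_diff_right distrib_right abs_le_iff)
  qed
  have "\<exists>d>0. \<forall>x'. norm (x' - x) < d \<longrightarrow>
      norm (max_fun f x' - max_fun f x - (x' - x) \<bullet> g) \<le> e * norm (x' - x)" if e: "e > 0" for e
  proof (intro exI conjI allI impI)
    show "e / c > 0" using e c by simp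
    fix x' assume "norm (x' - x) < e / c"
    then have "c * norm (x' - x) \<le> e" using c by (simp add: field_simps)
    then have "c * norm (x' - x) * norm (x' - x) \<le> e * norm (x' - x)" by (intro mult_right_mono) auto
    then show "norm (max_fun f x' - max_fun f x - (x' - x) \<bullet> g) \<le> e * norm (x' - x)"
      using rem[of x'] by (simp add: power2_eq_square mult.assoc)
  qed
  then show ?thesis unfolding gderiv_def has_derivative_at_alt g_def[symmetric]
    by (auto intro: bounded_linear_inner_left)
qed

lemma grad_max_fun: "grad (max_fun f) x = grad_x f x (y_star f x)"
  by (rule grad_eqI[OF max_fun_deriv])

lemma max_fun_GDERIV: "GDERIV (max_fun f) x :> grad (max_fun f) x"
  using max_fun_deriv by (simp add: grad_max_fun)

lemma max_fun_differentiable: "max_fun f differentiable (at x)"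
  using max_fun_deriv unfolding gderiv_def differentiable_def by blast

lemma grad_max_fun_lipschitz:
  "norm (grad (max_fun f) x - grad (max_fun f) x') \<le> L1 l \<mu> * norm (x - x')"
  unfolding grad_max_fun by (rule grad_x_y_star_lipschitz)

lemma grad_max_fun_error:
  "norm (grad_x f x y - grad (max_fun f) x) \<le> l * norm (y - y_star f x)"
  using grad_x_lipschitz[of x y x "y_star f x"] by (simp add: grad_max_fun norm_Pair)

text \<open>A gradient step of length \<open>1/L1\<close> cannot fall below \<open>Pstar\<close>.
  This caps the gradient wherever the maximal function is not above its initial value, and hence the
  number of halvings.\<close>

lemma grad_max_fun_sq: "(norm (grad (max_fun f) x))\<^sup>2 \<le> 2 * L1 l \<mu> * (max_fun f x - Pstar)"
proof -
  define g where "g = grad (max_fun f) x"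
  have L1: "L1 l \<mu> > 0" using l_pos kappa_ge_1 by (simp add: L1_def)
  have "Pstar \<le> max_fun f (x - (1/L1 l \<mu>) *\<^sub>R g)" by (rule bounded_below)
  also have "\<dots> \<le> max_fun f x - (g \<bullet> g) / (2 * L1 l \<mu>)"
    using lipschitz_gradient_upper[OF max_fun_GDERIV grad_max_fun_lipschitz, of "x - (1/L1 l \<mu>) *\<^sub>R g" x] L1
    by (simp add: g_def[symmetric] field_simps)
  finally show ?thesis using L1 by (simp add: g_def[symmetric] power2_norm_eq_inner field_simps)
qed

section \<open>Second derivatives and the Hessian of the maximal function\<close>

abbreviation "Fxx \<equiv> hess_xx f"
abbreviation "Fxy \<equiv> hess_xy f"
abbreviation "Fyx \<equiv> hess_yx f"
abbreviation "Fyy \<equiv> hess_yy f"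

lemma grad_derivative:
  "(grad f has_derivative (\<lambda>(h, k). (Fxx (x, y) *v h + Fxy (x, y) *v k, Fyx (x, y) *v h + Fyy (x, y) *v k)))
     (at (x, y))"
proof -
  have "((\<lambda>z. grad_x f (fst z) (snd z)) has_derivative (\<lambda>(h, k). Fxx (x, y) *v h + Fxy (x, y) *v k)) (at (x, y))"
  proof (rule has_derivative_partials_lipschitz[OF _ _ lipschitz_xy])
    show "((\<lambda>x'. grad_x f (fst (x', y)) (snd (x', y))) has_derivative (*v) (Fxx (x, y))) (at x)"
      using differentiable_xx[of y x] unfolding jacobian_works hess_xx_def by simp
    show "((\<lambda>y'. grad_x f (fst (x, y')) (snd (x, y'))) has_derivative (*v) (Fxy (x, y))) (at y)" for x y
      using differentiable_xy[of x y] unfolding jacobian_works hess_xy_def by simp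
  qed
  moreover have "((\<lambda>z. grad_y f (fst z) (snd z)) has_derivative (\<lambda>(h, k). Fyx (x, y) *v h + Fyy (x, y) *v k)) (at (x, y))"
  proof (rule has_derivative_partials_lipschitz[OF _ _ lipschitz_yy])
    show "((\<lambda>x'. grad_y f (fst (x', y)) (snd (x', y))) has_derivative (*v) (Fyx (x, y))) (at x)"
      using differentiable_yx[of y x] unfolding jacobian_works hess_yx_def by simp
    show "((\<lambda>y'. grad_y f (fst (x, y')) (snd (x, y'))) has_derivative (*v) (Fyy (x, y))) (at y)" for x y
      using differentiable_yy[of x y] unfolding jacobian_works hess_yy_def by simp
  qed
  ultimately have "((\<lambda>z. (grad_x f (fst z) (snd z), grad_y f (fst z) (snd z))) has_derivative
      (\<lambda>z. ((\<lambda>(h, k). Fxx (x, y) *v h + Fxy (x, y) *v k) z, (\<lambda>(h, k). Fyx (x, y) *v h + Fyy (x, y) *v k) z))) (at (x, y))"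
    by (rule has_derivative_Pair)
  then show ?thesis by (simp add: grad_x_def grad_y_def case_prod_unfold)
qed

text \<open>Symmetry of the joint Hessian in block form; zero blocks specialise it to the symmetry
  of \<open>Fxx\<close> and \<open>Fyy\<close> and to \<open>Fxy\<close> being adjoint to
  \<open>Fyx\<close>.\<close>

lemma hess_symmetric:
  "(Fxx z *v h + Fxy z *v k) \<bullet> h' + (Fyx z *v h + Fyy z *v k) \<bullet> k'
     = h \<bullet> (Fxx z *v h' + Fxy z *v k') + k \<bullet> (Fyx z *v h' + Fyy z *v k')"
  using hessian_symmetric[OF grad_f grad_derivative[of "fst z" "snd z"], of "(h, k)" "(h', k')"]
  by (simp add: inner_prod_def)

lemma transpose_Fxx: "transpose (Fxx z) = Fxx z"
proof (rule transpose_eqI)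
  fix x y
  show "(Fxx z *v x) \<bullet> y = x \<bullet> (Fxx z *v y)"
    using hess_symmetric[of z x 0 y 0] by simp
qed

lemma transpose_Fyy: "transpose (Fyy z) = Fyy z"
proof (rule transpose_eqI)
  fix x y
  show "(Fyy z *v x) \<bullet> y = x \<bullet> (Fyy z *v y)"
    using hess_symmetric[of z 0 x 0 y] by simp
qed

lemma Fyx_bound: "norm (Fyx z *v h) \<le> l * norm h"
proof (rule directional_bound[where G = "\<lambda>x. grad_y f x (snd z)" and D = "(*v) (Fyx z)" and z = "fst z"])
  show "((\<lambda>x. grad_y f x (snd z)) has_derivative (*v) (Fyx z)) (at (fst z))"
    using differentiable_yx[of "snd z" "fst z"] unfolding jacobian_works hess_yx_def .
  show "norm (grad_y f (fst z + t *\<^sub>R h) (snd z) - grad_y f (fst z) (snd z)) \<le> (l * norm h) * \<bar>t\<bar>" for t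
    using grad_y_lipschitz[of "fst z + t *\<^sub>R h" "snd z" "fst z" "snd z"]
    by (cases z) (simp add: norm_Pair mult_ac)
qed

lemma Fxy_bound: "norm (Fxy z *v k) \<le> l * norm k"
proof (rule directional_bound[where G = "\<lambda>y. grad_x f (fst z) y" and D = "(*v) (Fxy z)" and z = "snd z"])
  show "((\<lambda>y. grad_x f (fst z) y) has_derivative (*v) (Fxy z)) (at (snd z))"
    using differentiable_xy[of "fst z" "snd z"] unfolding jacobian_works hess_xy_def .
  show "norm (grad_x f (fst z) (snd z + t *\<^sub>R k) - grad_x f (fst z) (snd z)) \<le> (l * norm k) * \<bar>t\<bar>" for t
    using grad_x_lipschitz[of "fst z" "snd z + t *\<^sub>R k" "fst z" "snd z"]
    by (cases z) (simp add: norm_Pair mult_ac)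
qed

lemma Fyy_negative: "(Fyy z *v k) \<bullet> k \<le> - \<mu> * (k \<bullet> k)"
proof (rule directional_inner_bound[where G = "\<lambda>y. grad_y f (fst z) y" and D = "(*v) (Fyy z)" and z = "snd z"])
  show "((\<lambda>y. grad_y f (fst z) y) has_derivative (*v) (Fyy z)) (at (snd z))"
    using differentiable_yy[of "fst z" "snd z"] unfolding jacobian_works hess_yy_def .
  show "(grad_y f (fst z) (snd z + t *\<^sub>R k) - grad_y f (fst z) (snd z)) \<bullet> (t *\<^sub>R k)
      \<le> (- \<mu> * (k \<bullet> k)) * t\<^sup>2" for t
    using strong_monotone[of "fst z" "snd z + t *\<^sub>R k" "snd z"] by (simp add: power2_eq_square mult_ac)
qed

lemma Fyy_lower: "\<mu> * norm k \<le> norm (Fyy z *v k)"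
proof -
  have "\<mu> * (norm k * norm k) \<le> - (Fyy z *v k) \<bullet> k"
    using Fyy_negative[of z k] by (simp add: dot_square_norm power2_eq_square)
  also have "\<dots> \<le> norm (Fyy z *v k) * norm k" using norm_cauchy_schwarz[of "- (Fyy z *v k)" k] by simp
  finally show ?thesis by (cases "k = 0") auto
qed

lemma Fyy_right_inverse: "\<exists>N. Fyy z ** N = mat 1"
proof -
  have "inj ((*v) (Fyy z))"
  proof (rule injI)
    fix k k' assume "Fyy z *v k = Fyy z *v k'"
    then have "Fyy z *v (k - k') = 0" by (simp add: matrix_vector_mult_diff_distrib)
    then show "k = k'" using Fyy_lower[of "k - k'" z] mu_pos by (simp add: mult_le_0_iff)
  qed
  then obtain B where "B ** Fyy z = mat 1" using matrix_left_invertible_injective by blast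
  then have "Fyy z ** B = mat 1" using matrix_left_right_inverse by blast
  then show ?thesis by blast
qed

text \<open>The matrix \<open>- Fyy^-1 Fyx\<close> of the implicit function theorem; the chosen
  inverse matters only through \<open>y_star_jacobian_eq\<close>.\<close>

definition y_star_jacobian :: "real^'n \<Rightarrow> real^'n^'m" where
  "y_star_jacobian x =
     - ((SOME N. Fyy (x, y_star f x) ** N = mat 1) ** Fyx (x, y_star f x))"

lemma y_star_jacobian_eq:
  "Fyy (x, y_star f x) *v (y_star_jacobian x *v h) = - (Fyx (x, y_star f x) *v h)"
proof -
  define z N where "z = (x, y_star f x)" and "N = (SOME N. Fyy z ** N = mat 1)"
  have N: "Fyy z ** N = mat 1" unfolding N_def using Fyy_right_inverse by (rule someI_ex)
  have "y_star_jacobian x = - (N ** Fyx z)" by (simp add: y_star_jacobian_def z_def N_def)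
  then have "Fyy z *v (y_star_jacobian x *v h) = - (Fyy z *v (N *v (Fyx z *v h)))"
    using matrix_vector_mult_diff_rdistrib[of 0 "N ** Fyx z"] matrix_vector_mult_diff_distrib[of "Fyy z" 0]
    by (simp add: matrix_vector_mul_assoc matrix_mul_assoc)
  also have "\<dots> = - ((Fyy z ** N) *v (Fyx z *v h))" by (simp only: matrix_vector_mul_assoc matrix_mul_assoc)
  also have "\<dots> = - (Fyx z *v h)" by (simp add: N)
  finally show ?thesis by (simp only: z_def)
qed

lemma y_star_jacobian_bound: "norm (y_star_jacobian x *v h) \<le> kappa l \<mu> * norm h"
proof -
  have "\<mu> * norm (y_star_jacobian x *v h) \<le> norm (Fyx (x, y_star f x) *v h)"
    using Fyy_lower[of "y_star_jacobian x *v h" "(x, y_star f x)"] by (simp add: y_star_jacobian_eq)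
  also have "\<dots> \<le> l * norm h" by (rule Fyx_bound)
  finally show ?thesis using mu_pos by (simp add: kappa_def field_simps)
qed

text \<open>Implicit differentiation of \<open>grad_y f x (y_star f x) = 0\<close>.\<close>

lemma y_star_derivative: "(y_star f has_derivative (*v) (y_star_jacobian x)) (at x)"
proof -
  define z where "z = (x, y_star f x)"
  define J where "J = y_star_jacobian x"
  have k1: "0 < 1 + kappa l \<mu>" using kappa_ge_1 by simp
  have D: "(grad f has_derivative (\<lambda>(h, k). (Fxx z *v h + Fxy z *v k, Fyx z *v h + Fyy z *v k))) (at z)"
    using grad_derivative unfolding z_def .
  have "\<exists>d>0. \<forall>x'. norm (x' - x) < d \<longrightarrow>
      norm (y_star f x' - y_star f x - J *v (x' - x)) \<le> e * norm (x' - x)" if e: "e > 0" for e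
  proof -
    \<comment> \<open>Scaled for two losses: \<open>1/\<mu>\<close> from inverting
      \<open>Fyy\<close>, and \<open>1 + \<kappa>\<close> from measuring the increment of the pair
      by that of \<open>x\<close>.\<close>
    define e' where "e' = e * \<mu> / (1 + kappa l \<mu>)"
    have e': "e' > 0" using e mu_pos k1 by (simp add: e'_def)
    obtain d where d: "d > 0" and D': "\<And>w. norm (w - z) < d \<Longrightarrow>
        norm (grad f w - grad f z - (\<lambda>(h, k). (Fxx z *v h + Fxy z *v k, Fyx z *v h + Fyy z *v k)) (w - z))
          \<le> e' * norm (w - z)"
      using D e' unfolding has_derivative_at_alt by blast
    show ?thesis
    proof (intro exI[of _ "d / (1 + kappa l \<mu>)"] conjI allI impI)
      show "d / (1 + kappa l \<mu>) > 0" using d k1 by simp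
      fix x' assume x': "norm (x' - x) < d / (1 + kappa l \<mu>)"
      define w h k where "w = (x', y_star f x')" and "h = x' - x" and "k = y_star f x' - y_star f x"
      have wz: "w - z = (h, k)" by (simp add: w_def z_def h_def k_def)
      have nw: "norm (w - z) \<le> (1 + kappa l \<mu>) * norm h"
        unfolding w_def z_def h_def by (rule y_star_pair_lipschitz)
      also have "\<dots> < d" using x' k1 by (simp add: h_def field_simps)
      finally have "norm (grad f w - grad f z - (Fxx z *v h + Fxy z *v k, Fyx z *v h + Fyy z *v k))
          \<le> e' * norm (w - z)" using D'[of w] by (simp add: wz)
      moreover have "norm (snd (grad f w - grad f z - (Fxx z *v h + Fxy z *v k, Fyx z *v h + Fyy z *v k)))
          \<le> norm (grad f w - grad f z - (Fxx z *v h + Fxy z *v k, Fyx z *v h + Fyy z *v k))"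
        by (rule norm_snd)
      moreover have "snd (grad f w) = 0" "snd (grad f z) = 0"
        using grad_y_y_star[of x'] grad_y_y_star[of x] by (simp_all add: grad_y_def w_def z_def)
      ultimately have "norm (Fyx z *v h + Fyy z *v k) \<le> e' * norm (w - z)"
        by (simp add: norm_minus_commute add.commute)
      moreover have "Fyy z *v (k - J *v h) = Fyx z *v h + Fyy z *v k"
        using y_star_jacobian_eq[of x h] by (simp add: matrix_vector_mult_diff_distrib J_def z_def)
      ultimately have "\<mu> * norm (k - J *v h) \<le> e' * norm (w - z)"
        using Fyy_lower[of "k - J *v h" z] by simp
      also have "\<dots> \<le> e' * ((1 + kappa l \<mu>) * norm h)" using nw e' by (intro mult_left_mono) auto
      also have "\<dots> = \<mu> * (e * norm h)" using k1 by (simp add: e'_def)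
      finally show "norm (y_star f x' - y_star f x - J *v (x' - x)) \<le> e * norm (x' - x)"
        using mu_pos by (simp add: h_def k_def)
    qed
  qed
  then show ?thesis unfolding has_derivative_at_alt J_def
    by (auto intro: matrix_vector_mul_bounded_linear)
qed

lemma grad_max_fun_derivative_aux:
  "(grad (max_fun f) has_derivative
     (\<lambda>h. Fxx (x, y_star f x) *v h + Fxy (x, y_star f x) *v (y_star_jacobian x *v h))) (at x)"
proof -
  have "((\<lambda>x. (x, y_star f x)) has_derivative (\<lambda>h. (h, y_star_jacobian x *v h))) (at x)"
    by (intro has_derivative_Pair has_derivative_ident y_star_derivative)
  from has_derivative_fst[OF has_derivative_compose[OF this grad_derivative]]
  have "((\<lambda>x. grad_x f x (y_star f x)) has_derivative
     (\<lambda>h. Fxx (x, y_star f x) *v h + Fxy (x, y_star f x) *v (y_star_jacobian x *v h))) (at x)"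
    by (simp add: grad_x_def)
  moreover have "grad (max_fun f) = (\<lambda>x. grad_x f x (y_star f x))" by (rule ext) (rule grad_max_fun)
  ultimately show ?thesis by simp
qed

lemma grad_max_fun_differentiable: "grad (max_fun f) differentiable (at x)"
  using grad_max_fun_derivative_aux unfolding differentiable_def by blast

lemma grad_max_fun_derivative: "(grad (max_fun f) has_derivative (*v) (hess (max_fun f) x)) (at x)"
  using grad_max_fun_differentiable unfolding jacobian_works hess_def .

lemma hess_max_fun:
  "hess (max_fun f) x *v h = Fxx (x, y_star f x) *v h + Fxy (x, y_star f x) *v (y_star_jacobian x *v h)"
  using has_derivative_unique[OF grad_max_fun_derivative[of x] grad_max_fun_derivative_aux[of x]]
  by (rule fun_cong)

lemma hess_max_fun_bound: "norm (hess (max_fun f) x *v h) \<le> L1 l \<mu> * norm h"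
proof (rule directional_bound[OF grad_max_fun_derivative])
  show "norm (grad (max_fun f) (x + t *\<^sub>R h) - grad (max_fun f) x) \<le> L1 l \<mu> * norm h * \<bar>t\<bar>" for t
    using grad_max_fun_lipschitz[of "x + t *\<^sub>R h" x] by (simp add: mult_ac)
qed

text \<open>Subtracting the implicit equations at \<open>x\<close> and \<open>x'\<close> bounds the
  change of the Jacobian. The contributions add up to
  \<open>1 + \<kappa> (1 + \<kappa>) + \<kappa> = (1 + \<kappa>)^2\<close>, and the movement of
  \<open>(x, y_star f x)\<close> adds another \<open>1 + \<kappa>\<close>: this is the cube in
  \<open>L2\<close>.\<close>

lemma hess_max_fun_lipschitz:
  "norm (hess (max_fun f) x *v h - hess (max_fun f) x' *v h) \<le> L2 l \<mu> \<rho> * norm (x - x') * norm h"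
proof -
  define \<kappa> where "\<kappa> = kappa l \<mu>"
  have k: "\<kappa> \<ge> 1" using kappa_ge_1 by (simp add: \<kappa>_def)
  define z z' where "z = (x, y_star f x)" and "z' = (x', y_star f x')"
  define a a' where "a = y_star_jacobian x *v h" and "a' = y_star_jacobian x' *v h"
  define d where "d = norm (z - z')"
  have d: "d \<le> (1 + \<kappa>) * norm (x - x')"
    unfolding d_def z_def z'_def \<kappa>_def by (rule y_star_pair_lipschitz)
  have a': "norm a' \<le> \<kappa> * norm h" unfolding a'_def \<kappa>_def by (rule y_star_jacobian_bound)
  have sp: "norm (A *v v - B *v v) \<le> \<rho> * d * norm v" if "spectral_norm (A - B) \<le> \<rho> * d"
    for A B :: "real^'q^'r" and v
  proof -
    have "A *v v - B *v v = (A - B) *v v" by (simp add: matrix_vector_mult_diff_rdistrib)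
    then show ?thesis
      using spectral_norm_bound[of "A - B" v] mult_right_mono[OF that, of "norm v"] by simp
  qed
  have "Fyy z *v (a - a') = - (Fyx z *v h - Fyx z' *v h) - (Fyy z *v a' - Fyy z' *v a')"
    using y_star_jacobian_eq[of x h] y_star_jacobian_eq[of x' h]
    by (simp add: matrix_vector_mult_diff_distrib a_def a'_def z_def z'_def)
  then have "norm (Fyy z *v (a - a')) \<le> norm (Fyx z *v h - Fyx z' *v h) + norm (Fyy z *v a' - Fyy z' *v a')"
    using norm_triangle_ineq4[of "- (Fyx z *v h - Fyx z' *v h)" "Fyy z *v a' - Fyy z' *v a'"]
    by (simp only: norm_minus_cancel)
  also have "\<dots> \<le> \<rho> * d * norm h + \<rho> * d * norm a'"
    using lipschitz_yx[of z z'] lipschitz_yy[of z z'] unfolding d_def[symmetric] by (intro add_mono sp)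
  also have "\<dots> \<le> \<rho> * d * norm h + \<rho> * d * (\<kappa> * norm h)"
    using a' rho_pos by (intro add_mono mult_left_mono) (auto simp: d_def)
  finally have "\<mu> * norm (a - a') \<le> (1 + \<kappa>) * (\<rho> * d * norm h)"
    using Fyy_lower[of "a - a'" z] by (simp add: algebra_simps)
  then have "(l / \<mu>) * (\<mu> * norm (a - a')) \<le> (l / \<mu>) * ((1 + \<kappa>) * (\<rho> * d * norm h))"
    using l_pos mu_pos by (intro mult_left_mono) auto
  then have aa: "l * norm (a - a') \<le> \<kappa> * (1 + \<kappa>) * (\<rho> * d * norm h)"
    using mu_pos by (simp add: \<kappa>_def kappa_def)
  have "hess (max_fun f) x *v h - hess (max_fun f) x' *v h
      = (Fxx z *v h - Fxx z' *v h) + (Fxy z *v (a - a')) + (Fxy z *v a' - Fxy z' *v a')"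
    by (simp add: hess_max_fun z_def z'_def a_def a'_def matrix_vector_mult_diff_distrib)
  also have "norm \<dots> \<le> norm (Fxx z *v h - Fxx z' *v h) + norm (Fxy z *v (a - a'))
      + norm (Fxy z *v a' - Fxy z' *v a')"
    by (meson norm_triangle_ineq add_right_mono order_trans)
  also have "\<dots> \<le> \<rho> * d * norm h + l * norm (a - a') + \<rho> * d * norm a'"
    using lipschitz_xx[of z z'] lipschitz_xy[of z z'] unfolding d_def[symmetric]
    by (intro add_mono sp Fxy_bound)
  also have "\<dots> \<le> \<rho> * d * norm h + \<kappa> * (1 + \<kappa>) * (\<rho> * d * norm h) + \<rho> * d * (\<kappa> * norm h)"
    using a' aa rho_pos by (intro add_mono mult_left_mono) (auto simp: d_def)
  also have "\<dots> = \<rho> * (1 + \<kappa>)\<^sup>2 * norm h * d" by (simp add: power2_eq_square algebra_simps)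
  also have "\<dots> \<le> \<rho> * (1 + \<kappa>)\<^sup>2 * norm h * ((1 + \<kappa>) * norm (x - x'))"
    using d rho_pos by (intro mult_left_mono) auto
  also have "\<dots> = L2 l \<mu> \<rho> * norm (x - x') * norm h"
    by (simp add: L2_def \<kappa>_def power2_eq_square power3_eq_cube)
  finally show ?thesis .
qed

text \<open>The momentum rate for \<open>- f (x, _)\<close> concerns the squared distance; taking
  the root halves the exponent, whence the factor 2 in the prescribed \<open>N t\<close>.\<close>

lemma agd_accuracy:
  "norm (fst (agd f (1 / l) ((sqrt (kappa l \<mu>) - 1) / (sqrt (kappa l \<mu>) + 1)) x y0 N) - y_star f x)
     \<le> sqrt (kappa l \<mu> + 1) * exp (- real N / (2 * sqrt (kappa l \<mu>))) * norm (y0 - y_star f x)"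
proof -
  define \<kappa> where "\<kappa> = kappa l \<mu>"
  define s where "s = agd f (1 / l) ((sqrt \<kappa> - 1) / (sqrt \<kappa> + 1)) x y0"
  define ys where "ys = y_star f x"
  have sS: "s (Suc k) = (let y' = snd (s k) + (1/l) *\<^sub>R grad_y f x (snd (s k))
      in (y', y' + ((sqrt \<kappa> - 1) / (sqrt \<kappa> + 1)) *\<^sub>R (y' - fst (s k))))" for k
    by (simp add: s_def split_beta Let_def)
  have "(fst (s N) - ys) \<bullet> (fst (s N) - ys)
      \<le> (l/\<mu> + 1) * exp (- real N / sqrt (l/\<mu>)) * ((fst (s 0) - ys) \<bullet> (fst (s 0) - ys))"
  proof (rule accelerated_gradient_rate(2)[where h = "\<lambda>y. - f (x, y)" and G = "\<lambda>y. - grad_y f x y"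
        and z = "\<lambda>k. snd (s k)"])
    show "- f (x, u) + - grad_y f x u \<bullet> (w - u) + \<mu>/2 * ((w - u) \<bullet> (w - u)) \<le> - f (x, w)" for u w
      using concave_upper[of x w u] by simp
    show "- f (x, w) \<le> - f (x, u) + - grad_y f x u \<bullet> (w - u) + l/2 * ((w - u) \<bullet> (w - u))" for u w
      using smooth_lower_y[of x u w] by simp
  qed (simp_all add: mu_pos mu_le_l grad_y_y_star ys_def sS Let_def \<kappa>_def kappa_def, simp add: s_def)
  then have "(norm (fst (s N) - ys))\<^sup>2
      \<le> (sqrt (\<kappa> + 1) * exp (- real N / (2 * sqrt \<kappa>)) * norm (y0 - ys))\<^sup>2"
    using kappa_ge_1
    by (simp add: \<kappa>_def kappa_def s_def power2_norm_eq_inner power_mult_distrib exp_double[symmetric])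
  then show ?thesis unfolding s_def ys_def \<kappa>_def
    by (rule power2_le_imp_le) (use kappa_ge_1 in auto)
qed

end

section \<open>The approximate Hessian\<close>

lemma chebyshev_apply:
  "chebyshev Z (Suc (Suc k)) *v x = 2 *\<^sub>R (Z *v (chebyshev Z (Suc k) *v x)) - chebyshev Z k *v x"
  by (simp add: matrix_vector_mult_diff_rdistrib matrix_vector_mul_assoc scaleR_matrix_vector_assoc[symmetric])

lemma chebyshev_commute: "Z *v (chebyshev Z k *v x) = chebyshev Z k *v (Z *v x)"
proof (induction Z k arbitrary: x rule: chebyshev.induct)
  case (3 Z k)
  then show ?case
    by (simp only: chebyshev_apply matrix_vector_mult_diff_distrib matrix_vector_mult_scaleR)
qed simp_all

lemma chebyshev_symmetric:
  assumes "transpose Z = Z"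
  shows "(chebyshev Z k *v x) \<bullet> y = x \<bullet> (chebyshev Z k *v y)"
  using assms
proof (induction Z k arbitrary: x y rule: chebyshev.induct)
  case (2 Z)
  then show ?case by (simp add: symmetric_inner)
next
  case (3 Z k)
  have "(Z *v (chebyshev Z (Suc k) *v x)) \<bullet> y = x \<bullet> (Z *v (chebyshev Z (Suc k) *v y))"
    unfolding symmetric_inner[OF 3(3)] 3(1)[OF 3(3)] chebyshev_commute ..
  then show ?case using 3(2)[OF 3(3)]
    by (simp only: chebyshev_apply inner_diff_left inner_diff_right inner_scaleR_left inner_scaleR_right)
qed simp

text \<open>Closeness of the approximate Hessian to that of the maximal function is a condition on
  each step of the run. What has to be derived for the truncated series is symmetry, so that
  spectral arguments apply to it.\<close>

lemma chebyshev_inverse_symmetric: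
  assumes "transpose X = X"
  shows "(chebyshev_inverse l \<mu> K X *v x) \<bullet> y = x \<bullet> (chebyshev_inverse l \<mu> K X *v y)"
proof -
  define Z where "Z = (2 / (l - \<mu>)) *\<^sub>R X - ((l + \<mu>) / (l - \<mu>)) *\<^sub>R mat 1"
  have "transpose Z = Z"
    by (rule transpose_eqI)
      (simp add: Z_def matrix_vector_mult_diff_rdistrib scaleR_matrix_vector_assoc[symmetric]
        inner_diff_left inner_diff_right symmetric_inner[OF assms])
  note T = chebyshev_symmetric[OF this]
  define q where "q = (sqrt l - sqrt \<mu>) / (sqrt l + sqrt \<mu>)"
  have sum: "(\<Sum>k\<in>S. (- q) ^ k *\<^sub>R chebyshev Z k) *v u = (\<Sum>k\<in>S. (- q) ^ k *\<^sub>R (chebyshev Z k *v u))"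
    if "finite S" for S u
    using that by (induction S rule: finite_induct)
      (simp_all add: matrix_vector_mult_add_rdistrib scaleR_matrix_vector_assoc)
  have "chebyshev_inverse l \<mu> K X *v u =
      (1 / sqrt (l * \<mu>)) *\<^sub>R (u + 2 *\<^sub>R (\<Sum>k=1..K. (- q) ^ k *\<^sub>R (chebyshev Z k *v u)))" for u
    unfolding chebyshev_inverse_def Let_def Z_def[symmetric] q_def[symmetric]
    by (simp add: scaleR_matrix_vector_assoc[symmetric] matrix_vector_mult_add_rdistrib sum)
  then show ?thesis
    by (simp add: inner_add_left inner_add_right inner_sum_left inner_sum_right T)
qed

section \<open>Continuity of the approximate Hessian\<close>

lemma continuous_on_matrixI:
  fixes A :: "'a::topological_space \<Rightarrow> real^'n^'m"
  assumes "\<And>i j. continuous_on S (\<lambda>x. A x $ i $ j)"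
  shows "continuous_on S A"
proof -
  have "continuous_on S (\<lambda>x. \<chi> i j. A x $ i $ j)"
    by (intro continuous_on_vec_lambda assms)
  then show ?thesis by simp
qed

lemma continuous_on_matrix_mult:
  fixes A :: "'a::topological_space \<Rightarrow> real^'n^'m" and B :: "'a \<Rightarrow> real^'p^'n"
  assumes "continuous_on S A" "continuous_on S B"
  shows "continuous_on S (\<lambda>x. A x ** B x)"
  unfolding matrix_matrix_mult_def by (intro continuous_intros assms)

lemma continuous_on_chebyshev: "continuous_on UNIV (\<lambda>Z::real^'m^'m. chebyshev Z k)"
proof -
  have "continuous_on UNIV (\<lambda>Z::real^'m^'m. chebyshev Z k)
      \<and> continuous_on UNIV (\<lambda>Z::real^'m^'m. chebyshev Z (Suc k))"
  proof (induction k)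
    case 0
    show ?case by (auto intro!: continuous_intros)
  next
    case (Suc k)
    then show ?case
      unfolding chebyshev.simps by (intro conjI continuous_on_diff continuous_on_scaleR
          continuous_on_const continuous_on_matrix_mult continuous_on_id) (erule conjE; assumption)+
  qed
  then show ?thesis ..
qed

lemma continuous_on_chebyshev_inverse: "continuous_on UNIV (\<lambda>X. chebyshev_inverse l \<mu> K X)"
  unfolding chebyshev_inverse_def Let_def
  by (intro continuous_intros continuous_on_compose2[OF continuous_on_chebyshev _ subset_UNIV]
      continuous_on_id)

lemma spectral_norm_entry: "\<bar>A $ i $ j\<bar> \<le> spectral_norm A"
proof -
  have "\<bar>A $ i $ j\<bar> = \<bar>(A *v axis j 1) $ i\<bar>" by (simp add: matrix_vector_mult_basis column_def)
  also have "\<dots> \<le> norm (A *v axis j 1)" by (rule component_le_norm_cart)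
  also have "\<dots> \<le> spectral_norm A" using spectral_norm_bound[of A "axis j 1"] by simp
  finally show ?thesis .
qed

lemma continuous_on_spectral_lipschitz:
  fixes A :: "'a::real_normed_vector \<Rightarrow> real^'n^'m"
  assumes "\<And>z z'. spectral_norm (A z - A z') \<le> \<rho> * norm (z - z')" and "0 \<le> \<rho>"
  shows "continuous_on S A"
proof (rule continuous_on_matrixI)
  fix i j
  have "\<bar>A z $ i $ j - A z' $ i $ j\<bar> \<le> \<rho> * norm (z - z')" for z z'
    using spectral_norm_entry[of "A z - A z'" i j] assms(1)[of z z'] by simp
  then have "\<rho>-lipschitz_on S (\<lambda>z. A z $ i $ j)"
    using assms(2) by (intro lipschitz_onI) (auto simp: dist_norm)
  then show "continuous_on S (\<lambda>z. A z $ i $ j)" by (rule lipschitz_on_continuous_on)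
qed

context minimax_problem
begin

lemma approx_hess_symmetric: "transpose (approx_hess f l \<mu> K z) = approx_hess f l \<mu> K z"
proof (rule transpose_eqI)
  fix x y
  have m: "transpose (- Fyy z) = - Fyy z"
    using transpose_scalar[of "-1" "Fyy z"] by (simp add: transpose_Fyy)
  have xy: "(Fxy z *v k) \<bullet> h = k \<bullet> (Fyx z *v h)" for k h
    using hess_symmetric[of z 0 k h 0] by simp
  have "approx_hess f l \<mu> K z *v u
      = Fxx z *v u + Fxy z *v (chebyshev_inverse l \<mu> K (- Fyy z) *v (Fyx z *v u))" for u
    by (simp add: approx_hess_def matrix_vector_mult_add_rdistrib matrix_vector_mul_assoc matrix_mul_assoc)
  then show "(approx_hess f l \<mu> K z *v x) \<bullet> y = x \<bullet> (approx_hess f l \<mu> K z *v y)"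
    using xy[of "chebyshev_inverse l \<mu> K (- Fyy z) *v (Fyx z *v x)" y]
      xy[of "chebyshev_inverse l \<mu> K (- Fyy z) *v (Fyx z *v y)" x]
      chebyshev_inverse_symmetric[OF m, of l \<mu> K "Fyx z *v x" "Fyx z *v y"]
      symmetric_inner[OF transpose_Fxx, of z x y]
    by (simp add: inner_add_left inner_add_right inner_commute)
qed

text \<open>Stated for a fixed number of terms; the random number \<open>K t\<close> is later
  treated by a countable case distinction, which makes the matrix of an iteration
  measurable.\<close>

lemma continuous_approx_hess: "continuous_on UNIV (\<lambda>z. approx_hess f l \<mu> K z)"
  unfolding approx_hess_def
  by (intro continuous_intros continuous_on_matrix_mult
      continuous_on_compose2[OF continuous_on_chebyshev_inverse _ subset_UNIV])
    (rule continuous_on_spectral_lipschitz[OF _ less_imp_le[OF rho_pos]],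
      rule lipschitz_xx lipschitz_xy lipschitz_yx lipschitz_yy)+

lemma continuous_grad_x: "continuous_on UNIV (\<lambda>z. grad_x f (fst z) (snd z))"
  unfolding grad_x_def using continuous_grad by (auto intro!: continuous_intros)

end

section \<open>The Lanczos procedure\<close>

text \<open>The eigenvalues in the definition are exactly those of an orthonormal eigenbasis, so
  \<open>Min\<close> ranges over a finite nonempty set and bounds the quadratic form term by
  term.\<close>

lemma lambda_min_symmetric:
  fixes A :: "real^'n^'n"
  assumes sym: "transpose A = A"
  obtains e where "norm e = 1" "A *v e = lambda_min A *\<^sub>R e" "\<And>x. lambda_min A * (x \<bullet> x) \<le> x \<bullet> (A *v x)"
proof -
  obtain E ev where E: "finite E" "\<And>e. e \<in> E \<Longrightarrow> norm e = 1" "\<And>e. e \<in> E \<Longrightarrow> A *v e = ev e *\<^sub>R e"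
    and expand: "\<And>x y. x \<bullet> y = (\<Sum>e\<in>E. (x \<bullet> e) * (y \<bullet> e))"
    using symmetric_eigenbasis[OF sym] by blast
  define spec where "spec = {lam. \<exists>v. v \<noteq> 0 \<and> A *v v = lam *\<^sub>R v}"
  have "spec \<subseteq> ev ` E"
  proof
    fix lam assume "lam \<in> spec"
    then obtain v where v: "v \<noteq> 0" "A *v v = lam *\<^sub>R v" by (auto simp: spec_def)
    have "\<exists>e\<in>E. v \<bullet> e \<noteq> 0"
    proof (rule ccontr)
      assume "\<not> (\<exists>e\<in>E. v \<bullet> e \<noteq> 0)"
      then have "v \<bullet> v = 0" unfolding expand[of v v] by (intro sum.neutral) auto
      then show False using v by simp
    qed
    then obtain e where e: "e \<in> E" "v \<bullet> e \<noteq> 0" by blast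
    have "lam * (v \<bullet> e) = ev e * (v \<bullet> e)"
      using symmetric_inner[OF sym, of v e] v(2) E(3)[OF e(1)] by simp
    then show "lam \<in> ev ` E" using e by auto
  qed
  moreover have "ev ` E \<subseteq> spec"
  proof clarify
    fix e assume e: "e \<in> E"
    then have "e \<noteq> 0" using E(2)[OF e] by auto
    then show "ev e \<in> spec" unfolding spec_def using E(3)[OF e] by blast
  qed
  ultimately have spec: "spec = ev ` E" by blast
  have min: "lambda_min A = Min (ev ` E)" unfolding lambda_min_def spec_def[symmetric] spec ..
  obtain w :: "real^'n" where "w \<bullet> w = 1"
    using vector_choose_size[of 1] by (metis zero_le_one norm_eq_1)
  then have "E \<noteq> {}" using expand[of w w] by auto
  then have "lambda_min A \<in> ev ` E" unfolding min using E(1) by (intro Min_in) auto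
  then obtain e where e: "e \<in> E" "lambda_min A = ev e" by auto
  have "lambda_min A * (x \<bullet> x) \<le> x \<bullet> (A *v x)" for x
  proof -
    have "lambda_min A * (x \<bullet> x) = (\<Sum>e\<in>E. lambda_min A * ((x \<bullet> e) * (x \<bullet> e)))"
      unfolding expand[of x x] by (simp add: sum_distrib_left)
    also have "\<dots> \<le> (\<Sum>e\<in>E. ev e * ((x \<bullet> e) * (x \<bullet> e)))"
      unfolding min using E(1) by (intro sum_mono mult_right_mono Min_le) auto
    also have "\<dots> = (\<Sum>e\<in>E. (x \<bullet> e) * ((A *v x) \<bullet> e))"
      using E(3) by (intro sum.cong) (auto simp: symmetric_inner[OF sym])
    also have "\<dots> = x \<bullet> (A *v x)" using expand[of x "A *v x"] by simp
    finally show ?thesis .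
  qed
  then show thesis using that[of e] E(2,3) e by auto
qed

section \<open>Krylov spaces of the Lanczos recurrence and their accuracy\<close>

definition lanczos_space :: "real^'n^'n \<Rightarrow> real^'n \<Rightarrow> nat \<Rightarrow> (real^'n) set" where
  "lanczos_space A b j = span (lanczos_vector A b ` {..<j})"

lemma subspace_lanczos_space: "subspace (lanczos_space A b j)"
  by (simp add: lanczos_space_def)

lemma lanczos_space_mono: "i \<le> j \<Longrightarrow> lanczos_space A b i \<subseteq> lanczos_space A b j"
  unfolding lanczos_space_def by (intro span_mono image_mono) auto

lemma lanczos_vector_in_space: "i < j \<Longrightarrow> lanczos_vector A b i \<in> lanczos_space A b j"
  unfolding lanczos_space_def by (intro span_base) auto

text \<open>The three-term recurrence is solved for \<open>A q_k\<close>. The identity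
  \<open>r = norm r *\<^sub>R sgn r\<close> holds at breakdown as well, when \<open>A q_k\<close>
  already lies in the span of the last two vectors.\<close>

lemma lanczos_krylov:
  assumes "x \<in> lanczos_space A b j"
  shows "A *v x \<in> lanczos_space A b (Suc j)"
proof -
  note sub = subspace_lanczos_space[of A b "Suc j"]
  have prev: "fst (lanczos_state A b k) \<in> lanczos_space A b k" for k
  proof (cases k)
    case 0
    then show ?thesis by (simp add: lanczos_space_def)
  next
    case (Suc i)
    then have "fst (lanczos_state A b k) = lanczos_vector A b i"
      by (simp add: lanczos_vector_def split_beta Let_def)
    then show ?thesis using lanczos_vector_in_space[of i k] Suc by simp
  qed
  have gen: "A *v lanczos_vector A b k \<in> lanczos_space A b (Suc j)" if "k < j" for k
  proof -
    define p q \<beta> where "p = fst (lanczos_state A b k)" and "q = lanczos_vector A b k"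
      and "\<beta> = snd (snd (lanczos_state A b k))"
    define r where "r = A *v q - \<beta> *\<^sub>R p - (q \<bullet> (A *v q)) *\<^sub>R q"
    have "lanczos_vector A b (Suc k) = sgn r"
      by (simp add: lanczos_vector_def split_beta Let_def r_def p_def q_def \<beta>_def)
    moreover have "r = norm r *\<^sub>R sgn r" by (cases "r = 0") (simp_all add: sgn_div_norm)
    ultimately have "A *v q = norm r *\<^sub>R lanczos_vector A b (Suc k) + \<beta> *\<^sub>R p + (q \<bullet> (A *v q)) *\<^sub>R q"
      by (simp add: r_def)
    moreover have "lanczos_vector A b (Suc k) \<in> lanczos_space A b (Suc j)"
      "q \<in> lanczos_space A b (Suc j)" "p \<in> lanczos_space A b (Suc j)"
      using that prev[of k] lanczos_space_mono[of k "Suc j" A b]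
      by (auto simp: q_def p_def intro: lanczos_vector_in_space)
    ultimately have "A *v q \<in> lanczos_space A b (Suc j)"
      using sub by (metis subspace_add subspace_scale)
    then show ?thesis by (simp add: q_def)
  qed
  show ?thesis
    using assms unfolding lanczos_space_def[of A b j]
  proof (induction rule: span_induct_alt)
    case base
    show ?case using sub by (simp add: subspace_0)
  next
    case (step c x y)
    then show ?case using gen sub
      by (auto simp: matrix_vector_right_distrib matrix_vector_mult_scaleR intro!: subspace_add subspace_scale)
  qed
qed

text \<open>The momentum iteration with gradient \<open>(A - lambda_min A) z\<close>, started at \<open>b\<close>, stays in the Krylov
  space; it fixes the component of \<open>b\<close> along a least eigenvector and contracts the components
  belonging to eigenvalues above \<open>lambda_min A + tol/2\<close>.\<close>

lemma lanczos_accuracy: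
  fixes A :: "real^'n^'n" and b e :: "real^'n" and B tol \<eta> :: real
  assumes sym: "transpose A = A" and B: "spectral_norm A \<le> B" and tol: "0 < tol" and b: "norm b = 1"
    and e: "A *v e = lambda_min A *\<^sub>R e" "norm e = 1" and \<eta>: "0 < \<eta>" "\<eta> \<le> (b \<bullet> e)\<^sup>2"
  defines "\<kappa> \<equiv> max 1 (4 * B / tol)"
  assumes k: "\<kappa> * (\<kappa> + 1) \<le> \<eta> * exp (real k / sqrt \<kappa>)"
  shows "\<exists>v\<in>lanczos_space A b (Suc k). norm v = 1 \<and> v \<bullet> (A *v v) \<le> lambda_min A + tol"
proof -
  define lm where "lm = lambda_min A"
  \<comment> \<open>Half of the tolerance goes to eigenvalues within \<open>m\<close> of the least
    one, the other half to what contraction leaves of the larger ones.\<close>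
  define m where "m = tol / 2"
  \<comment> \<open>Eigenvalues of \<open>A - lm\<close> are at most \<open>2 * B\<close>; the
    maximum ensures \<open>m \<le> L\<close> and makes \<open>L / m\<close> equal to
    \<kappa>.\<close>
  define L where "L = max m (2 * B)"
  have B0: "B \<ge> 0" using B spectral_norm_nonneg[of A] by linarith
  have m: "m > 0" "m \<le> L" using tol by (auto simp: m_def L_def)
  have kap: "\<kappa> = L / m" using tol by (auto simp: \<kappa>_def L_def m_def max_def field_simps)
  have k1: "\<kappa> \<ge> 1" by (simp add: \<kappa>_def)
  define C where "C z = A *v z - lm *\<^sub>R z" for z
  define step where "step = (\<lambda>(y::real^'n, z::real^'n).
      let y' = z - (1/L) *\<^sub>R C z in (y', y' + ((sqrt (L/m) - 1)/(sqrt (L/m) + 1)) *\<^sub>R (y' - y)))"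
  define yz where "yz k = (step ^^ k) (b, b)" for k
  define y z where "y k = fst (yz k)" and "z k = snd (yz k)" for k
  have y0: "y 0 = b" "z 0 = b" by (simp_all add: y_def z_def yz_def)
  have yS: "y (Suc k) = z k - (1/L) *\<^sub>R C (z k)" for k
    by (simp add: y_def z_def yz_def step_def split_beta Let_def)
  have zS: "z (Suc k) = y (Suc k) + ((sqrt (L/m) - 1)/(sqrt (L/m) + 1)) *\<^sub>R (y (Suc k) - y k)" for k
    by (simp add: y_def z_def yz_def step_def split_beta Let_def)
  have yV: "y k \<in> lanczos_space A b (Suc k) \<and> z k \<in> lanczos_space A b (Suc k)" for k
  proof (induction k)
    case 0
    have "lanczos_vector A b 0 = b" using b by (simp add: lanczos_vector_def sgn_div_norm)
    then show ?case using lanczos_vector_in_space[of 0 1 A b] by (simp add: y0)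
  next
    case (Suc k)
    note sub = subspace_lanczos_space[of A b "Suc (Suc k)"]
    have "lanczos_space A b (Suc k) \<subseteq> lanczos_space A b (Suc (Suc k))" by (rule lanczos_space_mono) simp
    then have in2: "y k \<in> lanczos_space A b (Suc (Suc k))" "z k \<in> lanczos_space A b (Suc (Suc k))"
      "A *v z k \<in> lanczos_space A b (Suc (Suc k))"
      using Suc lanczos_krylov[of "z k" A b "Suc k"] by auto
    then have "y (Suc k) \<in> lanczos_space A b (Suc (Suc k))"
      unfolding yS C_def using sub by (intro subspace_diff subspace_scale) auto
    then show ?case unfolding zS using in2 sub
      by (intro conjI subspace_diff subspace_scale subspace_add) auto
  qed
  have fixed: "y k \<bullet> e = b \<bullet> e \<and> z k \<bullet> e = b \<bullet> e" for k
  proof (induction k)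
    case (Suc k)
    have "C (z k) \<bullet> e = 0"
      using symmetric_inner[OF sym, of "z k" e] e(1) by (simp add: C_def inner_diff_left lm_def)
    then have "y (Suc k) \<bullet> e = b \<bullet> e" using Suc by (simp add: yS inner_diff_left)
    then show ?case using Suc by (simp add: zS inner_add_left inner_diff_left)
  qed (simp add: y0)
  obtain E ev where E: "finite E" "\<And>e. e \<in> E \<Longrightarrow> norm e = 1" "\<And>e. e \<in> E \<Longrightarrow> A *v e = ev e *\<^sub>R e"
    and expand: "\<And>x y. x \<bullet> y = (\<Sum>e\<in>E. (x \<bullet> e) * (y \<bullet> e))"
    using symmetric_eigenbasis[OF sym] by blast
  define c where "c = (\<kappa> + 1) * exp (- real k / sqrt \<kappa>)"
  have c0: "c \<ge> 0" using k1 by (simp add: c_def)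
  define w where "w = y k"
  have comp: "(ev d - lm) * (w \<bullet> d)\<^sup>2 \<le> m * (w \<bullet> d)\<^sup>2 + L * c * (b \<bullet> d)\<^sup>2" if d: "d \<in> E" for d
  proof (cases "ev d - lm \<le> m")
    case True
    then have "(ev d - lm) * (w \<bullet> d)\<^sup>2 \<le> m * (w \<bullet> d)\<^sup>2" by (intro mult_right_mono) auto
    moreover have "0 \<le> L * c * (b \<bullet> d)\<^sup>2" using c0 m by (intro mult_nonneg_nonneg) auto
    ultimately show ?thesis by linarith
  next
    case False
    define r where "r = ev d - lm"
    have quad: "\<bar>x \<bullet> (A *v x)\<bar> \<le> B" if "norm x = 1" for x
      using spectral_norm_quadratic[of x A] that B by (simp add: dot_square_norm)
    have "\<bar>ev d\<bar> \<le> B" using quad[OF E(2)[OF d]] E(2,3)[OF d] by (simp add: dot_square_norm)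
    moreover have "\<bar>lm\<bar> \<le> B" using quad[OF e(2)] e by (simp add: dot_square_norm lm_def)
    ultimately have r: "m \<le> r" "r \<le> L" using False by (auto simp: r_def L_def)
    have Cd: "C u \<bullet> d = r * (u \<bullet> d)" for u
      using symmetric_inner[OF sym, of u d] E(3)[OF d] by (simp add: C_def r_def algebra_simps)
    \<comment> \<open>The component along \<open>d\<close> follows the scalar momentum iteration for
      \<open>r/2 * u^2\<close>, whose minimiser is 0.\<close>
    have "(y k \<bullet> d - 0) \<bullet> (y k \<bullet> d - 0)
        \<le> (L/m + 1) * exp (- real k / sqrt (L/m)) * ((y 0 \<bullet> d - 0) \<bullet> (y 0 \<bullet> d - 0))"
    proof (rule accelerated_gradient_rate(2)[OF m, where h = "\<lambda>u. r/2 * u\<^sup>2" and G = "\<lambda>u. r * u"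
          and z = "\<lambda>k. z k \<bullet> d"])
      fix u w :: real
      have eq: "r/2 * w\<^sup>2 - (r/2 * u\<^sup>2 + (r * u) \<bullet> (w - u)) = r/2 * ((w - u) \<bullet> (w - u))"
        by (simp add: power2_eq_square algebra_simps)
      show "r/2 * u\<^sup>2 + (r * u) \<bullet> (w - u) + m/2 * ((w - u) \<bullet> (w - u)) \<le> r/2 * w\<^sup>2"
        using eq mult_right_mono[of "m/2" "r/2" "(w - u) \<bullet> (w - u)"] r by simp
      show "r/2 * w\<^sup>2 \<le> r/2 * u\<^sup>2 + (r * u) \<bullet> (w - u) + L/2 * ((w - u) \<bullet> (w - u))"
        using eq mult_right_mono[of "r/2" "L/2" "(w - u) \<bullet> (w - u)"] r by simp
    next
      show "y (Suc k) \<bullet> d = z k \<bullet> d - (1/L) *\<^sub>R (r * (z k \<bullet> d))" for k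
        by (simp add: yS inner_diff_left Cd)
      show "z (Suc k) \<bullet> d = y (Suc k) \<bullet> d
          + ((sqrt (L/m) - 1)/(sqrt (L/m) + 1)) *\<^sub>R (y (Suc k) \<bullet> d - y k \<bullet> d)" for k
        by (simp add: zS inner_diff_left inner_add_left)
    qed (simp_all add: y0)
    then have "(w \<bullet> d)\<^sup>2 \<le> c * (b \<bullet> d)\<^sup>2"
      by (simp add: w_def c_def kap y0 power2_eq_square)
    then have "r * (w \<bullet> d)\<^sup>2 \<le> L * (c * (b \<bullet> d)\<^sup>2)" using r m by (intro mult_mono) auto
    moreover have "0 \<le> m * (w \<bullet> d)\<^sup>2" using m by simp
    ultimately show ?thesis by (simp add: r_def mult.assoc)
  qed
  have "w \<bullet> (A *v w) - lm * (w \<bullet> w) = (\<Sum>d\<in>E. (ev d - lm) * (w \<bullet> d)\<^sup>2)"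
  proof -
    have "w \<bullet> (A *v w) = (\<Sum>d\<in>E. ev d * (w \<bullet> d)\<^sup>2)"
      unfolding expand[of w "A *v w"] using E(3)
      by (intro sum.cong) (auto simp: symmetric_inner[OF sym] power2_eq_square)
    moreover have "w \<bullet> w = (\<Sum>d\<in>E. (w \<bullet> d)\<^sup>2)" using expand[of w w] by (simp add: power2_eq_square)
    ultimately show ?thesis by (simp add: sum_distrib_left sum_subtractf[symmetric] left_diff_distrib)
  qed
  also have "\<dots> \<le> (\<Sum>d\<in>E. m * (w \<bullet> d)\<^sup>2 + L * c * (b \<bullet> d)\<^sup>2)" by (intro sum_mono comp)
  also have "\<dots> = m * (w \<bullet> w) + L * c * (b \<bullet> b)"
    unfolding expand[of w w] expand[of b b] by (simp add: sum.distrib sum_distrib_left power2_eq_square)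
  also have "L * c * (b \<bullet> b) \<le> m * \<eta>"
  proof -
    have "\<kappa> * (\<kappa> + 1) * exp (- real k / sqrt \<kappa>) \<le> \<eta>"
      using k by (simp add: exp_minus field_simps)
    then have "m * (\<kappa> * (\<kappa> + 1) * exp (- real k / sqrt \<kappa>)) \<le> m * \<eta>" using m by (intro mult_left_mono) auto
    then show ?thesis using m b by (simp add: c_def kap dot_square_norm mult.assoc)
  qed
  \<comment> \<open>The component along \<open>e\<close> is that of \<open>b\<close>, which keeps
    \<open>w\<close> from becoming too short to be normalised.\<close>
  also have "\<eta> \<le> w \<bullet> w"
  proof -
    have "(w \<bullet> e)\<^sup>2 \<le> (w \<bullet> w) * (e \<bullet> e)" by (rule Cauchy_Schwarz_ineq)
    then show ?thesis using \<eta>(2) fixed[of k] e(2) by (simp add: w_def dot_square_norm)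
  qed
  finally have main: "w \<bullet> (A *v w) \<le> (lm + tol) * (w \<bullet> w)"
    using m by (simp add: m_def algebra_simps)
  have ww: "w \<bullet> w > 0" using \<open>\<eta> \<le> w \<bullet> w\<close> \<eta>(1) by linarith
  then have w0: "w \<noteq> 0" by auto
  define v where "v = w /\<^sub>R norm w"
  have "v \<bullet> (A *v v) = (w \<bullet> (A *v w)) / (w \<bullet> w)"
    by (simp add: v_def matrix_vector_mult_scaleR dot_square_norm power2_eq_square field_simps)
  also have "\<dots> \<le> lm + tol" using main ww by (simp add: pos_divide_le_eq)
  finally have "v \<bullet> (A *v v) \<le> lm + tol" .
  moreover have "norm v = 1" using w0 by (simp add: v_def)
  moreover have "v \<in> lanczos_space A b (Suc k)"
    unfolding v_def w_def using yV[of k] by (intro subspace_scale[OF subspace_lanczos_space]) auto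
  ultimately show ?thesis unfolding lm_def by blast
qed

text \<open>A slab through the centre of a slightly smaller ball has many disjoint translates inside the unit ball.\<close>

lemma slab_measure:
  fixes e :: "real^'n" and t :: real
  assumes e: "norm e = 1" and t: "0 < t"
  shows "measure lebesgue {x \<in> ball 0 1. \<bar>x \<bullet> e\<bar> < t}
           \<le> 4 * t * sqrt (6 * real CARD('n)) * measure lebesgue (ball 0 (1::real) :: (real^'n) set)"
proof -
  define n where "n = real CARD('n)"
  have n: "n \<ge> 1" using zero_less_card_finite[where 'a='n] by (simp add: n_def del: zero_less_card_finite)
  \<comment> \<open>Translates reach at most \<open>s\<close> along \<open>e\<close>. Shrinking by
    \<open>r\<close> keeps at least half of the volume by Bernoulli's inequality, and
    \<open>r + 3 * s^2 = 1\<close> leaves just enough room for the shifted points.\<close>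
  define s where "s = 1 / sqrt (6 * n)"
  have s: "s > 0" "s\<^sup>2 = 1 / (6 * n)" using n by (auto simp: s_def power_divide)
  define r where "r = 1 - 1 / (2 * n)"
  have r: "0 < r" "r \<le> 1" "1/2 \<le> r ^ CARD('n)"
  proof -
    have *: "1 / (2 * n) \<le> 1/2" using n by simp
    then show "0 < r" "r \<le> 1" using n by (auto simp: r_def)
    have "1 + real CARD('n) * (- (1 / (2 * n))) \<le> (1 + - (1 / (2 * n))) ^ CARD('n)"
      by (rule Bernoulli_inequality) (use * in linarith)
    then show "1/2 \<le> r ^ CARD('n)" using n by (simp add: r_def n_def[symmetric])
  qed
  define S where "S = {x \<in> ball (0::real^'n) 1. \<bar>x \<bullet> e\<bar> < t}"
  define T where "T i = (\<lambda>x. r *\<^sub>R x + (2 * t * real i) *\<^sub>R e) ` S" for i :: nat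
  \<comment> \<open>Translates are spaced \<open>2 * t\<close> apart, hence disjoint; the indices
    from 0 to \<open>M\<close> fit into the length \<open>s\<close>.\<close>
  define M where "M = nat \<lfloor>s / (2 * t)\<rfloor>"
  have M: "2 * t * real i \<le> s" if "i \<le> M" for i
  proof -
    have "real M \<le> s / (2 * t)" unfolding M_def using s t by (intro of_nat_floor) auto
    then have "real i \<le> s / (2 * t)" using that by simp
    then show ?thesis using t by (simp add: field_simps)
  qed
  have opS: "open S"
    unfolding S_def ball_def Collect_conj_eq mem_Collect_eq
    by (intro open_Int open_Collect_less continuous_intros)
  then have opT: "open (T i)" for i
    using open_affinity[OF opS, of r "(2 * t * real i) *\<^sub>R e"] r by (simp add: T_def add.commute)
  have mT: "measure lebesgue (T i) = r ^ CARD('n) * measure lebesgue S" for i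
    unfolding T_def using measure_lebesgue_affine[of r "(2 * t * real i) *\<^sub>R e" S] r by simp
  have inner_T: "\<bar>x \<bullet> e - 2 * t * real i\<bar> < t" if xT: "x \<in> T i" for x i
  proof -
    obtain u where u: "u \<in> S" "x = r *\<^sub>R u + (2 * t * real i) *\<^sub>R e"
      using xT unfolding T_def by blast
    have "r * \<bar>u \<bullet> e\<bar> \<le> 1 * \<bar>u \<bullet> e\<bar>" using r by (intro mult_right_mono) auto
    then show ?thesis using u r e by (simp add: S_def inner_add_left dot_square_norm abs_mult)
  qed
  have disj: "disjoint_family_on T {..M}"
    unfolding disjoint_family_on_def
  proof (intro ballI impI)
    fix i j :: nat assume "i \<noteq> j"
    then have "1 \<le> \<bar>real i - real j\<bar>" by linarith
    then have "2 * t \<le> 2 * t * \<bar>real i - real j\<bar>" using t by simp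
    then have far: "2 * t \<le> \<bar>2 * t * real i - 2 * t * real j\<bar>"
      using t by (simp add: abs_mult right_diff_distrib[symmetric])
    show "T i \<inter> T j = {}"
    proof (rule ccontr)
      assume "T i \<inter> T j \<noteq> {}"
      then obtain x where "x \<in> T i" "x \<in> T j" by blast
      then show False using inner_T[of x i] inner_T[of x j] far by linarith
    qed
  qed
  have sub: "T i \<subseteq> ball 0 1" if i: "i \<le> M" for i
  proof
    fix x assume "x \<in> T i"
    then obtain u where "u \<in> S" and ux: "x = r *\<^sub>R u + (2 * t * real i) *\<^sub>R e"
      unfolding T_def by blast
    then have u: "norm u < 1" "\<bar>u \<bullet> e\<bar> < t" by (auto simp: S_def)
    define a where "a = 2 * t * real i"
    have a: "0 \<le> a" "a \<le> s" using M[OF i] t by (auto simp: a_def)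
    have "(norm x)\<^sup>2 = r\<^sup>2 * (norm u)\<^sup>2 + 2 * r * (a * (u \<bullet> e)) + a\<^sup>2"
    proof -
      have "e \<bullet> e = 1" using e by (simp add: dot_square_norm)
      then show ?thesis unfolding ux a_def[symmetric] power2_norm_eq_inner
        by (simp add: inner_add_left inner_add_right inner_commute[of e u] power2_eq_square algebra_simps)
    qed
    moreover have "r\<^sup>2 * (norm u)\<^sup>2 < r"
    proof -
      have "(norm u)\<^sup>2 < 1" using u(1) by (simp add: power_less_one_iff)
      then have "r\<^sup>2 * (norm u)\<^sup>2 < r\<^sup>2 * 1" using r by (intro mult_strict_left_mono) auto
      also have "r\<^sup>2 * 1 \<le> r" using r by (simp add: power2_eq_square mult_le_one)
      finally show ?thesis .
    qed
    \<comment> \<open>The unshifted copy has no cross term, and a proper translate exists only if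
      \<open>2 * t \<le> s\<close>.\<close>
    moreover have "2 * r * (a * (u \<bullet> e)) \<le> 2 * s\<^sup>2"
    proof (cases "i = 0")
      case False
      have "1 \<le> real i" using False by simp
      then have "2 * t \<le> a" unfolding a_def using t by simp
      then have ts: "t \<le> s" using a t by linarith
      have "a * (u \<bullet> e) \<le> a * s" using a u(2) ts by (intro mult_left_mono) auto
      also have "\<dots> \<le> s * s" using a s by (intro mult_right_mono) auto
      finally have "r * (a * (u \<bullet> e)) \<le> r * (s * s)" using r by (intro mult_left_mono) auto
      also have "\<dots> \<le> 1 * (s * s)" using r by (intro mult_right_mono) auto
      finally show ?thesis by (simp add: power2_eq_square mult.assoc)
    qed (simp add: a_def)
    moreover have "a\<^sup>2 \<le> s\<^sup>2" using a by (intro power_mono) auto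
    moreover have "r + 3 * s\<^sup>2 = 1" using n by (simp add: s r_def field_simps)
    ultimately have "(norm x)\<^sup>2 < 1" by linarith
    then show "x \<in> ball 0 1" by (simp add: power_less_one_iff)
  qed
  have "(real M + 1) * (r ^ CARD('n) * measure lebesgue S) = (\<Sum>i\<in>{..M}. measure lebesgue (T i))"
    by (simp add: mT)
  also have "\<dots> = measure lebesgue (\<Union>i\<in>{..M}. T i)"
  proof (rule measure_finite_Union[symmetric])
    show "emeasure lebesgue (T i) \<noteq> \<infinity>" if "i \<in> {..M}" for i
    proof -
      have "T i \<in> lmeasurable"
        using that by (intro lmeasurable_open bounded_subset[OF bounded_ball sub] opT) auto
      then show ?thesis unfolding infinity_ennreal_def by (rule fmeasurableD2)
    qed
  qed (use opT disj in auto)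
  also have "\<dots> \<le> measure lebesgue (ball 0 1 :: (real^'n) set)"
    using sub opT by (intro measure_mono_fmeasurable) (auto intro!: lmeasurable_open)
  finally have "(real M + 1) * (r ^ CARD('n) * measure lebesgue S) \<le> measure lebesgue (ball 0 1 :: (real^'n) set)" .
  moreover have "s / (2 * t) * (1/2 * measure lebesgue S) \<le> (real M + 1) * (r ^ CARD('n) * measure lebesgue S)"
  proof (intro mult_mono mult_right_mono)
    show "s / (2 * t) \<le> real M + 1" unfolding M_def by linarith
  qed (use r s t in auto)
  ultimately have "s / (2 * t) * (1/2 * measure lebesgue S) \<le> measure lebesgue (ball 0 1 :: (real^'n) set)"
    by linarith
  then have "(4 * t / s) * (s / (2 * t) * (1/2 * measure lebesgue S))
      \<le> (4 * t / s) * measure lebesgue (ball 0 1 :: (real^'n) set)"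
    using s t by (intro mult_left_mono) auto
  then have "measure lebesgue S \<le> 4 * t * sqrt (6 * n) * measure lebesgue (ball 0 1 :: (real^'n) set)"
    using s t by (simp add: s_def mult_ac)
  then show ?thesis unfolding S_def n_def .
qed

section \<open>The uniform distribution on the sphere\<close>

lemma emeasure_unit_ball:
  "emeasure lborel (ball 0 1 :: (real^'n) set) \<noteq> \<infinity>" "emeasure lborel (ball 0 1 :: (real^'n) set) \<noteq> 0"
proof -
  show "emeasure lborel (ball 0 1 :: (real^'n) set) \<noteq> \<infinity>"
    using emeasure_bounded_finite[OF bounded_ball, of "0::real^'n" 1] by auto
  have "measure lborel (ball 0 1 :: (real^'n) set) > 0" by (rule content_ball_pos) simp
  then show "emeasure lborel (ball 0 1 :: (real^'n) set) \<noteq> 0" by (auto simp: measure_def)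
qed

text \<open>Normalising a nonzero point of the unit ball can only enlarge its component along
  \<open>e\<close>, so bad directions come from the slab of half-width
  \<open>t = \<delta> / (4 * sqrt (6 * n))\<close>, and
  \<open>t^2 = \<delta>^2 / (96 * n)\<close>.\<close>

lemma uniform_sphere_component:
  fixes e :: "real^'n" and \<delta> :: real
  assumes e: "norm e = 1" and \<delta>: "0 < \<delta>"
  shows "1 - \<delta> \<le> measure uniform_sphere {b. norm b = 1 \<and> \<delta>\<^sup>2 / (96 * real CARD('n)) \<le> (b \<bullet> e)\<^sup>2}"
proof -
  define n where "n = real CARD('n)"
  have n: "n \<ge> 1" using zero_less_card_finite[where 'a='n] by (simp add: n_def del: zero_less_card_finite)
  define t where "t = \<delta> / (4 * sqrt (6 * n))"
  have t: "t > 0" "4 * t * sqrt (6 * n) = \<delta>" using \<delta> n by (auto simp: t_def)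
  have t2: "t\<^sup>2 = \<delta>\<^sup>2 / (96 * n)" using n by (simp add: t_def power_divide power_mult_distrib)
  define Bl where "Bl = (ball 0 1 :: (real^'n) set)"
  define G where "G = {b::real^'n. norm b = 1 \<and> t\<^sup>2 \<le> (b \<bullet> e)\<^sup>2}"
  have G: "G \<in> sets borel" unfolding G_def by measurable
  define S where "S = {x \<in> Bl. \<bar>x \<bullet> e\<bar> < t}"
  have S: "S \<in> sets borel" unfolding S_def Bl_def by measurable
  have Bl: "Bl \<in> sets borel" by (simp add: Bl_def)
  have fin: "emeasure lborel Bl \<noteq> \<infinity>" "emeasure lborel Bl \<noteq> 0"
    unfolding Bl_def by (rule emeasure_unit_ball)+
  have mB: "measure lborel Bl > 0" unfolding Bl_def by (rule content_ball_pos) simp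
  have sgn: "sgn \<in> borel_measurable (borel :: (real^'n) measure)"
    unfolding sgn_div_norm[abs_def] by measurable
  have sgnU: "sgn \<in> measurable (uniform_measure lborel Bl) (borel :: (real^'n) measure)"
    using sgn by (simp add: measurable_def)
  have "measure uniform_sphere G = measure (uniform_measure lborel Bl) (sgn -` G \<inter> space (uniform_measure lborel Bl))"
    unfolding uniform_sphere_def Bl_def[symmetric] by (rule measure_distr[OF sgnU G])
  also have "\<dots> = measure lborel (Bl \<inter> (sgn -` G)) / measure lborel Bl"
    using measurable_sets[OF sgn G] Bl fin by (subst measure_uniform_measure) auto
  also have "\<dots> \<ge> measure lborel (Bl - S) / measure lborel Bl"
  proof (intro divide_right_mono measure_mono_fmeasurable)
    show "Bl - S \<subseteq> Bl \<inter> sgn -` G"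
    proof
      fix x assume x: "x \<in> Bl - S"
      then have nx: "norm x < 1" and xe: "t \<le> \<bar>x \<bullet> e\<bar>" by (auto simp: Bl_def S_def)
      then have x0: "x \<noteq> 0" using t by auto
      have "\<bar>sgn x \<bullet> e\<bar> = \<bar>x \<bullet> e\<bar> / norm x" by (simp add: sgn_div_norm abs_mult divide_inverse mult.commute)
      moreover have "\<bar>x \<bullet> e\<bar> \<le> \<bar>x \<bullet> e\<bar> / norm x" using nx x0 mult_left_le[of "norm x" "\<bar>x \<bullet> e\<bar>"]
        by (simp add: pos_le_divide_eq)
      ultimately have "t \<le> \<bar>sgn x \<bullet> e\<bar>" using xe by linarith
      then have "t\<^sup>2 \<le> \<bar>sgn x \<bullet> e\<bar>\<^sup>2" using t by (intro power_mono) auto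
      then show "x \<in> Bl \<inter> sgn -` G" using x x0 by (simp add: G_def norm_sgn)
    qed
    show "Bl \<inter> sgn -` G \<in> fmeasurable lborel"
    proof (rule fmeasurableI2)
      show "Bl \<in> fmeasurable lborel" unfolding Bl_def by (rule fmeasurableI) (use emeasure_unit_ball in \<open>simp_all add: less_top\<close>)
      show "Bl \<inter> sgn -` G \<in> sets lborel" using measurable_sets[OF sgn G] Bl by auto
    qed simp
  qed (use Bl S mB in auto)
  also have "measure lborel (Bl - S) = measure lborel Bl - measure lborel S"
    using Bl S fin by (intro measure_Diff) (auto simp: S_def)
  finally have "(measure lborel Bl - measure lborel S) / measure lborel Bl \<le> measure uniform_sphere G" .
  moreover have "measure lborel S \<le> \<delta> * measure lborel Bl"
    using slab_measure[OF e t(1)] S Bl t(2)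
    by (simp add: S_def[symmetric] Bl_def[symmetric] n_def[symmetric] measure_completion)
  then have "(1 - \<delta>) * measure lborel Bl \<le> measure lborel Bl - measure lborel S" by (simp add: algebra_simps)
  then have "1 - \<delta> \<le> (measure lborel Bl - measure lborel S) / measure lborel Bl"
    using mB by (simp add: pos_le_divide_eq)
  ultimately show ?thesis using t2 by (simp add: G_def n_def)
qed

lemma prob_space_uniform_sphere: "prob_space (uniform_sphere :: (real^'n) measure)"
proof -
  have "sgn \<in> borel_measurable (borel :: (real^'n) measure)"
    unfolding sgn_div_norm[abs_def] by measurable
  then show ?thesis unfolding uniform_sphere_def
    using prob_space_uniform_measure[OF emeasure_unit_ball(2,1)]
    by (intro prob_space.prob_space_distr) (auto simp: measurable_def)
qed

lemma sets_uniform_sphere [simp]: "sets (uniform_sphere :: (real^'n) measure) = sets borel"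
  by (simp add: uniform_sphere_def)

lemma space_uniform_sphere [simp]: "space (uniform_sphere :: (real^'n) measure) = UNIV"
  by (simp add: uniform_sphere_def)

section \<open>Measurability of Lanczos success\<close>

definition rayleigh_min :: "real^'n^'n \<Rightarrow> real" where
  "rayleigh_min A = (INF x\<in>sphere 0 1. x \<bullet> (A *v x))"

lemma rayleigh_min_bdd:
  fixes A :: "real^'n^'n"
  shows "bdd_below ((\<lambda>x. x \<bullet> (A *v x)) ` sphere 0 1)"
proof (rule bdd_belowI2)
  fix x :: "real^'n" assume "x \<in> sphere 0 1"
  then show "- spectral_norm A \<le> x \<bullet> (A *v x)"
    using spectral_norm_quadratic[of x A] by (simp add: dot_square_norm abs_le_iff)
qed

lemma sphere_nonempty: "sphere (0::real^'n) 1 \<noteq> {}"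
  using vector_choose_size[of 1] by (auto simp: sphere_def)

lemma rayleigh_min_symmetric:
  assumes "transpose A = A" shows "rayleigh_min A = lambda_min A"
proof -
  obtain e where e: "norm e = 1" "A *v e = lambda_min A *\<^sub>R e"
    and le: "\<And>x. lambda_min A * (x \<bullet> x) \<le> x \<bullet> (A *v x)"
    using lambda_min_symmetric[OF assms] by blast
  show ?thesis unfolding rayleigh_min_def
  proof (rule cInf_eq_minimum)
    show "lambda_min A \<in> (\<lambda>x. x \<bullet> (A *v x)) ` sphere 0 1"
      using e by (intro image_eqI[of _ _ e]) (auto simp: dot_square_norm)
    show "lambda_min A \<le> y" if "y \<in> (\<lambda>x. x \<bullet> (A *v x)) ` sphere 0 1" for y
    proof -
      from that obtain x where "norm x = 1" "y = x \<bullet> (A *v x)" by auto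
      then show ?thesis using le[of x] by (simp add: dot_square_norm)
    qed
  qed
qed

lemma continuous_on_matrix_vector [continuous_intros]:
  fixes A :: "'a::topological_space \<Rightarrow> real^'n^'m"
  assumes "continuous_on S A" "continuous_on S g"
  shows "continuous_on S (\<lambda>x. A x *v g x)"
  unfolding matrix_vector_mult_def by (intro continuous_intros assms)

lemma borel_measurable_matrix_vector [measurable (raw)]:
  fixes A :: "'a \<Rightarrow> real^'n^'m"
  assumes "A \<in> borel_measurable M" "g \<in> borel_measurable M"
  shows "(\<lambda>x. A x *v g x) \<in> borel_measurable M"
  using assms(1,2)
  by (rule borel_measurable_continuous_Pair) (intro continuous_intros continuous_on_fst continuous_on_snd continuous_on_id)

lemma borel_measurable_sgn_vec [measurable (raw)]:
  fixes g :: "'a \<Rightarrow> real^'n"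
  assumes [measurable]: "g \<in> borel_measurable M"
  shows "(\<lambda>x. sgn (g x)) \<in> borel_measurable M"
  unfolding sgn_div_norm by measurable

text \<open>This is the reason for replacing \<open>lambda_min\<close>: an infimum of continuous
  functions has closed superlevel sets on the space of all matrices, and on symmetric ones it is the
  least eigenvalue.\<close>

lemma borel_measurable_rayleigh_min [measurable]: "(rayleigh_min :: real^'n^'n \<Rightarrow> real) \<in> borel_measurable borel"
  unfolding borel_measurable_iff_ge
proof
  fix a :: real
  have "{A. a \<le> rayleigh_min A} = (\<Inter>x\<in>sphere 0 1. {A :: real^'n^'n. a \<le> x \<bullet> (A *v x)})"
    unfolding rayleigh_min_def using le_cINF_iff[OF sphere_nonempty rayleigh_min_bdd] by auto
  moreover have "closed \<dots>"
    by (intro closed_INT ballI closed_Collect_le continuous_intros)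
  ultimately show "{w \<in> space borel. a \<le> rayleigh_min w} \<in> sets (borel :: (real^'n^'n) measure)"
    using borel_closed by auto
qed

text \<open>Coefficients are indexed by position rather than by vector, as the Lanczos vectors
  repeat the value 0 after a breakdown.\<close>

lemma span_image_lessThan:
  "v \<in> span (q ` {..<j}) \<longleftrightarrow> (\<exists>c. v = (\<Sum>i<j. c i *\<^sub>R q i))" for j :: nat
proof
  assume "v \<in> span (q ` {..<j})"
  then show "\<exists>c. v = (\<Sum>i<j. c i *\<^sub>R q i)"
  proof (induction j arbitrary: v)
    case (Suc j)
    then obtain a where "v - a *\<^sub>R q j \<in> span (q ` {..<j})"
      by (auto simp: lessThan_Suc span_breakdown_eq)
    then obtain c where c: "v - a *\<^sub>R q j = (\<Sum>i<j. c i *\<^sub>R q i)" using Suc.IH by blast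
    have "v = (\<Sum>i<Suc j. (c(j := a)) i *\<^sub>R q i)" using c by (simp add: algebra_simps)
    then show ?case by blast
  qed simp
next
  assume "\<exists>c. v = (\<Sum>i<j. c i *\<^sub>R q i)"
  then obtain c where v: "v = (\<Sum>i<j. c i *\<^sub>R q i)" by blast
  show "v \<in> span (q ` {..<j})" unfolding v
    by (rule span_sum, rule span_scale, rule span_base) auto
qed

text \<open>Countable reformulation, needed for measurability: in the closed space \<open>lanczos_space A b j\<close> a unit
  vector with small Rayleigh quotient exists iff rational combinations come arbitrarily close to one.\<close>

lemma lanczos_good_rational:
  "(\<exists>v\<in>lanczos_space A b j. norm v = 1 \<and> v \<bullet> (A *v v) \<le> t) \<longleftrightarrow>
   (\<forall>n::nat. \<exists>c::rat list. let v = (\<Sum>i<j. real_of_rat (c ! i) *\<^sub>R lanczos_vector A b i) in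
      \<bar>norm v - 1\<bar> < 1 / real (Suc n) \<and> v \<bullet> (A *v v) < t + 1 / real (Suc n))"
    (is "?L \<longleftrightarrow> (\<forall>n. \<exists>c. ?P n c)")
proof
  assume ?L
  then obtain v where v: "v \<in> lanczos_space A b j" "norm v = 1" "v \<bullet> (A *v v) \<le> t" by blast
  then obtain c where c: "v = (\<Sum>i<j. c i *\<^sub>R lanczos_vector A b i)"
    unfolding lanczos_space_def span_image_lessThan by blast
  have "\<exists>r::nat \<Rightarrow> rat. (\<lambda>m. real_of_rat (r m)) \<longlonglongrightarrow> x" for x :: real
  proof -
    have "\<exists>r. \<bar>real_of_rat r - x\<bar> < 1 / real (Suc m)" for m
    proof -
      have "x - 1 / real (Suc m) < x + 1 / real (Suc m)"
        using zero_less_divide_1_iff[of "real (Suc m)"] by linarith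
      then obtain q where "x - 1 / real (Suc m) < real_of_rat q" "real_of_rat q < x + 1 / real (Suc m)"
        using of_rat_dense by blast
      then show ?thesis by (intro exI[of _ q]) linarith
    qed
    then have "\<forall>m. \<exists>r. \<bar>real_of_rat r - x\<bar> < 1 / real (Suc m)" by blast
    from choice[OF this] obtain r where "\<And>m. \<bar>real_of_rat (r m) - x\<bar> < 1 / real (Suc m)" by blast
    then have "(\<lambda>m. real_of_rat (r m) - x) \<longlonglongrightarrow> 0"
      by (intro Lim_null_comparison[OF _ LIMSEQ_inverse_real_of_nat])
        (auto simp: inverse_eq_divide intro!: always_eventually less_imp_le)
    then show ?thesis using LIM_zero_iff by blast
  qed
  then have "\<forall>i. \<exists>r::nat \<Rightarrow> rat. (\<lambda>m. real_of_rat (r m)) \<longlonglongrightarrow> c i" by blast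
  from choice[OF this] obtain r where r: "\<And>i. (\<lambda>m. real_of_rat (r i m)) \<longlonglongrightarrow> c i" by blast
  define w where "w m = (\<Sum>i<j. real_of_rat (r i m) *\<^sub>R lanczos_vector A b i)" for m
  have w: "w \<longlonglongrightarrow> v" unfolding w_def c by (intro tendsto_intros r)
  have "(\<lambda>m. \<bar>norm (w m) - 1\<bar>) \<longlonglongrightarrow> \<bar>norm v - 1\<bar>" by (intro tendsto_intros w)
  then have lim1: "(\<lambda>m. \<bar>norm (w m) - 1\<bar>) \<longlonglongrightarrow> 0" using v by simp
  have "(\<lambda>m. A *v w m) \<longlonglongrightarrow> A *v v"
    by (rule isCont_tendsto_compose[OF _ w]) (rule matrix_vector_mult_linear_continuous_at)
  then have lim2: "(\<lambda>m. w m \<bullet> (A *v w m)) \<longlonglongrightarrow> v \<bullet> (A *v v)" by (intro tendsto_intros w)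
  show "\<forall>n. \<exists>c. ?P n c"
  proof
    fix n :: nat
    have "\<forall>\<^sub>F m in sequentially. \<bar>norm (w m) - 1\<bar> < 1 / real (Suc n)"
      by (rule order_tendstoD(2)[OF lim1]) simp
    moreover have "\<forall>\<^sub>F m in sequentially. w m \<bullet> (A *v w m) < t + 1 / real (Suc n)"
      by (rule order_tendstoD(2)[OF lim2]) (rule le_less_trans[OF v(3)], simp)
    ultimately have "\<forall>\<^sub>F m in sequentially. \<bar>norm (w m) - 1\<bar> < 1 / real (Suc n)
        \<and> w m \<bullet> (A *v w m) < t + 1 / real (Suc n)" by (rule eventually_conj)
    then obtain m where m: "\<bar>norm (w m) - 1\<bar> < 1 / real (Suc n)" "w m \<bullet> (A *v w m) < t + 1 / real (Suc n)"
      using eventually_happens'[OF sequentially_bot] by blast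
    \<comment> \<open>The coefficients are packed into a list because lists of rationals form a
      countable type.\<close>
    have "(\<Sum>i<j. real_of_rat (map (\<lambda>i. r i m) [0..<j] ! i) *\<^sub>R lanczos_vector A b i) = w m"
      unfolding w_def by (intro sum.cong) auto
    then show "\<exists>c. ?P n c" using m by (intro exI[of _ "map (\<lambda>i. r i m) [0..<j]"]) (simp add: Let_def)
  qed
next
  assume "\<forall>n. \<exists>c. ?P n c"
  from choice[OF this] obtain c where c: "\<And>n. ?P n (c n)" by blast
  define w where "w n = (\<Sum>i<j. real_of_rat (c n ! i) *\<^sub>R lanczos_vector A b i)" for n
  have w1: "\<bar>norm (w n) - 1\<bar> < 1 / real (Suc n)" and w2: "w n \<bullet> (A *v w n) < t + 1 / real (Suc n)" for n
    using c[of n] by (simp_all add: w_def Let_def)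
  have wV: "w n \<in> lanczos_space A b j" for n
    unfolding lanczos_space_def span_image_lessThan w_def
    by (rule exI[of _ "\<lambda>i. real_of_rat (c n ! i)"]) (rule refl)
  \<comment> \<open>Bounded points of a closed subspace have a convergent subsequence; its limit is
    an exact unit vector with the required quotient.\<close>
  have "norm (w n) \<le> 2" for n
  proof -
    have "1 / real (Suc n) \<le> 1" by simp
    then show ?thesis using w1[of n] by linarith
  qed
  then have "w n \<in> lanczos_space A b j \<inter> cball 0 2" for n using wV by simp
  moreover have "compact (lanczos_space A b j \<inter> cball 0 2)"
    by (intro closed_Int_compact closed_subspace subspace_lanczos_space) auto
  ultimately obtain v \<sigma> where v: "v \<in> lanczos_space A b j" and \<sigma>: "strict_mono \<sigma>"
    and lim: "(w \<circ> \<sigma>) \<longlonglongrightarrow> v"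
    unfolding compact_def by blast
  have null: "(\<lambda>n. 1 / real (Suc (\<sigma> n))) \<longlonglongrightarrow> 0"
    using LIMSEQ_subseq_LIMSEQ[OF LIMSEQ_inverse_real_of_nat \<sigma>] by (simp add: o_def inverse_eq_divide)
  have "(\<lambda>n. \<bar>norm ((w \<circ> \<sigma>) n) - 1\<bar>) \<longlonglongrightarrow> \<bar>norm v - 1\<bar>" by (intro tendsto_intros lim)
  from LIMSEQ_le[OF this null] w1 have "\<bar>norm v - 1\<bar> \<le> 0" by (force intro: less_imp_le)
  moreover have "(\<lambda>n. A *v (w \<circ> \<sigma>) n) \<longlonglongrightarrow> A *v v"
    by (rule isCont_tendsto_compose[OF _ lim]) (rule matrix_vector_mult_linear_continuous_at)
  then have "(\<lambda>n. (w \<circ> \<sigma>) n \<bullet> (A *v (w \<circ> \<sigma>) n)) \<longlonglongrightarrow> v \<bullet> (A *v v)" by (intro tendsto_intros lim)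
  from LIMSEQ_le[OF this tendsto_add[OF tendsto_const null]] w2 have "v \<bullet> (A *v v) \<le> t + 0"
    by (force intro: less_imp_le)
  ultimately show ?L using v by auto
qed

text \<open>The Rayleigh quotient attains its minimum on the compact unit sphere of the space, so a
  least Ritz pair exists as soon as that sphere is nonempty.\<close>

lemma lanczos_output_le_iff:
  "(\<exists>lam u. lanczos_output A b j lam u \<and> lam \<le> t) \<longleftrightarrow>
   (\<exists>v\<in>lanczos_space A b j. norm v = 1 \<and> v \<bullet> (A *v v) \<le> t)"
proof
  assume "\<exists>v\<in>lanczos_space A b j. norm v = 1 \<and> v \<bullet> (A *v v) \<le> t"
  then obtain v where v: "v \<in> lanczos_space A b j \<inter> sphere 0 1" "v \<bullet> (A *v v) \<le> t" by auto
  have "compact (lanczos_space A b j \<inter> sphere 0 1)"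
    by (intro closed_Int_compact closed_subspace subspace_lanczos_space) auto
  moreover have "continuous_on (lanczos_space A b j \<inter> sphere 0 1) (\<lambda>x. x \<bullet> (A *v x))"
    by (intro continuous_intros)
  ultimately obtain u where u: "u \<in> lanczos_space A b j \<inter> sphere 0 1"
    and min: "\<forall>y\<in>lanczos_space A b j \<inter> sphere 0 1. u \<bullet> (A *v u) \<le> y \<bullet> (A *v y)"
    using continuous_attains_inf[of "lanczos_space A b j \<inter> sphere 0 1" "\<lambda>x. x \<bullet> (A *v x)"] v(1) by blast
  have "lanczos_output A b j (u \<bullet> (A *v u)) u"
    using u min by (auto simp: lanczos_output_def Let_def lanczos_space_def)
  moreover have "u \<bullet> (A *v u) \<le> t" using min v by (meson order_trans)
  ultimately show "\<exists>lam u. lanczos_output A b j lam u \<and> lam \<le> t" by blast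
qed (auto simp: lanczos_output_def Let_def lanczos_space_def)

text \<open>The least Ritz value is unique. The probability estimate speaks of some output with a
  small value; this carries the bound over to the output occurring in the run.\<close>

lemma lanczos_output_le:
  assumes "lanczos_output A b j lam u" and "\<exists>lam' u'. lanczos_output A b j lam' u' \<and> lam' \<le> t"
  shows "lam \<le> t"
  using assms by (force simp: lanczos_output_def Let_def)

lemma measurable_lanczos_state:
  assumes [measurable]: "A \<in> borel_measurable M" "b \<in> borel_measurable M"
  shows "(\<lambda>x. fst (lanczos_state (A x) (b x) k)) \<in> borel_measurable M
    \<and> (\<lambda>x. fst (snd (lanczos_state (A x) (b x) k))) \<in> borel_measurable M
    \<and> (\<lambda>x. snd (snd (lanczos_state (A x) (b x) k))) \<in> borel_measurable M"
proof (induction k)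
  case (Suc k)
  then have [measurable]: "(\<lambda>x. fst (lanczos_state (A x) (b x) k)) \<in> borel_measurable M"
    "(\<lambda>x. fst (snd (lanczos_state (A x) (b x) k))) \<in> borel_measurable M"
    "(\<lambda>x. snd (snd (lanczos_state (A x) (b x) k))) \<in> borel_measurable M" by auto
  show ?case unfolding lanczos_state.simps split_beta Let_def fst_conv snd_conv by measurable
qed simp

lemma measurable_lanczos_vector [measurable (raw)]:
  assumes "A \<in> borel_measurable M" "b \<in> borel_measurable M"
  shows "(\<lambda>x. lanczos_vector (A x) (b x) k) \<in> borel_measurable M"
  using measurable_lanczos_state[OF assms] by (simp add: lanczos_vector_def)

lemma measurable_lanczos_good [measurable (raw)]:
  assumes [measurable]: "A \<in> borel_measurable M" "b \<in> borel_measurable M" "t \<in> borel_measurable M"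
  shows "Measurable.pred M (\<lambda>x. \<exists>lam u. lanczos_output (A x) (b x) j lam u \<and> lam \<le> t x)"
proof -
  define v where "v c x = (\<Sum>i<j. real_of_rat (c ! i) *\<^sub>R lanczos_vector (A x) (b x) i)" for c :: "rat list" and x
  have [measurable]: "v c \<in> borel_measurable M" for c
    unfolding v_def by measurable
  have "Measurable.pred M (\<lambda>x. \<forall>n::nat. \<exists>c. \<bar>norm (v c x) - 1\<bar> < 1 / real (Suc n)
      \<and> v c x \<bullet> (A x *v v c x) < t x + 1 / real (Suc n))"
    by measurable
  then show ?thesis unfolding lanczos_output_le_iff lanczos_good_rational Let_def v_def .
qed

section \<open>Reliability of the prescribed number of steps\<close>

lemma lanczos_success:
  fixes A :: "real^'n^'n" and B tol \<delta> :: real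
  assumes sym: "transpose A = A" and B: "spectral_norm A \<le> B" and tol: "0 < tol" and \<delta>: "0 < \<delta>"
  defines "\<kappa> \<equiv> max 1 (4 * B / tol)"
  assumes k: "\<kappa> * (\<kappa> + 1) * (96 * real CARD('n) / \<delta>\<^sup>2) \<le> exp (real k / sqrt \<kappa>)"
  shows "1 - \<delta> \<le> measure uniform_sphere
    {b. \<exists>lam u. lanczos_output A b (Suc k) lam u \<and> lam \<le> lambda_min A + tol}"
proof -
  interpret U: prob_space "uniform_sphere :: (real^'n) measure" by (rule prob_space_uniform_sphere)
  obtain e where e: "norm e = 1" "A *v e = lambda_min A *\<^sub>R e"
    using lambda_min_symmetric[OF sym] by blast
  define \<eta> where "\<eta> = \<delta>\<^sup>2 / (96 * real CARD('n))"
  have \<eta>: "\<eta> > 0" using \<delta> by (simp add: \<eta>_def)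
  have "\<kappa> * (\<kappa> + 1) * (1 / \<eta>) \<le> exp (real k / sqrt \<kappa>)" using k by (simp add: \<eta>_def)
  then have k': "\<kappa> * (\<kappa> + 1) \<le> \<eta> * exp (real k / sqrt \<kappa>)" using \<eta> by (simp add: field_simps)
  have "{b. \<exists>lam u. lanczos_output A b (Suc k) lam u \<and> lam \<le> lambda_min A + tol} \<in> sets borel"
    by measurable
  moreover have "{b. norm b = 1 \<and> \<eta> \<le> (b \<bullet> e)\<^sup>2}
      \<subseteq> {b. \<exists>lam u. lanczos_output A b (Suc k) lam u \<and> lam \<le> lambda_min A + tol}"
    unfolding lanczos_output_le_iff
    using lanczos_accuracy[OF sym B tol _ e(2,1) \<eta> _ k'[unfolded \<kappa>_def]] by blast
  ultimately have "measure uniform_sphere {b. norm b = 1 \<and> \<eta> \<le> (b \<bullet> e)\<^sup>2}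
      \<le> measure uniform_sphere {b. \<exists>lam u. lanczos_output A b (Suc k) lam u \<and> lam \<le> lambda_min A + tol}"
    by (intro U.finite_measure_mono) auto
  then show ?thesis using uniform_sphere_component[OF e(1) \<delta>] unfolding \<eta>_def by linarith
qed

text \<open>The condition under \<open>LEAST\<close> in \<open>lanczos_steps\<close>, named so that
  its monotonicity in the tolerance can be used.\<close>

definition lanczos_reliable :: "'n::finite itself \<Rightarrow> real \<Rightarrow> real \<Rightarrow> real \<Rightarrow> nat \<Rightarrow> bool" where
  "lanczos_reliable _ B tol \<delta> j \<longleftrightarrow> 1 \<le> j \<and>
     (\<forall>A :: real^'n^'n. transpose A = A \<and> spectral_norm A \<le> B \<longrightarrow>
        1 - \<delta> \<le> measure uniform_sphere
          {b. \<exists>lam u. lanczos_output A b j lam u \<and> lam \<le> lambda_min A + tol})"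

lemma lanczos_steps_eq: "lanczos_steps TYPE('n::finite) B tol \<delta> = (LEAST j. lanczos_reliable TYPE('n) B tol \<delta> j)"
  unfolding lanczos_steps_def lanczos_reliable_def ..

lemma lanczos_reliable_Suc:
  assumes "0 < tol" "0 < \<delta>"
    and "max 1 (4 * B / tol) * (max 1 (4 * B / tol) + 1) * (96 * real CARD('n) / \<delta>\<^sup>2)
           \<le> exp (real k / sqrt (max 1 (4 * B / tol)))"
  shows "lanczos_reliable TYPE('n::finite) B tol \<delta> (Suc k)"
  unfolding lanczos_reliable_def using lanczos_success[OF _ _ assms] by auto

lemma lanczos_steps_le:
  assumes "0 < tol" "0 < \<delta>"
    and "max 1 (4 * B / tol) * (max 1 (4 * B / tol) + 1) * (96 * real CARD('n) / \<delta>\<^sup>2)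
           \<le> exp (real k / sqrt (max 1 (4 * B / tol)))"
  shows "lanczos_steps TYPE('n::finite) B tol \<delta> \<le> Suc k"
  unfolding lanczos_steps_eq 
  using lanczos_reliable_Suc[OF assms] by (rule Least_le)

text \<open>\<open>LEAST\<close> says something only if some step count works. One does, because the
  exponential exceeds its argument and the argument can be made arbitrarily large.\<close>

lemma lanczos_steps_reliable:
  assumes "0 < tol" "0 < \<delta>"
  shows "lanczos_reliable TYPE('n::finite) B tol \<delta> (lanczos_steps TYPE('n) B tol \<delta>)"
proof -
  define \<kappa> where "\<kappa> = max 1 (4 * B / tol)"
  define c where "c = \<kappa> * (\<kappa> + 1) * (96 * real CARD('n) / \<delta>\<^sup>2)"
  have k: "\<kappa> \<ge> 1" by (simp add: \<kappa>_def)
  obtain k where "sqrt \<kappa> * c \<le> real k" using real_arch_simple by blast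
  then have "c \<le> real k / sqrt \<kappa>" using k by (simp add: pos_le_divide_eq mult.commute)
  also have "\<dots> \<le> exp (real k / sqrt \<kappa>)" using exp_ge_add_one_self[of "real k / sqrt \<kappa>"] by linarith
  finally have "lanczos_reliable TYPE('n) B tol \<delta> (Suc k)"
    unfolding c_def \<kappa>_def by (rule lanczos_reliable_Suc[OF assms])
  then show ?thesis unfolding lanczos_steps_eq by (rule LeastI)
qed

lemma lanczos_reliable_mono:
  assumes "lanczos_reliable TYPE('n::finite) B tol \<delta> j" "tol \<le> tol'"
  shows "lanczos_reliable TYPE('n) B tol' \<delta> j"
  unfolding lanczos_reliable_def
proof (intro conjI allI impI)
  interpret U: prob_space "uniform_sphere :: (real^'n) measure" by (rule prob_space_uniform_sphere)
  show "1 \<le> j" using assms(1) by (simp add: lanczos_reliable_def)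
  fix A :: "real^'n^'n" assume A: "transpose A = A \<and> spectral_norm A \<le> B"
  have "1 - \<delta> \<le> measure uniform_sphere {b. \<exists>lam u. lanczos_output A b j lam u \<and> lam \<le> lambda_min A + tol}"
    using assms(1) A by (simp add: lanczos_reliable_def)
  also have "\<dots> \<le> measure uniform_sphere {b. \<exists>lam u. lanczos_output A b j lam u \<and> lam \<le> lambda_min A + tol'}"
  proof (rule U.finite_measure_mono)
    have "{b. \<exists>lam u. lanczos_output A b j lam u \<and> lam \<le> lambda_min A + tol'} \<in> sets borel" by measurable
    then show "{b. \<exists>lam u. lanczos_output A b j lam u \<and> lam \<le> lambda_min A + tol'} \<in> sets uniform_sphere" by simp
  qed (use assms(2) in \<open>auto intro: order_trans\<close>)
  finally show "1 - \<delta> \<le> measure uniform_sphere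
      {b. \<exists>lam u. lanczos_output A b j lam u \<and> lam \<le> lambda_min A + tol'}" .
qed

text \<open>The tolerance depends on the current gradient, so the step count is random. For fixed
  \<open>j\<close> reliability is monotone in the tolerance, hence a Borel predicate.\<close>

lemma measurable_lanczos_steps:
  "(\<lambda>tol. lanczos_steps TYPE('n::finite) B tol \<delta>) \<in> measurable borel (count_space UNIV)"
  unfolding lanczos_steps_eq
proof (rule measurable_Least)
  fix j
  define g where "g tol = (if lanczos_reliable TYPE('n) B tol \<delta> j then 1 else 0 :: real)" for tol
  have "mono g" unfolding g_def using lanczos_reliable_mono by (auto intro!: monoI)
  then have [measurable]: "g \<in> borel_measurable borel" by (rule borel_measurable_mono)
  have "(\<lambda>tol. lanczos_reliable TYPE('n) B tol \<delta> j) = (\<lambda>tol. g tol = 1)" by (auto simp: g_def)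
  then show "Measurable.pred borel (\<lambda>tol. lanczos_reliable TYPE('n) B tol \<delta> j)" by simp
qed

lemma continuous_on_transpose: "continuous_on UNIV (transpose :: real^'n^'m \<Rightarrow> real^'m^'n)"
  unfolding transpose_def by (intro continuous_intros)

lemma sets_spectral_norm: "{A :: real^'n^'m. spectral_norm A \<le> B} \<in> sets borel"
proof (cases "0 \<le> B")
  case True
  have "{A :: real^'n^'m. spectral_norm A \<le> B} = (\<Inter>x. {A. norm (A *v x) \<le> B * norm x})"
  proof (intro equalityI subsetI)
    fix A :: "real^'n^'m" assume "A \<in> {A. spectral_norm A \<le> B}"
    then show "A \<in> (\<Inter>x. {A. norm (A *v x) \<le> B * norm x})"
      using spectral_norm_bound[of A] mult_right_mono[of "spectral_norm A" B "norm _"]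
      by (auto intro: order_trans)
  qed (auto intro: spectral_norm_le)
  moreover have "closed \<dots>" by (intro closed_INT ballI closed_Collect_le continuous_intros)
  ultimately show ?thesis using borel_closed by simp
next
  case False
  then have "{A :: real^'n^'m. spectral_norm A \<le> B} = {}"
    using spectral_norm_nonneg by (auto simp: not_le intro: less_le_trans)
  then show ?thesis by simp
qed

text \<open>Matrix and tolerance are known before \<open>b\<close> is drawn, so their joint law with
  \<open>b\<close> is a product. For each fixed matrix and tolerance the bad starting vectors have
  measure at most \<delta> by the choice of the step count, and integrating over the first factor
  preserves this.\<close>

lemma lanczos_failure_probability:
  fixes B \<delta> :: real and A :: "'w \<Rightarrow> real^'n^'n" and b :: "'w \<Rightarrow> real^'n" and tol :: "'w \<Rightarrow> real"
  assumes M: "prob_space M" and sub: "subalgebra M F"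
    and A: "A \<in> borel_measurable F" and tol: "tol \<in> borel_measurable F"
    and b: "b \<in> borel_measurable M" "distr M borel b = uniform_sphere"
    and ind: "prob_space.indep_set M (sets F) {b -` S \<inter> space M | S. S \<in> sets borel}"
    and sym: "\<And>\<omega>. transpose (A \<omega>) = A \<omega>" and tol0: "\<And>\<omega>. 0 < tol \<omega>" and \<delta>: "0 < \<delta>"
  defines "Bad \<equiv> {\<omega> \<in> space M. spectral_norm (A \<omega>) \<le> B \<and>
      \<not> (\<exists>lam u. lanczos_output (A \<omega>) (b \<omega>) (lanczos_steps TYPE('n) B (tol \<omega>) \<delta>) lam u
              \<and> lam \<le> lambda_min (A \<omega>) + tol \<omega>)}"
  shows "Bad \<in> sets M" and "measure M Bad \<le> \<delta>"
proof -
  interpret M: prob_space M by (rule M)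
  interpret U: prob_space "uniform_sphere :: (real^'n) measure" by (rule prob_space_uniform_sphere)
  note [measurable] = b(1) measurable_lanczos_steps
  have [measurable]: "A \<in> borel_measurable M" "tol \<in> borel_measurable M"
    using measurable_from_subalg[OF sub] A tol by auto
  define X where "X \<omega> = (A \<omega>, tol \<omega>)" for \<omega>
  define S :: "((real^'n^'n) \<times> real) measure" where "S = borel \<Otimes>\<^sub>M borel"
  have XF: "X \<in> measurable F S" unfolding X_def S_def using A tol by measurable
  have X: "X \<in> measurable M S" using measurable_from_subalg[OF sub XF] .
  \<comment> \<open>The step count is pulled out as a constant \<open>j\<close>, so that each case
    has a fixed number of Lanczos steps, and \<open>rayleigh_min\<close> stands for
    \<open>lambda_min\<close>; both are for measurability.\<close>
  define good where "good = (\<lambda>((A :: real^'n^'n, t), b). \<forall>j. lanczos_steps TYPE('n) B t \<delta> = j \<longrightarrow>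
      (\<exists>lam u. lanczos_output A b j lam u \<and> lam \<le> rayleigh_min A + t))"
  \<comment> \<open>The product space contains arbitrary matrices and tolerances, so symmetry and
    positivity, which hold along \<open>X\<close>, are built into the set.\<close>
  define Q where "Q = {z \<in> space (S \<Otimes>\<^sub>M borel). spectral_norm (fst (fst z)) \<le> B \<and>
      transpose (fst (fst z)) = fst (fst z) \<and> 0 < snd (fst z) \<and> \<not> good z}"
  have sn: "Measurable.pred borel (\<lambda>A :: real^'n^'n. spectral_norm A \<le> B)"
    using sets_spectral_norm[of B] by (simp add: pred_def)
  have "closed {A :: real^'n^'n. transpose A = A}"
    by (intro closed_Collect_eq continuous_on_transpose continuous_on_id)
  then have tr: "Measurable.pred borel (\<lambda>A :: real^'n^'n. transpose A = A)"
    using borel_closed by (simp add: pred_def)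
  have "Measurable.pred (S \<Otimes>\<^sub>M borel) good"
    unfolding good_def S_def case_prod_unfold by measurable
  then have Q: "Q \<in> sets (S \<Otimes>\<^sub>M borel)"
    unfolding Q_def S_def using sn tr by measurable
  have Bad: "Bad = (\<lambda>\<omega>. (X \<omega>, b \<omega>)) -` Q \<inter> space M"
    unfolding Bad_def Q_def good_def X_def
    using sym tol0 by (auto simp: rayleigh_min_symmetric S_def space_pair_measure)
  have pair: "(\<lambda>\<omega>. (X \<omega>, b \<omega>)) \<in> measurable M (S \<Otimes>\<^sub>M borel)" using X by measurable
  show "Bad \<in> sets M" unfolding Bad by (rule measurable_sets[OF pair Q])
  have space_F: "space F = space M" using sub by (simp add: subalgebra_def)
  interpret PX: prob_space "distr M S X" by (rule M.prob_space_distr[OF X])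
  have distr: "distr M S X \<Otimes>\<^sub>M uniform_sphere = distr M (S \<Otimes>\<^sub>M borel) (\<lambda>\<omega>. (X \<omega>, b \<omega>))"
  proof (rule pair_measure_eqI)
    show "sigma_finite_measure (distr M S X)" ..
    show "sigma_finite_measure (uniform_sphere :: (real^'n) measure)" ..
    show "sets (distr M S X \<Otimes>\<^sub>M (uniform_sphere :: (real^'n) measure))
        = sets (distr M (S \<Otimes>\<^sub>M borel) (\<lambda>\<omega>. (X \<omega>, b \<omega>)))"
      unfolding sets_distr by (rule sets_pair_measure_cong) simp_all
    fix C D assume "C \<in> sets (distr M S X)" "D \<in> sets (uniform_sphere :: (real^'n) measure)"
    then have C: "C \<in> sets S" and D: "D \<in> sets borel" by auto
    have "X -` C \<inter> space M \<in> sets F" using measurable_sets[OF XF C] by (simp add: space_F)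
    then have "M.prob ((X -` C \<inter> space M) \<inter> (b -` D \<inter> space M))
        = M.prob (X -` C \<inter> space M) * M.prob (b -` D \<inter> space M)"
      by (rule M.indep_setD[OF ind]) (use D in blast)
    moreover have "(\<lambda>\<omega>. (X \<omega>, b \<omega>)) -` (C \<times> D) \<inter> space M = (X -` C \<inter> space M) \<inter> (b -` D \<inter> space M)"
      by auto
    moreover have "emeasure uniform_sphere D = emeasure M (b -` D \<inter> space M)"
      unfolding b(2)[symmetric] by (rule emeasure_distr[OF b(1) D])
    ultimately show "emeasure (distr M S X) C * emeasure uniform_sphere D
        = emeasure (distr M (S \<Otimes>\<^sub>M borel) (\<lambda>\<omega>. (X \<omega>, b \<omega>))) (C \<times> D)"
      using C D by (simp add: emeasure_distr[OF pair] emeasure_distr[OF X C] M.emeasure_eq_measure ennreal_mult)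
  qed
  have slice: "emeasure uniform_sphere (Pair x -` Q) \<le> ennreal \<delta>" for x
  proof (cases "spectral_norm (fst x) \<le> B \<and> transpose (fst x) = fst x \<and> 0 < snd x")
    case True
    define G where "G = {b. \<exists>lam u. lanczos_output (fst x) b (lanczos_steps TYPE('n) B (snd x) \<delta>) lam u
        \<and> lam \<le> lambda_min (fst x) + snd x}"
    have G: "G \<in> sets uniform_sphere"
    proof -
      have "G \<in> sets borel" unfolding G_def by measurable
      then show ?thesis by simp
    qed
    have "Pair x -` Q = space uniform_sphere - G"
      using True unfolding Q_def good_def G_def case_prod_unfold
      by (auto simp: rayleigh_min_symmetric S_def space_pair_measure)
    then have "measure uniform_sphere (Pair x -` Q) = 1 - measure uniform_sphere G"
      using U.prob_compl[OF G] by simp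
    also have "\<dots> \<le> \<delta>"
      using lanczos_steps_reliable[of "snd x" \<delta> B, where 'n='n] True \<delta>
      unfolding lanczos_reliable_def G_def by auto
    finally show ?thesis using \<delta> by (simp add: U.emeasure_eq_measure)
  next
    case False
    then have "Pair x -` Q = {}" by (auto simp: Q_def)
    then show ?thesis by simp
  qed
  have "emeasure M Bad = emeasure (distr M (S \<Otimes>\<^sub>M borel) (\<lambda>\<omega>. (X \<omega>, b \<omega>))) Q"
    unfolding Bad by (rule emeasure_distr[OF pair Q, symmetric])
  also have "\<dots> = (\<integral>\<^sup>+x. emeasure uniform_sphere (Pair x -` Q) \<partial>distr M S X)"
    unfolding distr[symmetric]
  proof (rule U.emeasure_pair_measure_alt)
    have "sets (distr M S X \<Otimes>\<^sub>M (uniform_sphere :: (real^'n) measure)) = sets (S \<Otimes>\<^sub>M borel)"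
      by (intro sets_pair_measure_cong) auto
    then show "Q \<in> sets (distr M S X \<Otimes>\<^sub>M uniform_sphere)" using Q by simp
  qed
  also have "\<dots> \<le> (\<integral>\<^sup>+x. ennreal \<delta> \<partial>distr M S X)" by (intro nn_integral_mono slice)
  also have "\<dots> = ennreal \<delta>" by (simp add: PX.emeasure_space_1[simplified])
  finally show "measure M Bad \<le> \<delta>" using \<delta> by (simp add: M.emeasure_eq_measure)
qed

section \<open>Descent\<close>

lemma eps2_eq: "eps2 l \<mu> \<rho> \<epsilon> = sqrt (L2 l \<mu> \<rho>) * sqrt \<epsilon> / 36" if "0 < \<epsilon>"
  using that by (simp add: eps2_def powr_half_sqrt)

lemma powr_three_halves: "\<epsilon> powr (3/2) = sqrt \<epsilon> ^ 3" if "0 < \<epsilon>" for \<epsilon> :: real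
proof -
  have "\<epsilon> powr (3/2) = \<epsilon> powr (1/2 * 3)" by simp
  also have "\<dots> = (\<epsilon> powr (1/2)) powr 3" by (rule powr_powr[symmetric])
  also have "\<dots> = sqrt \<epsilon> ^ 3" using that by (simp add: powr_half_sqrt powr_numeral)
  finally show ?thesis .
qed

lemma quadratic_perturbation:
  assumes "spectral_norm (H - A) \<le> c"
  shows "\<bar>x \<bullet> (H *v x) - x \<bullet> (A *v x)\<bar> \<le> c * (x \<bullet> x)"
proof -
  have "x \<bullet> (H *v x) - x \<bullet> (A *v x) = x \<bullet> ((H - A) *v x)"
    by (simp add: matrix_vector_mult_diff_rdistrib inner_diff_right)
  then show ?thesis
    using spectral_norm_quadratic[of x "H - A"] mult_right_mono[OF assms, of "x \<bullet> x"] by simp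
qed

context minimax_problem
begin

section \<open>The cubic model and the accuracy budget\<close>

abbreviation "Pf \<equiv> max_fun f"
abbreviation "M1 \<equiv> L1 l \<mu>"
abbreviation "M2 \<equiv> L2 l \<mu> \<rho>"

lemma M1_pos: "0 < M1" using l_pos kappa_ge_1 by (simp add: L1_def)

lemma M2_pos: "0 < M2" using rho_pos kappa_ge_1 by (simp add: L2_def)

lemma Pf_upper:
  "Pf (x + s) \<le> Pf x + grad Pf x \<bullet> s + 1/2 * (s \<bullet> (hess Pf x *v s)) + M2/6 * norm s ^ 3"
  by (rule lipschitz_hessian_upper[OF max_fun_GDERIV grad_max_fun_derivative hess_max_fun_lipschitz])

lemma grad_Pf_taylor: "norm (grad Pf (x + s) - grad Pf x - hess Pf x *v s) \<le> M2/2 * (norm s)\<^sup>2"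
  by (rule lipschitz_jacobian_norm[OF grad_max_fun_derivative hess_max_fun_lipschitz])

context
  fixes \<epsilon> :: real
  assumes eps_pos: "0 < \<epsilon>" and eps_le_1: "\<epsilon> \<le> 1" and chi: "sqrt (M2 * \<epsilon>) \<le> M1"
begin

abbreviation "e1 \<equiv> eps1 l \<mu> \<rho> \<epsilon>"
abbreviation "e2 \<equiv> eps2 l \<mu> \<rho> \<epsilon>"

lemma sqrt_eps: "0 < sqrt \<epsilon>" "sqrt \<epsilon> \<le> 1" "(sqrt \<epsilon>)\<^sup>2 = \<epsilon>" "sqrt \<epsilon> ^ 3 \<le> \<epsilon>"
proof -
  show "0 < sqrt \<epsilon>" "sqrt \<epsilon> \<le> 1" "(sqrt \<epsilon>)\<^sup>2 = \<epsilon>" using eps_pos eps_le_1 by auto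
  have "sqrt \<epsilon> ^ 3 = \<epsilon> * sqrt \<epsilon>" using eps_pos by (simp add: power3_eq_cube)
  then show "sqrt \<epsilon> ^ 3 \<le> \<epsilon>" using eps_pos eps_le_1 by (simp add: mult_left_le)
qed

lemma eps1_bounds:
  "0 < e1" "e1 \<le> sqrt \<epsilon> ^ 3 / 144" "e1 * (32 * M1) \<le> sqrt M2 * sqrt \<epsilon> ^ 3"
proof -
  define m where "m = Min {1/32, 1/144, sqrt M2 / (32 * M1)}"
  have e1: "e1 = m * sqrt \<epsilon> ^ 3" unfolding eps1_def m_def using powr_three_halves[OF eps_pos] by simp
  have m: "0 < m" "m \<le> 1/144" "m \<le> sqrt M2 / (32 * M1)"
    using M1_pos M2_pos by (auto simp: m_def)
  have q: "0 < sqrt \<epsilon> ^ 3" using sqrt_eps by simp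
  show "0 < e1" using m q by (simp add: e1)
  show "e1 \<le> sqrt \<epsilon> ^ 3 / 144" using mult_right_mono[OF m(2), of "sqrt \<epsilon> ^ 3"] q by (simp add: e1)
  have "m * (32 * M1) \<le> sqrt M2" using m(3) M1_pos by (simp add: pos_le_divide_eq)
  then have "m * (32 * M1) * sqrt \<epsilon> ^ 3 \<le> sqrt M2 * sqrt \<epsilon> ^ 3" using q by (intro mult_right_mono) auto
  then show "e1 * (32 * M1) \<le> sqrt M2 * sqrt \<epsilon> ^ 3" by (simp add: e1 mult_ac)
qed

lemma eps1_le: "e1 \<le> \<epsilon> / 144" using eps1_bounds(2) sqrt_eps(4) by linarith

lemma eps2_bounds: "0 \<le> e2" "e2 \<le> M1 / 36"
  using chi M2_pos eps_pos by (auto simp: eps2_eq real_sqrt_mult)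

lemma inner_accuracy_bounds: "0 < inner_accuracy l \<mu> \<rho> \<epsilon>" "l * inner_accuracy l \<mu> \<rho> \<epsilon> \<le> e1"
proof -
  have "0 < e2" using M2_pos eps_pos by (simp add: eps2_eq)
  moreover have "0 < LH l \<mu> \<rho>" using rho_pos kappa_ge_1 by (simp add: LH_def)
  ultimately show "0 < inner_accuracy l \<mu> \<rho> \<epsilon>"
    using eps1_bounds l_pos by (simp add: inner_accuracy_def)
  have "inner_accuracy l \<mu> \<rho> \<epsilon> \<le> e1 / l" by (simp add: inner_accuracy_def)
  then show "l * inner_accuracy l \<mu> \<rho> \<epsilon> \<le> e1" using l_pos by (simp add: pos_le_divide_eq mult.commute)
qed

text \<open>With \<open>v = sqrt M2\<close> and \<open>w = sqrt (max (norm g) \<epsilon>)\<close>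
  the step has length \<open>w / (2 * v)\<close>, and all terms of the cubic bound are multiples of
  \<open>w^3 / v\<close>: gradient error \<open>1/288\<close>, curvature \<open>- 1/36\<close> (from
  \<open>- 1/4 + 1/36 = - 2/9\<close>), cubic term \<open>1/48\<close>. Their sum is
  \<open>- 1/288\<close>; 500 is a common value that also covers the Newton step.\<close>

lemma negative_curvature_descent:
  fixes g u s :: "real^'n" and H :: "real^'n^'n"
  assumes g: "norm (g - grad Pf x) \<le> e1" and H: "spectral_norm (H - hess Pf x) \<le> e2"
    and u: "norm u = 1" "g \<bullet> u \<le> 0" "u \<bullet> (H *v u) \<le> - curvature_threshold M2 \<epsilon> g"
    and s: "s = (1/2 * sqrt (max (norm g) \<epsilon> / M2)) *\<^sub>R u"
  shows "Pf (x + s) \<le> Pf x - sqrt \<epsilon> ^ 3 / (500 * sqrt M2)"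
proof -
  define v w where "v = sqrt M2" and "w = sqrt (max (norm g) \<epsilon>)"
  have v: "v > 0" "v\<^sup>2 = M2" using M2_pos by (auto simp: v_def)
  have w: "w > 0" "sqrt \<epsilon> \<le> w" "w\<^sup>2 = max (norm g) \<epsilon>" using eps_pos by (auto simp: w_def)
  define t where "t = w / (2 * v)"
  have t: "t > 0" using v w by (simp add: t_def)
  have su: "s = t *\<^sub>R u" by (simp add: s t_def v_def w_def real_sqrt_divide)
  have ns: "norm s = t" using u t by (simp add: su)
  have ss: "s \<bullet> s = t\<^sup>2" using u by (simp add: su dot_square_norm power2_eq_square)
  have thr: "curvature_threshold M2 \<epsilon> g = v * w / 4"
    by (simp add: curvature_threshold_def v_def w_def real_sqrt_mult)
  have e2: "e2 \<le> v * w / 36" using w v eps_pos by (simp add: eps2_eq v_def)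
  have "grad Pf x \<bullet> s = g \<bullet> s - (g - grad Pf x) \<bullet> s" by (simp add: inner_diff_left)
  moreover have "g \<bullet> s \<le> 0" using u(2) t by (simp add: su mult_nonneg_nonpos)
  moreover have "- ((g - grad Pf x) \<bullet> s) \<le> e1 * t"
  proof -
    have "- ((g - grad Pf x) \<bullet> s) \<le> norm (g - grad Pf x) * norm s"
      using Cauchy_Schwarz_ineq2[of "g - grad Pf x" s] by linarith
    also have "\<dots> \<le> e1 * t" unfolding ns using g t by (intro mult_right_mono) auto
    finally show ?thesis .
  qed
  ultimately have first: "grad Pf x \<bullet> s \<le> e1 * t" by linarith
  have "s \<bullet> (H *v s) = t\<^sup>2 * (u \<bullet> (H *v u))"
    by (simp add: su matrix_vector_mult_scaleR power2_eq_square)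
  also have "\<dots> \<le> t\<^sup>2 * (- (v * w / 4))" using u(3) unfolding thr by (intro mult_left_mono) auto
  finally have "s \<bullet> (hess Pf x *v s) \<le> t\<^sup>2 * (- (v * w / 4)) + e2 * t\<^sup>2"
    using quadratic_perturbation[OF H, of s] by (simp add: ss abs_le_iff)
  also have "e2 * t\<^sup>2 \<le> (v * w / 36) * t\<^sup>2" using e2 by (intro mult_right_mono) auto
  finally have second: "s \<bullet> (hess Pf x *v s) \<le> - (2/9) * (v * w * t\<^sup>2)" by (simp add: algebra_simps)
  have "e1 * t \<le> (w\<^sup>2 / 144) * t"
  proof -
    have "\<epsilon> \<le> w\<^sup>2" using w by simp
    then have "e1 \<le> w\<^sup>2 / 144" using eps1_le by linarith
    then show ?thesis using t by (intro mult_right_mono) auto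
  qed
  then have "Pf (x + s) - Pf x \<le> (w\<^sup>2 / 144) * t + 1/2 * (- (2/9) * (v * w * t\<^sup>2)) + v\<^sup>2/6 * t^3"
    using Pf_upper[of x s] first second by (simp add: ns v)
  also have "\<dots> = - (1/288) * (w^3 / v)"
    using v(1) by (simp add: t_def field_simps power2_eq_square power3_eq_cube)
  also have "\<dots> \<le> - (1/500) * (sqrt \<epsilon> ^ 3 / v)"
  proof -
    have "sqrt \<epsilon> ^ 3 / v \<le> w ^ 3 / v" using w v sqrt_eps by (intro divide_right_mono power_mono) auto
    moreover have "0 \<le> sqrt \<epsilon> ^ 3 / v" using v sqrt_eps by simp
    ultimately show ?thesis by linarith
  qed
  finally show ?thesis by (simp add: v_def)
qed

text \<open>An accepted step lowers \<open>Pf\<close> by at least \<open>\<sigma> n^2 / 15\<close>,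
  where \<sigma> is the shift and \<open>n\<close> the step length. If the new gradient is not
  halved, the Taylor bound for the gradient forces \<open>\<sigma> n\<close> to be at least a
  multiple of \<open>norm g\<close>, and the decrease is of the desired order.\<close>

lemma newton_descent:
  fixes g s :: "real^'n" and H :: "real^'n^'n"
  assumes g: "norm (g - grad Pf x) \<le> e1" and H: "spectral_norm (H - hess Pf x) \<le> e2"
    and g_eps: "\<epsilon> \<le> norm g"
    and low: "\<And>x. - (1/2 * sqrt (M2 * norm g)) * (x \<bullet> x) \<le> x \<bullet> (H *v x)"
    and res: "norm (g + cg_shift M2 H g *v s) \<le> 1/4 * min (norm g) (1/2 * sqrt (M2 * norm g) * norm s)"
  shows "Pf (x + s) \<le> Pf x"
    and "norm (g' - grad Pf (x + s)) \<le> e1 \<Longrightarrow>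
      norm g' < norm g / 2 \<or> Pf (x + s) \<le> Pf x - sqrt \<epsilon> ^ 3 / (500 * sqrt M2)"
proof -
  define v w n where "v = sqrt M2" and "w = sqrt (norm g)" and "n = norm s"
  define A where "A = hess Pf x"
  define r where "r = g + cg_shift M2 H g *v s"
  have v: "v > 0" "v\<^sup>2 = M2" using M2_pos by (auto simp: v_def)
  have w: "w > 0" "sqrt \<epsilon> \<le> w" "w\<^sup>2 = norm g" using eps_pos g_eps by (auto simp: w_def)
  have n: "n \<ge> 0" by (simp add: n_def)
  define \<sigma> where "\<sigma> = v * w"
  have sg: "sqrt (M2 * norm g) = \<sigma>" by (simp add: \<sigma>_def v_def w_def real_sqrt_mult)
  have \<sigma>: "\<sigma> > 0" using v w by (simp add: \<sigma>_def)
  have ss: "s \<bullet> s = n\<^sup>2" by (simp add: n_def dot_square_norm)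
  have Bs: "cg_shift M2 H g *v s = H *v s + \<sigma> *\<^sub>R s"
    by (simp add: cg_shift_def sg matrix_vector_mult_add_rdistrib scaleR_matrix_vector_assoc[symmetric])
  have rg: "r = g + H *v s + \<sigma> *\<^sub>R s" by (simp add: r_def Bs)
  have res': "norm r \<le> 1/4 * min (norm g) (1/2 * \<sigma> * n)"
    using res unfolding r_def[symmetric] sg n_def[symmetric] .
  have r1: "norm r \<le> 1/4 * w\<^sup>2" and r2: "norm r \<le> \<sigma> * n / 8"
    using res' min.cobounded1[of "norm g" "1/2 * \<sigma> * n"] min.cobounded2[of "norm g" "1/2 * \<sigma> * n"]
    unfolding w(3) by linarith+
  have e2: "e2 \<le> \<sigma> / 36" using w v eps_pos by (simp add: eps2_eq v_def \<sigma>_def)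
  have e2n: "e2 * n \<le> \<sigma> / 36 * n" "e2 * n\<^sup>2 \<le> \<sigma> / 36 * n\<^sup>2" using mult_right_mono[OF e2 n] mult_right_mono[OF e2, of "n\<^sup>2"] by simp_all
  have lowH: "- (1/2 * \<sigma>) * n\<^sup>2 \<le> s \<bullet> (H *v s)" using low[of s] by (simp only: sg ss)
  have rs: "r \<bullet> s \<le> \<sigma> * n\<^sup>2 / 8"
  proof -
    have "r \<bullet> s \<le> norm r * n" unfolding n_def by (rule norm_cauchy_schwarz)
    also have "\<dots> \<le> (\<sigma> * n / 8) * n" using r2 n by (intro mult_right_mono) auto
    finally show ?thesis by (simp add: power2_eq_square)
  qed
  have dot: "r \<bullet> s = g \<bullet> s + s \<bullet> (H *v s) + \<sigma> * n\<^sup>2"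
    by (simp add: rg inner_add_left ss inner_commute[of "H *v s" s])
  \<comment> \<open>Pairing the residual equation with \<open>s\<close> gives
    \<open>g \<bullet> s \<le> - 3/8 * \<sigma> * n^2\<close>, from \<open>1/8 + 1/2 - 1\<close>.
    This bounds the step length and thereby controls the cubic term.\<close>
  have vn: "v * n \<le> 8/3 * w"
  proof (cases "n = 0")
    case False
    have "- (g \<bullet> s) \<le> w\<^sup>2 * n" using Cauchy_Schwarz_ineq2[of g s] by (simp add: n_def w)
    then have "(3/8 * \<sigma> * n) * n \<le> w\<^sup>2 * n" using dot rs lowH by (simp add: power2_eq_square algebra_simps)
    then have "w * (3/8 * (v * n)) \<le> w * w"
      using False n by (simp add: \<sigma>_def power2_eq_square mult_ac mult_le_cancel_right)
    then show ?thesis using w(1) by simp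
  qed (use w in simp)
  have cubic: "v\<^sup>2 * n\<^sup>2 \<le> 8/3 * (\<sigma> * n)"
  proof -
    have "(v * n) * (v * n) \<le> (8/3 * w) * (v * n)" using vn v n by (intro mult_right_mono) auto
    then show ?thesis by (simp add: \<sigma>_def power2_eq_square mult_ac)
  qed
  have lower: "3/4 * w\<^sup>2 \<le> (37/36 * M1 + \<sigma>) * n"
  proof -
    have "norm (H *v s) \<le> (37/36 * M1) * n"
    proof -
      have "norm (H *v s) \<le> norm ((H - A) *v s) + norm (A *v s)"
        using norm_triangle_ineq[of "(H - A) *v s" "A *v s"] by (simp add: matrix_vector_mult_diff_rdistrib)
      also have "\<dots> \<le> e2 * n + M1 * n"
        using spectral_norm_bound[of "H - A" s] mult_right_mono[OF H, of n] hess_max_fun_bound[of x s] n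
        by (simp add: A_def n_def)
      also have "e2 * n \<le> M1 / 36 * n" using eps2_bounds n by (intro mult_right_mono) auto
      finally show ?thesis by (simp add: algebra_simps)
    qed
    moreover have "norm g \<le> norm r + (norm (H *v s) + \<sigma> * n)"
    proof -
      have "g = r - (H *v s + \<sigma> *\<^sub>R s)" by (simp add: rg)
      then have "norm g \<le> norm r + norm (H *v s + \<sigma> *\<^sub>R s)" by (metis norm_triangle_ineq4)
      also have "norm (H *v s + \<sigma> *\<^sub>R s) \<le> norm (H *v s) + \<sigma> * n"
        using norm_triangle_ineq[of "H *v s" "\<sigma> *\<^sub>R s"] \<sigma> by (simp add: n_def)
      finally show ?thesis by simp
    qed
    ultimately show ?thesis using r1 w by (simp add: algebra_simps)
  qed
  \<comment> \<open>The third entry of the minimum in \<open>eps1\<close> acts here: for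
    \<open>\<sigma> \<le> M1\<close> the lower bound on \<open>n\<close> involves \<open>M1\<close>.
    For larger \<sigma> the bound \<open>\<epsilon> / 144\<close> suffices.\<close>
  have e1n: "e1 \<le> 1/10 * (\<sigma> * n)"
  proof (cases "\<sigma> \<le> M1")
    case True
    then have "(37/36 * M1 + \<sigma>) * n \<le> (73/36 * M1) * n" using n by (intro mult_right_mono) auto
    then have "3/4 * w\<^sup>2 \<le> 73/36 * (M1 * n)" using lower by simp
    then have "\<sigma> * (3/4 * w\<^sup>2) \<le> \<sigma> * (73/36 * (M1 * n))" using \<sigma> by (intro mult_left_mono) auto
    moreover have "e1 * (32 * M1) \<le> v * w ^ 3"
    proof -
      have "sqrt M2 * sqrt \<epsilon> ^ 3 \<le> v * w ^ 3" unfolding v_def[symmetric] using v w sqrt_eps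
        by (intro mult_left_mono power_mono) auto
      then show ?thesis using eps1_bounds(3) by linarith
    qed
    moreover have "v * w ^ 3 = \<sigma> * w\<^sup>2" by (simp add: \<sigma>_def power2_eq_square power3_eq_cube)
    ultimately have "(24 * e1) * M1 \<le> (73/36 * (\<sigma> * n)) * M1" by (simp add: algebra_simps)
    then have "24 * e1 \<le> 73/36 * (\<sigma> * n)" using M1_pos by (simp only: mult_le_cancel_right_pos)
    moreover have "0 \<le> \<sigma> * n" using \<sigma> n by simp
    ultimately show ?thesis by linarith
  next
    case False
    then have "(37/36 * M1 + \<sigma>) * n \<le> (73/36 * \<sigma>) * n" using n by (intro mult_right_mono) auto
    then have "3/4 * w\<^sup>2 \<le> 73/36 * (\<sigma> * n)" using lower by simp
    then show ?thesis using eps1_le w g_eps eps_pos by linarith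
  qed
  have "grad Pf x \<bullet> s \<le> g \<bullet> s + e1 * n"
  proof -
    have "\<bar>(g - grad Pf x) \<bullet> s\<bar> \<le> e1 * n"
      using Cauchy_Schwarz_ineq2[of "g - grad Pf x" s] mult_right_mono[OF g n] by (simp add: n_def)
    then show ?thesis by (simp add: inner_diff_left abs_le_iff)
  qed
  moreover have "s \<bullet> (A *v s) \<le> s \<bullet> (H *v s) + e2 * n\<^sup>2"
    using quadratic_perturbation[OF H, of s] by (simp add: A_def ss abs_le_iff)
  moreover have "M2/6 * n ^ 3 \<le> 4/9 * (\<sigma> * n\<^sup>2)"
  proof -
    have "(v\<^sup>2 * n\<^sup>2) * n \<le> (8/3 * (\<sigma> * n)) * n" using cubic n by (intro mult_right_mono)
    then show ?thesis unfolding v(2)[symmetric] by (simp add: power2_eq_square power3_eq_cube mult_ac)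
  qed
  moreover have "e1 * n \<le> 1/10 * (\<sigma> * n\<^sup>2)"
    using mult_right_mono[OF e1n n] by (simp add: power2_eq_square mult.assoc)
  \<comment> \<open>Multiples of \<open>\<sigma> * n^2\<close>: residual \<open>1/8\<close>,
    curvature \<open>1/4\<close>, shift \<open>- 1\<close>, gradient error \<open>1/10\<close>,
    Hessian error \<open>1/72\<close>, cubic term \<open>4/9\<close>. They sum to
    \<open>- 1/15\<close>.\<close>
  ultimately have descent: "Pf (x + s) \<le> Pf x - 1/15 * (\<sigma> * n\<^sup>2)"
    using Pf_upper[of x s] dot rs lowH e2n(2) unfolding n_def[symmetric] A_def[symmetric] by linarith
  moreover have "0 \<le> \<sigma> * n\<^sup>2" using \<sigma> by simp
  ultimately show "Pf (x + s) \<le> Pf x" by linarith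
  assume g': "norm (g' - grad Pf (x + s)) \<le> e1"
  show "norm g' < norm g / 2 \<or> Pf (x + s) \<le> Pf x - sqrt \<epsilon> ^ 3 / (500 * sqrt M2)"
  proof (cases "norm g' < norm g / 2")
    case False
    define q where "q = grad Pf (x + s) - grad Pf x - A *v s"
    have q: "norm q \<le> v\<^sup>2/2 * n\<^sup>2" unfolding q_def A_def n_def v by (rule grad_Pf_taylor)
    have "g' = (g' - grad Pf (x + s)) + q - (g - grad Pf x) - (H - A) *v s + r - \<sigma> *\<^sub>R s"
      by (simp add: q_def rg matrix_vector_mult_diff_rdistrib)
    then have "norm g' \<le> norm (g' - grad Pf (x + s)) + norm q + norm (g - grad Pf x)
        + norm ((H - A) *v s) + norm r + norm (\<sigma> *\<^sub>R s)"
      by (smt (verit, best) norm_triangle_ineq norm_triangle_ineq4)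
    also have "\<dots> \<le> e1 + v\<^sup>2/2 * n\<^sup>2 + e1 + e2 * n + \<sigma> * n / 8 + \<sigma> * n"
      using g' q g r2 spectral_norm_bound[of "H - A" s] mult_right_mono[OF H n] \<sigma>
      by (intro add_mono) (auto simp: n_def A_def)
    finally have "norm g' \<le> 2 * e1 + v\<^sup>2 * n\<^sup>2 / 2 + e2 * n + 9/8 * (\<sigma> * n)" by simp
    moreover have "0 \<le> \<sigma> * n" using \<sigma> n by simp
    moreover have "e2 * n \<le> 1/36 * (\<sigma> * n)" using e2n(1) by simp
    ultimately have "norm g' \<le> 2 * e1 + 5/2 * (\<sigma> * n)" using cubic by linarith
    \<comment> \<open>An unhalved gradient leaves \<open>1/2 - 2/144 = 35/72\<close> of
      \<open>w^2\<close>; division by \<open>5/2\<close> gives \<open>7/36\<close>.\<close>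
    then have "7/36 * w\<^sup>2 \<le> \<sigma> * n" using False eps1_le g_eps w by simp
    then have "(7/36 * w\<^sup>2)\<^sup>2 \<le> (\<sigma> * n)\<^sup>2" using \<sigma> n by (intro power_mono) auto
    then have "w * (49/1296 * w ^ 3) \<le> w * (v * (\<sigma> * n\<^sup>2))"
      by (simp add: \<sigma>_def power2_eq_square power3_eq_cube mult_ac)
    then have "49/1296 * w ^ 3 \<le> v * (\<sigma> * n\<^sup>2)" using w(1) by simp
    moreover have "sqrt \<epsilon> ^ 3 \<le> w ^ 3" using w sqrt_eps by (intro power_mono) auto
    moreover have "0 \<le> sqrt \<epsilon> ^ 3" using sqrt_eps by simp
    ultimately have "15 / 500 * sqrt \<epsilon> ^ 3 \<le> v * (\<sigma> * n\<^sup>2)" by linarith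
    then have "sqrt \<epsilon> ^ 3 / (500 * v) \<le> 1/15 * (\<sigma> * n\<^sup>2)" using v by (simp add: field_simps)
    then show ?thesis using descent by (simp add: v_def)
  qed simp
qed

end
end

section \<open>Trajectories\<close>

text \<open>Potential: \<open>W (p - Ps) / d\<close> plus the number of halvings that \<open>\<gamma>\<close> can still undergo.\<close>

lemma halving_count:
  fixes p \<gamma> :: "nat \<Rightarrow> real"
  assumes d: "0 < d" and \<epsilon>: "0 < \<epsilon>" "\<epsilon> \<le> \<Gamma>"
    and step: "\<And>t. t < T \<Longrightarrow> p (Suc t) \<le> p t - d \<or> (p (Suc t) \<le> p t \<and> \<epsilon> \<le> \<gamma> t \<and> \<gamma> (Suc t) < \<gamma> t / 2)"
    and low: "Ps \<le> p T" and bound: "\<And>t. t \<le> T \<Longrightarrow> p t \<le> p 0 \<Longrightarrow> \<gamma> t \<le> \<Gamma>"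
  shows "real T \<le> (log 2 (2 * \<Gamma> / \<epsilon>) + 1) * ((p 0 - Ps) / d + 1)"
proof -
  \<comment> \<open>One more than the largest value of the counter, so that a decrease by
    \<open>d\<close> pays for a full reset of the counter and still gains 1.\<close>
  define W where "W = log 2 (2 * \<Gamma> / \<epsilon>) + 1"
  \<comment> \<open>The factor 2 makes the value at least 1 whenever
    \<open>r \<ge> \<epsilon>\<close>, so halving such an \<open>r\<close> always costs a full unit,
    even if it ends below the cut-off.\<close>
  define \<phi> where "\<phi> r = log 2 (max 1 (2 * r / \<epsilon>))" for r
  have W: "W \<ge> 1" using \<epsilon> by (simp add: W_def field_simps)
  have \<phi>0: "0 \<le> \<phi> r" for r by (simp add: \<phi>_def)
  have \<phi>W: "\<phi> r \<le> W - 1" if "r \<le> \<Gamma>" for r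
  proof -
    have "2 * r / \<epsilon> \<le> 2 * \<Gamma> / \<epsilon>" using that \<epsilon> by (intro divide_right_mono) auto
    moreover have "1 \<le> 2 * \<Gamma> / \<epsilon>" using \<epsilon> by (simp add: field_simps)
    ultimately show ?thesis by (simp add: \<phi>_def W_def)
  qed
  have half: "\<phi> r' \<le> \<phi> r - 1" if "\<epsilon> \<le> r" "r' < r / 2" for r r'
  proof -
    have "max 1 (2 * r' / \<epsilon>) \<le> r / \<epsilon>" using that \<epsilon> by (simp add: field_simps)
    then have "\<phi> r' \<le> log 2 (r / \<epsilon>)" by (simp add: \<phi>_def)
    also have "\<dots> = log 2 (2 * r / \<epsilon>) - 1"
      using that \<epsilon> by (simp add: log_mult log_divide)
    also have "2 * r / \<epsilon> = max 1 (2 * r / \<epsilon>)" using that \<epsilon> by (simp add: field_simps)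
    finally show ?thesis by (simp add: \<phi>_def)
  qed
  define \<Psi> where "\<Psi> t = W * ((p t - Ps) / d) + \<phi> (\<gamma> t)" for t
  have "t \<le> T \<Longrightarrow> p t \<le> p 0 \<and> \<Psi> t \<le> \<Psi> 0 - real t" for t
  proof (induction t)
    case (Suc t)
    then have IH: "p t \<le> p 0" "\<Psi> t \<le> \<Psi> 0 - real t" and t: "t < T" by auto
    have "p (Suc t) \<le> p 0" using step[OF t] IH d by linarith
    moreover have "\<Psi> (Suc t) \<le> \<Psi> t - 1"
      using step[OF t]
    proof
      assume "p (Suc t) \<le> p t - d"
      then have "(p (Suc t) - Ps) / d \<le> ((p t - Ps) - d) / d" using d by (intro divide_right_mono) auto
      also have "\<dots> = (p t - Ps) / d - 1" using d by (simp add: diff_divide_distrib)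
      finally have "W * ((p (Suc t) - Ps) / d) \<le> W * ((p t - Ps) / d - 1)" using W by (intro mult_left_mono) auto
      moreover have "\<phi> (\<gamma> (Suc t)) \<le> W - 1"
        using bound[of "Suc t"] \<open>p (Suc t) \<le> p 0\<close> t by (intro \<phi>W) auto
      ultimately show ?thesis using \<phi>0[of "\<gamma> t"] by (simp add: \<Psi>_def algebra_simps)
    next
      assume a: "p (Suc t) \<le> p t \<and> \<epsilon> \<le> \<gamma> t \<and> \<gamma> (Suc t) < \<gamma> t / 2"
      then have "(p (Suc t) - Ps) / d \<le> (p t - Ps) / d" using d by (intro divide_right_mono) auto
      then have "W * ((p (Suc t) - Ps) / d) \<le> W * ((p t - Ps) / d)" using W by (intro mult_left_mono) auto
      then show ?thesis using half[of "\<gamma> t" "\<gamma> (Suc t)"] a by (simp add: \<Psi>_def)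
    qed
    ultimately show ?case using IH by simp
  qed simp
  from this[of T] have "real T \<le> \<Psi> 0 - \<Psi> T" by simp
  moreover have "0 \<le> \<Psi> T" using W low d \<phi>0[of "\<gamma> T"] by (simp add: \<Psi>_def)
  moreover have "\<Psi> 0 \<le> W * ((p 0 - Ps) / d) + (W - 1)" using \<phi>W[OF bound[of 0]] by (simp add: \<Psi>_def)
  ultimately show ?thesis by (simp add: W_def algebra_simps)
qed

context minimax_problem
begin

section \<open>Explicit bounds on iterations and inner costs\<close>

definition gradient_bound :: "real \<Rightarrow> real^'n \<Rightarrow> real" where
  "gradient_bound \<epsilon> x0 = sqrt (2 * M1 * (Pf x0 - Pstar)) + \<epsilon>"

definition iteration_bound :: "real \<Rightarrow> real^'n \<Rightarrow> real" where
  "iteration_bound \<epsilon> x0 = (log 2 (2 * gradient_bound \<epsilon> x0 / \<epsilon>) + 1)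
     * ((Pf x0 - Pstar) / (sqrt \<epsilon> ^ 3 / (500 * sqrt M2)) + 1)"

text \<open>Solves the exponential condition of \<open>cg_accepts_after\<close> for the condition
  number \<open>5 * (M1 / sqrt (M2 * \<epsilon>))\<close>, where 5 exceeds
  \<open>37/18 + 2\<close>.\<close>

definition cg_bound :: "real \<Rightarrow> nat" where
  "cg_bound \<epsilon> = nat \<lceil>sqrt (5 * (M1 / sqrt (M2 * \<epsilon>))) *
     ln (5 * (M1 / sqrt (M2 * \<epsilon>)) * (5 * (M1 / sqrt (M2 * \<epsilon>)) + 1) * (6 * (5 * (M1 / sqrt (M2 * \<epsilon>))))\<^sup>2)\<rceil>"

text \<open>The analogue for Lanczos: 17 exceeds \<open>4 * 4 * 37/36\<close>, the value coming from
  \<open>4 * B / tol\<close>, and \<open>Suc\<close> accounts for the starting vector.\<close>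

definition lanczos_bound :: "real \<Rightarrow> real \<Rightarrow> nat" where
  "lanczos_bound \<epsilon> \<delta> = Suc (nat \<lceil>sqrt (17 * (M1 / sqrt (M2 * \<epsilon>))) *
     ln (17 * (M1 / sqrt (M2 * \<epsilon>)) * (17 * (M1 / sqrt (M2 * \<epsilon>)) + 1) * (96 * real CARD('n) / \<delta>\<^sup>2))\<rceil>)"

lemma iteration_bound_nonneg:
  assumes "0 < \<epsilon>" shows "0 \<le> iteration_bound \<epsilon> x0"
proof -
  have "0 \<le> Pf x0 - Pstar" using bounded_below[of x0] by simp
  moreover from this have "1 \<le> 2 * gradient_bound \<epsilon> x0 / \<epsilon>"
    using M1_pos assms by (simp add: gradient_bound_def field_simps add_nonneg_nonneg)
  ultimately show ?thesis unfolding iteration_bound_def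
    using M2_pos assms by (intro mult_nonneg_nonneg add_nonneg_nonneg divide_nonneg_nonneg) auto
qed

lemma agd_within:
  assumes a: "0 < a" and D: "norm (y0 - y_star f x) \<le> D"
    and N: "2 * sqrt (kappa l \<mu>) * ln (sqrt (kappa l \<mu> + 1) * D / a) \<le> real N"
  shows "norm (fst (agd f (1 / l) ((sqrt (kappa l \<mu>) - 1) / (sqrt (kappa l \<mu>) + 1)) x y0 N) - y_star f x) \<le> a"
proof -
  define \<kappa> where "\<kappa> = kappa l \<mu>"
  have k: "\<kappa> \<ge> 1" using kappa_ge_1 by (simp add: \<kappa>_def)
  have D0: "D \<ge> 0" using D norm_ge_zero order_trans by blast
  have "sqrt (\<kappa> + 1) * exp (- real N / (2 * sqrt \<kappa>)) * norm (y0 - y_star f x)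
      \<le> sqrt (\<kappa> + 1) * exp (- real N / (2 * sqrt \<kappa>)) * D"
    using D k by (intro mult_left_mono) auto
  also have "\<dots> \<le> a"
  \<comment> \<open>For \<open>D = 0\<close> the logarithm is taken at 0 and carries no information,
    but the error bound is then 0 itself.\<close>
  proof (cases "D = 0")
    case False
    then have pos: "0 < sqrt (\<kappa> + 1) * D / a" using D0 a k by simp
    have "ln (sqrt (\<kappa> + 1) * D / a) \<le> real N / (2 * sqrt \<kappa>)"
      using N k by (simp add: \<kappa>_def[symmetric] pos_le_divide_eq mult_ac)
    then have "exp (ln (sqrt (\<kappa> + 1) * D / a)) \<le> exp (real N / (2 * sqrt \<kappa>))" by simp
    then have "sqrt (\<kappa> + 1) * D / a \<le> exp (real N / (2 * sqrt \<kappa>))" using pos by (simp only: exp_ln)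
    then show ?thesis using a by (simp add: exp_minus field_simps)
  qed (use a in simp)
  finally show ?thesis using agd_accuracy[of x y0 N] unfolding \<kappa>_def by linarith
qed

context
  fixes \<epsilon> :: real
  assumes eps_pos: "0 < \<epsilon>" and eps_le_1: "\<epsilon> \<le> 1" and chi: "sqrt (M2 * \<epsilon>) \<le> M1"
begin

abbreviation "acc \<equiv> inner_accuracy l \<mu> \<rho> \<epsilon>"

context
  fixes \<delta> :: real and x0 :: "real^'n" and ym1 :: "real^'m" and b :: "nat \<Rightarrow> real^'n" and N K :: "nat \<Rightarrow> nat"
    and x :: "nat \<Rightarrow> real^'n" and y :: "nat \<Rightarrow> real^'m" and lam :: "nat \<Rightarrow> real" and u s :: "nat \<Rightarrow> real^'n"
  assumes run: "ilm_run f l \<mu> \<rho> \<epsilon> \<delta> x0 ym1 b N K x y lam u s"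
begin

section \<open>Invariants of a single trajectory\<close>

abbreviation "gt t \<equiv> grad_x f (x t) (y t)"
abbreviation "Ht t \<equiv> approx_hess f l \<mu> (K t) (x t, y t)"
abbreviation "stopped t \<equiv> stops M2 \<epsilon> (gt t) (lam t)"
abbreviation "running t \<equiv> \<forall>\<tau><t. \<not> stopped \<tau>"
abbreviation "hit t \<equiv> reaches_target M2 \<epsilon> (gt t) (lam t)"
abbreviation "tolt t \<equiv> curvature_threshold M2 \<epsilon> (gt t)"

lemma run_start: "x 0 = x0" using run by (simp add: ilm_run_def Let_def)

lemma run_step:
  assumes "running t"
  shows "(if t = 0 then 2 * sqrt (kappa l \<mu>) * ln (sqrt (kappa l \<mu> + 1) * norm (ym1 - y_star f x0) / acc)
      else 2 * sqrt (kappa l \<mu>) * ln (sqrt (kappa l \<mu> + 1) * (acc + kappa l \<mu> * norm (s (t - 1))) / acc)) \<le> real (N t)"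
    and "ilm_step f l \<mu> \<rho> \<epsilon> \<delta> (b t) (if t = 0 then ym1 else y (t - 1)) (N t) (K t)
            (x t) (y t) (lam t) (u t) (s t) (x (Suc t))"
  using run assms unfolding ilm_run_def Let_def by blast+

lemma run_next: "running (Suc t) \<Longrightarrow> x (Suc t) = x t + s t"
  using run_step(2)[of t] by (simp add: ilm_step_def Let_def less_Suc_eq)

lemma run_hess: "running t \<Longrightarrow> spectral_norm (Ht t - hess Pf (x t)) \<le> e2 \<epsilon>"
  using run_step(2)[of t] unfolding ilm_step_def Let_def by blast

lemma run_lanczos: "running t \<Longrightarrow> lanczos_output (Ht t) (b t) (lanczos_budget l \<mu> \<rho> \<epsilon> \<delta> (gt t)) (lam t) (u t)"
  using run_step(2)[of t] unfolding ilm_step_def Let_def by blast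

text \<open>The warm start explains the form of \<open>N t\<close>: the previous inner error is at
  most \<open>acc\<close>, and the maximiser moves by at most \<kappa> times the length of the
  step.\<close>

lemma run_accuracy: "running t \<Longrightarrow> norm (y t - y_star f (x t)) \<le> acc"
proof (induction t)
  case 0
  have "norm (fst (agd f (1 / l) ((sqrt (kappa l \<mu>) - 1) / (sqrt (kappa l \<mu>) + 1)) (x 0) ym1 (N 0)) - y_star f (x 0)) \<le> acc"
    using run_step(1)[OF 0] run_start
    by (intro agd_within[OF inner_accuracy_bounds(1)[OF eps_pos eps_le_1 chi] order_refl]) simp
  then show ?case using run_step(2)[OF 0] by (simp add: ilm_step_def Let_def)
next
  case (Suc t)
  have "norm (y t - y_star f (x (Suc t))) \<le> norm (y t - y_star f (x t)) + norm (y_star f (x t) - y_star f (x (Suc t)))"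
    using norm_triangle_ineq[of "y t - y_star f (x t)" "y_star f (x t) - y_star f (x (Suc t))"] by simp
  also have "\<dots> \<le> acc + kappa l \<mu> * norm (s t)"
    using Suc y_star_lipschitz[of "x t" "x (Suc t)"] run_next[OF Suc.prems] by (intro add_mono) auto
  finally have "norm (fst (agd f (1 / l) ((sqrt (kappa l \<mu>) - 1) / (sqrt (kappa l \<mu>) + 1)) (x (Suc t)) (y t) (N (Suc t)))
      - y_star f (x (Suc t))) \<le> acc"
    using run_step(1)[OF Suc.prems]
    by (intro agd_within[OF inner_accuracy_bounds(1)[OF eps_pos eps_le_1 chi]]) simp_all
  then show ?case using run_step(2)[OF Suc.prems] by (simp add: ilm_step_def Let_def)
qed

lemma run_gradient: assumes "running t" shows "norm (gt t - grad Pf (x t)) \<le> e1 \<epsilon>"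
proof -
  have "norm (gt t - grad Pf (x t)) \<le> l * norm (y t - y_star f (x t))" by (rule grad_max_fun_error)
  also have "\<dots> \<le> l * acc" using run_accuracy[OF assms] l_pos by (intro mult_left_mono) auto
  also have "\<dots> \<le> e1 \<epsilon>" by (rule inner_accuracy_bounds(2)[OF eps_pos eps_le_1 chi])
  finally show ?thesis .
qed

text \<open>The run is thus still active at the first hit, and every constraint of
  \<open>ilm_run\<close> is available up to and including it.\<close>

lemma stopped_imp_hit: "stopped t \<Longrightarrow> hit t"
  by (auto simp: stops_def reaches_target_def curvature_threshold_def max_def split: if_splits)

lemma running_if_not_hit: "(\<And>\<tau>. \<tau> < t \<Longrightarrow> \<not> hit \<tau>) \<Longrightarrow> running t"
  using stopped_imp_hit by blast

definition lanczos_succeeds :: "nat \<Rightarrow> bool" where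
  "lanczos_succeeds t \<longleftrightarrow> lam t \<le> lambda_min (Ht t) + tolt t"

lemma curvature_lower:
  assumes "lanczos_succeeds t"
  shows "(lam t - tolt t) * (v \<bullet> v) \<le> v \<bullet> (Ht t *v v)"
proof -
  have "lambda_min (Ht t) * (v \<bullet> v) \<le> v \<bullet> (Ht t *v v)"
    using lambda_min_symmetric[OF approx_hess_symmetric] by metis
  moreover have "(lam t - tolt t) * (v \<bullet> v) \<le> lambda_min (Ht t) * (v \<bullet> v)"
    using assms by (intro mult_right_mono) (auto simp: lanczos_succeeds_def)
  ultimately show ?thesis by linarith
qed

lemma newton_curvature:
  assumes "lanczos_succeeds t" "\<not> lam t \<le> - tolt t" "\<epsilon> \<le> norm (gt t)"
  shows "- (1/2 * sqrt (M2 * norm (gt t))) * (v \<bullet> v) \<le> v \<bullet> (Ht t *v v)"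
proof -
  have "tolt t = 1/4 * sqrt (M2 * norm (gt t))" using assms(3) by (simp add: curvature_threshold_def)
  then have "- (1/2 * sqrt (M2 * norm (gt t))) * (v \<bullet> v) \<le> (lam t - tolt t) * (v \<bullet> v)"
    using assms(2) by (intro mult_right_mono) auto
  then show ?thesis using curvature_lower[OF assms(1), of v] by linarith
qed

text \<open>Serves twice: the tolerance is met at all, so that the step is the specified one, and
  the first accepted iterate comes after at most \<open>cg_bound \<epsilon>\<close>
  iterations.\<close>

lemma newton_cg:
  assumes "running t" "lanczos_succeeds t" "\<not> lam t \<le> - tolt t" "\<epsilon> \<le> norm (gt t)"
  shows "cg_accepts M2 (Ht t) (gt t) (cg_bound \<epsilon>)"
proof (rule cg_accepts_after[OF approx_hess_symmetric _ M2_pos newton_curvature[OF assms(2-4)]])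
  define ch where "ch = M1 / sqrt (M2 * \<epsilon>)"
  have M2e: "0 < sqrt (M2 * \<epsilon>)" using M2_pos eps_pos by simp
  have ch: "1 \<le> ch" using chi M2e by (simp add: ch_def)
  show "gt t \<noteq> 0" using assms(4) eps_pos by auto
  show up: "spectral_norm (Ht t) \<le> 37/36 * M1"
  proof (rule spectral_norm_le)
    fix v
    have "norm (Ht t *v v) \<le> norm ((Ht t - hess Pf (x t)) *v v) + norm (hess Pf (x t) *v v)"
      using norm_triangle_ineq[of "(Ht t - hess Pf (x t)) *v v" "hess Pf (x t) *v v"]
      by (simp add: matrix_vector_mult_diff_rdistrib)
    also have "\<dots> \<le> M1 / 36 * norm v + M1 * norm v"
    proof (rule add_mono[OF _ hess_max_fun_bound])
      have "norm ((Ht t - hess Pf (x t)) *v v) \<le> spectral_norm (Ht t - hess Pf (x t)) * norm v"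
        by (rule spectral_norm_bound)
      also have "\<dots> \<le> M1 / 36 * norm v"
        using run_hess[OF assms(1)] eps2_bounds(2)[OF eps_pos eps_le_1 chi] by (intro mult_right_mono) auto
      finally show "norm ((Ht t - hess Pf (x t)) *v v) \<le> M1 / 36 * norm v" .
    qed
    finally show "norm (Ht t *v v) \<le> 37/36 * M1 * norm v" by (simp add: algebra_simps)
  qed
  define \<sigma> where "\<sigma> = sqrt (M2 * norm (gt t))"
  have \<sigma>: "sqrt (M2 * \<epsilon>) \<le> \<sigma>" unfolding \<sigma>_def using assms(4) M2_pos by simp
  define k where "k = 2 * (37/36 * M1 + \<sigma>) / \<sigma>"
  have \<sigma>0: "\<sigma> > 0" using \<sigma> M2e by linarith
  have "M1 / \<sigma> \<le> ch" unfolding ch_def using \<sigma> M2e M1_pos by (intro divide_left_mono mult_pos_pos \<sigma>0) auto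
  moreover have "k = 37/18 * (M1 / \<sigma>) + 2" using \<sigma>0 by (simp add: k_def field_simps)
  ultimately have k: "2 \<le> k" "k \<le> 5 * ch" using ch M1_pos \<sigma>0 by auto
  define c where "c = 5 * ch * (5 * ch + 1) * (6 * (5 * ch))\<^sup>2"
  have c: "c > 0" unfolding c_def using ch by (intro mult_pos_pos) auto
  have "k * (k + 1) * (6 * k)\<^sup>2 \<le> c"
    unfolding c_def using k by (intro mult_mono power_mono) auto
  also have "c = exp (ln c)" using c by simp
  also have "\<dots> \<le> exp (real (cg_bound \<epsilon>) / sqrt k)"
  proof -
    have "sqrt (5 * ch) * ln c \<le> real (cg_bound \<epsilon>)"
      unfolding cg_bound_def ch_def[symmetric] c_def[symmetric] by linarith
    moreover have "0 \<le> ln c"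
    proof -
      have "1 * 1 * 1 \<le> c" unfolding c_def using ch by (intro mult_mono one_le_power) auto
      then show ?thesis by simp
    qed
    then have "sqrt k * ln c \<le> sqrt (5 * ch) * ln c" using k by (intro mult_right_mono) auto
    ultimately have "ln c \<le> real (cg_bound \<epsilon>) / sqrt k" using k by (simp add: pos_le_divide_eq mult.commute)
    then show ?thesis by simp
  qed
  finally show "2 * (37/36 * M1 + sqrt (M2 * norm (gt t))) / sqrt (M2 * norm (gt t))
      * (2 * (37/36 * M1 + sqrt (M2 * norm (gt t))) / sqrt (M2 * norm (gt t)) + 1)
      * (6 * (2 * (37/36 * M1 + sqrt (M2 * norm (gt t))) / sqrt (M2 * norm (gt t))))\<^sup>2
      \<le> exp (real (cg_bound \<epsilon>) / sqrt (2 * (37/36 * M1 + sqrt (M2 * norm (gt t))) / sqrt (M2 * norm (gt t))))"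
    unfolding k_def \<sigma>_def .
qed

lemma run_progress:
  assumes next_run: "running (Suc t)" and ok: "lanczos_succeeds t"
  shows "Pf (x (Suc t)) \<le> Pf (x t) - sqrt \<epsilon> ^ 3 / (500 * sqrt M2) \<or>
    (Pf (x (Suc t)) \<le> Pf (x t) \<and> \<epsilon> \<le> norm (gt t) \<and> norm (gt (Suc t)) < norm (gt t) / 2)"
proof -
  have rt: "running t" "\<not> stopped t" using next_run by auto
  note step = run_step(2)[OF rt(1), unfolded ilm_step_def Let_def]
  have out: "norm (u t) = 1" "lam t = u t \<bullet> (Ht t *v u t)"
    using run_lanczos[OF rt(1)] by (auto simp: lanczos_output_def Let_def)
  show ?thesis
  proof (cases "lam t \<le> - tolt t")
    case True
    then have "s t = (1/2 * sqrt (max (norm (gt t)) \<epsilon> / M2)) *\<^sub>R u t" "gt t \<bullet> u t \<le> 0" using step by auto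
    from negative_curvature_descent[OF eps_pos eps_le_1 chi run_gradient[OF rt(1)] run_hess[OF rt(1)] out(1) this(2) _ this(1)]
    show ?thesis using True out(2) run_next[OF next_run] by simp
  next
    case False
    then have ge: "\<epsilon> \<le> norm (gt t)" using rt(2) by (simp add: stops_def)
    have ex: "\<exists>k. cg_accepts M2 (Ht t) (gt t) k" using newton_cg[OF rt(1) ok False ge] by blast
    then have s: "s t = fst (cg (cg_shift M2 (Ht t) (gt t)) (gt t) (cg_iterations M2 (Ht t) (gt t)))"
      using step False ge by auto
    have "cg_accepts M2 (Ht t) (gt t) (cg_iterations M2 (Ht t) (gt t))"
      unfolding cg_iterations_def using ex by (rule LeastI_ex)
    then have res: "norm (gt t + cg_shift M2 (Ht t) (gt t) *v s t)
        \<le> 1/4 * min (norm (gt t)) (1/2 * sqrt (M2 * norm (gt t)) * norm (s t))"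
      by (simp add: cg_accepts_def Let_def s)
    note nd = newton_descent[OF eps_pos eps_le_1 chi run_gradient[OF rt(1)] run_hess[OF rt(1)] ge
        newton_curvature[OF ok False ge] res]
    show ?thesis using nd(1) nd(2)[of "gt (Suc t)"] run_gradient[OF next_run] run_next[OF next_run] ge by auto
  qed
qed

lemma not_hit_bound:
  assumes no_hit: "\<And>t. t < T \<Longrightarrow> \<not> hit t" and ok: "\<And>t. t < T \<Longrightarrow> lanczos_succeeds t"
  shows "real T \<le> iteration_bound \<epsilon> x0"
proof -
  have running: "running t" if "t \<le> T" for t
    using that no_hit by (intro running_if_not_hit) auto
  have gap: "0 \<le> Pf x0 - Pstar" using bounded_below[of x0] by simp
  have "real T \<le> (log 2 (2 * gradient_bound \<epsilon> x0 / \<epsilon>) + 1)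
      * ((Pf (x 0) - Pstar) / (sqrt \<epsilon> ^ 3 / (500 * sqrt M2)) + 1)"
  proof (rule halving_count[where p = "\<lambda>t. Pf (x t)" and \<gamma> = "\<lambda>t. norm (gt t)"])
    show "0 < sqrt \<epsilon> ^ 3 / (500 * sqrt M2)" using eps_pos M2_pos by simp
    show "\<epsilon> \<le> gradient_bound \<epsilon> x0" using gap M1_pos by (simp add: gradient_bound_def)
    show "Pf (x (Suc t)) \<le> Pf (x t) - sqrt \<epsilon> ^ 3 / (500 * sqrt M2) \<or>
        Pf (x (Suc t)) \<le> Pf (x t) \<and> \<epsilon> \<le> norm (gt t) \<and> norm (gt (Suc t)) < norm (gt t) / 2" if "t < T" for t
      using run_progress[of t] running[of "Suc t"] ok[OF that] that by auto
    show "norm (gt t) \<le> gradient_bound \<epsilon> x0" if t: "t \<le> T" and le: "Pf (x t) \<le> Pf (x 0)" for t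
    proof -
      have "(norm (grad Pf (x t)))\<^sup>2 \<le> 2 * M1 * (Pf (x t) - Pstar)" by (rule grad_max_fun_sq)
      also have "\<dots> \<le> 2 * M1 * (Pf x0 - Pstar)" using le M1_pos run_start by (intro mult_left_mono) auto
      finally have "norm (grad Pf (x t)) \<le> sqrt (2 * M1 * (Pf x0 - Pstar))" by (simp add: real_le_rsqrt)
      moreover have "norm (gt t) \<le> norm (gt t - grad Pf (x t)) + norm (grad Pf (x t))"
        using norm_triangle_ineq[of "gt t - grad Pf (x t)" "grad Pf (x t)"] by simp
      ultimately show ?thesis
        using run_gradient[OF running[OF t]] eps1_le[OF eps_pos eps_le_1 chi] eps_pos
        unfolding gradient_bound_def by linarith
    qed
  qed (use eps_pos bounded_below in auto)
  then show ?thesis unfolding iteration_bound_def by (simp only: run_start)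
qed

text \<open>If all of the first \<open>\<lfloor>bound\<rfloor> + 1\<close> iterations missed, the
  run would be active throughout and \<open>not_hit_bound\<close> would put this number below the
  bound. Lanczos success is asked only of active iterations within the bound, which is what the
  union bound can provide.\<close>

lemma hit_exists:
  assumes ok: "\<And>t. real t \<le> iteration_bound \<epsilon> x0 \<Longrightarrow> running t \<Longrightarrow> lanczos_succeeds t"
  obtains T where "hit T" "\<And>t. t < T \<Longrightarrow> \<not> hit t" "real T \<le> iteration_bound \<epsilon> x0"
proof -
  have "\<exists>t. real t \<le> iteration_bound \<epsilon> x0 \<and> hit t"
  proof (rule ccontr)
    assume no: "\<nexists>t. real t \<le> iteration_bound \<epsilon> x0 \<and> hit t"
    have small: "real t \<le> iteration_bound \<epsilon> x0" if "t < nat \<lfloor>iteration_bound \<epsilon> x0\<rfloor> + 1" for t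
      using that iteration_bound_nonneg[OF eps_pos, of x0] by linarith
    have no': "\<not> hit t" if "t < nat \<lfloor>iteration_bound \<epsilon> x0\<rfloor> + 1" for t using no small[OF that] by blast
    have "running t" if "t < nat \<lfloor>iteration_bound \<epsilon> x0\<rfloor> + 1" for t
      using that no' by (intro running_if_not_hit) auto
    then have "real (nat \<lfloor>iteration_bound \<epsilon> x0\<rfloor> + 1) \<le> iteration_bound \<epsilon> x0"
      using no' small ok by (intro not_hit_bound) blast+
    then show False by linarith
  qed
  then obtain t where t: "real t \<le> iteration_bound \<epsilon> x0" "hit t" by blast
  define T where "T = (LEAST t. hit t)"
  have "hit T" "T \<le> t" unfolding T_def using t(2) by (auto intro: LeastI Least_le)
  moreover have "\<not> hit t'" if "t' < T" for t' using that unfolding T_def by (rule not_less_Least)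
  ultimately show ?thesis using that t(1) by auto
qed

text \<open>Error budget: \<open>1 + 1/144 \<le> 2\<close> for the gradient, and for the curvature
  \<open>1/4 + 1/4 + 1/36 \<le> 1\<close> from the target test, the Lanczos tolerance and the
  Hessian error.\<close>

lemma hit_stationary:
  assumes "running t" "hit t" and ok: "lanczos_succeeds t"
  shows "second_order_stationary Pf 2 (sqrt M2) \<epsilon> (x t)"
  unfolding second_order_stationary_def
proof (intro conjI allI max_fun_differentiable grad_max_fun_differentiable)
  have g: "norm (gt t) \<le> \<epsilon>" "- (1/4 * sqrt (M2 * \<epsilon>)) \<le> lam t"
    using assms(2) by (auto simp: reaches_target_def)
  have "norm (grad Pf (x t)) \<le> norm (gt t) + norm (gt t - grad Pf (x t))"
    using norm_triangle_ineq4[of "gt t" "gt t - grad Pf (x t)"] by simp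
  then show "norm (grad Pf (x t)) \<le> 2 * \<epsilon>"
    using g(1) run_gradient[OF assms(1)] eps1_le[OF eps_pos eps_le_1 chi] eps_pos by linarith
  fix v :: "real^'n"
  have tol: "tolt t = 1/4 * sqrt (M2 * \<epsilon>)" using g(1) by (simp add: curvature_threshold_def max_def)
  have "- (sqrt (M2 * \<epsilon>) / 2) * (v \<bullet> v) \<le> (lam t - tolt t) * (v \<bullet> v)"
    using g(2) tol by (intro mult_right_mono) auto
  also have "\<dots> \<le> v \<bullet> (Ht t *v v)" by (rule curvature_lower[OF ok])
  also have "\<dots> \<le> v \<bullet> (hess Pf (x t) *v v) + e2 \<epsilon> * (v \<bullet> v)"
    using quadratic_perturbation[OF run_hess[OF assms(1)], of v] by (simp add: abs_le_iff)
  finally have "- (sqrt (M2 * \<epsilon>) / 2) * (v \<bullet> v) - e2 \<epsilon> * (v \<bullet> v) \<le> v \<bullet> (hess Pf (x t) *v v)" by simp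
  moreover have "e2 \<epsilon> * (v \<bullet> v) = sqrt (M2 * \<epsilon>) * (v \<bullet> v) / 36" using eps_pos by (simp add: eps2_eq real_sqrt_mult)
  moreover have "0 \<le> sqrt (M2 * \<epsilon>) * (v \<bullet> v)" using M2_pos eps_pos by simp
  ultimately have "- (sqrt (M2 * \<epsilon>) * (v \<bullet> v)) \<le> v \<bullet> (hess Pf (x t) *v v)" by linarith
  then show "- sqrt M2 * sqrt \<epsilon> * (v \<bullet> v) \<le> v \<bullet> (hess Pf (x t) *v v)"
    by (simp add: real_sqrt_mult)
qed

lemma lanczos_budget_le:
  fixes g :: "real^'n"
  assumes \<delta>: "0 < \<delta>" "\<delta> \<le> 1"
  shows "lanczos_budget l \<mu> \<rho> \<epsilon> \<delta> g \<le> lanczos_bound \<epsilon> \<delta>"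
  unfolding lanczos_budget_def lanczos_bound_def
proof (rule lanczos_steps_le[OF _ \<delta>(1)])
  define ch where "ch = M1 / sqrt (M2 * \<epsilon>)"
  have M2e: "0 < sqrt (M2 * \<epsilon>)" using M2_pos eps_pos by simp
  have ch: "1 \<le> ch" using chi M2e by (simp add: ch_def)
  define tol where "tol = curvature_threshold M2 \<epsilon> g"
  have "sqrt (M2 * \<epsilon>) \<le> sqrt (M2 * max (norm g) \<epsilon>)" using M2_pos by simp
  then have tol: "sqrt (M2 * \<epsilon>) / 4 \<le> tol" by (simp add: tol_def curvature_threshold_def)
  then show tol0: "0 < curvature_threshold M2 \<epsilon> g" using M2e unfolding tol_def by linarith
  define B where "B = M1 + e2 \<epsilon>"
  have B: "0 < B" "B \<le> 37/36 * M1"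
    using eps2_bounds[OF eps_pos eps_le_1 chi] M1_pos by (auto simp: B_def)
  define k where "k = max 1 (4 * B / tol)"
  have "4 * B / tol \<le> 4 * (37/36 * M1) / (sqrt (M2 * \<epsilon>) / 4)"
    using B tol M2e M1_pos by (intro frac_le) auto
  also have "\<dots> \<le> 17 * ch" using ch by (simp add: ch_def)
  finally have k: "1 \<le> k" "k \<le> 17 * ch" using ch by (auto simp: k_def)
  define d where "d = 96 * real CARD('n) / \<delta>\<^sup>2"
  have n1: "1 \<le> real CARD('n)" using zero_less_card_finite[where 'a='n] by (simp add: Suc_leI del: zero_less_card_finite)
  have d1: "1 \<le> d"
  proof -
    have "\<delta>\<^sup>2 \<le> 1" using \<delta> by (simp add: power_le_one)
    then have "\<delta>\<^sup>2 \<le> 96 * real CARD('n)" using n1 by linarith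
    then show ?thesis unfolding d_def using \<delta> by (simp add: pos_le_divide_eq)
  qed
  define c where "c = 17 * ch * (17 * ch + 1) * d"
  have "1 * 1 * 1 \<le> c" unfolding c_def using ch d1 by (intro mult_mono) auto
  then have c: "1 \<le> c" by simp
  define m where "m = nat \<lceil>sqrt (17 * ch) * ln c\<rceil>"
  have "k * (k + 1) * d \<le> c"
    unfolding c_def using k d1 by (intro mult_mono) auto
  also have "c = exp (ln c)" using c by simp
  also have "\<dots> \<le> exp (real m / sqrt k)"
  proof -
    have "sqrt (17 * ch) * ln c \<le> real m" unfolding m_def by linarith
    moreover have "sqrt k * ln c \<le> sqrt (17 * ch) * ln c" using k c by (intro mult_right_mono) auto
    ultimately have "ln c \<le> real m / sqrt k" using k by (simp add: pos_le_divide_eq mult.commute)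
    then show ?thesis by simp
  qed
  finally show "max 1 (4 * (M1 + e2 \<epsilon>) / curvature_threshold M2 \<epsilon> g)
      * (max 1 (4 * (M1 + e2 \<epsilon>) / curvature_threshold M2 \<epsilon> g) + 1) * (96 * real CARD('n) / \<delta>\<^sup>2)
      \<le> exp (real (nat \<lceil>sqrt (17 * (M1 / sqrt (M2 * \<epsilon>))) *
          ln (17 * (M1 / sqrt (M2 * \<epsilon>)) * (17 * (M1 / sqrt (M2 * \<epsilon>)) + 1) * (96 * real CARD('n) / \<delta>\<^sup>2))\<rceil>)
        / sqrt (max 1 (4 * (M1 + e2 \<epsilon>) / curvature_threshold M2 \<epsilon> g)))"
    unfolding k_def tol_def B_def m_def c_def d_def ch_def .
qed

lemma product_count:
  fixes Kmax :: real
  assumes \<delta>: "0 < \<delta>" "\<delta> \<le> 1" and K: "\<And>t. real (K t) \<le> Kmax"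
    and no_hit: "\<And>t. t < T \<Longrightarrow> \<not> hit t" and ok: "\<And>t. t < T \<Longrightarrow> lanczos_succeeds t"
  shows "real (hessian_vector_products f l \<mu> \<rho> \<epsilon> \<delta> K x y lam T)
    \<le> (real T + 1) * (Kmax + 3) * (real (lanczos_bound \<epsilon> \<delta>) + real (cg_bound \<epsilon>))"
proof -
  define A where "A = (\<lambda>t. (K t + 3) * lanczos_budget l \<mu> \<rho> \<epsilon> \<delta> (gt t))"
  define B where "B = (\<lambda>t. if \<not> lam t \<le> - tolt t \<and> norm (gt t) \<ge> \<epsilon>
      then (K t + 3) * cg_iterations M2 (Ht t) (gt t) else 0)"
  have Kmax: "0 \<le> Kmax" using K[of 0] of_nat_0_le_iff order_trans by blast
  have "real (A t) \<le> (Kmax + 3) * real (lanczos_bound \<epsilon> \<delta>)" for t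
    unfolding A_def using K[of t] lanczos_budget_le[OF \<delta>, of "gt t"] Kmax
    by (simp only: of_nat_mult of_nat_add of_nat_numeral) (intro mult_mono, auto)
  then have "(\<Sum>t\<le>T. real (A t)) \<le> (\<Sum>t\<le>T. (Kmax + 3) * real (lanczos_bound \<epsilon> \<delta>))" by (intro sum_mono) auto
  then have 1: "(\<Sum>t\<le>T. real (A t)) \<le> (real T + 1) * ((Kmax + 3) * real (lanczos_bound \<epsilon> \<delta>))" by (simp add: add.commute)
  have "real (B t) \<le> (Kmax + 3) * real (cg_bound \<epsilon>)" if t: "t < T" for t
  proof (cases "\<not> lam t \<le> - tolt t \<and> norm (gt t) \<ge> \<epsilon>")
    case True
    have "running t" using t no_hit by (intro running_if_not_hit) auto
    then have "cg_accepts M2 (Ht t) (gt t) (cg_bound \<epsilon>)" using True ok[OF t] by (intro newton_cg) auto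
    then have "cg_iterations M2 (Ht t) (gt t) \<le> cg_bound \<epsilon>" unfolding cg_iterations_def by (rule Least_le)
    then show ?thesis using True K[of t] Kmax
      by (simp only: B_def if_True simp_thms of_nat_mult of_nat_add of_nat_numeral) (intro mult_mono, auto)
  next
    case False
    then have "B t = 0" by (auto simp: B_def)
    then show ?thesis using Kmax by simp
  qed
  then have "(\<Sum>t<T. real (B t)) \<le> (\<Sum>t<T. (Kmax + 3) * real (cg_bound \<epsilon>))" by (intro sum_mono) auto
  also have "\<dots> = real T * ((Kmax + 3) * real (cg_bound \<epsilon>))" by simp
  also have "\<dots> \<le> (real T + 1) * ((Kmax + 3) * real (cg_bound \<epsilon>))" using Kmax by (intro mult_right_mono) auto
  finally have "real ((\<Sum>t\<le>T. A t) + (\<Sum>t<T. B t))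
      \<le> (real T + 1) * ((Kmax + 3) * real (lanczos_bound \<epsilon> \<delta>)) + (real T + 1) * ((Kmax + 3) * real (cg_bound \<epsilon>))"
    using 1 by simp
  then show ?thesis
    unfolding hessian_vector_products_def Let_def A_def B_def by (simp add: algebra_simps)
qed

end
end
end

section \<open>Soft-O bookkeeping\<close>

lemma ln_le_exponent:
  fixes c :: real
  assumes "0 < c" "c \<le> 2 ^ k"
  shows "ln c \<le> real k"
proof -
  have "ln c \<le> ln (2 ^ k :: real)" using assms by simp
  also have "\<dots> = real k * ln 2" by (simp add: ln_realpow)
  also have "\<dots> \<le> real k * 1" by (intro mult_left_mono) (use ln_2_less_1 in auto)
  finally show ?thesis by simp
qed

lemma ln_add_one_le: "0 < z \<Longrightarrow> ln (1 + z) \<le> 1 + \<bar>ln z\<bar>" for z :: real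
proof (cases "z \<le> 1")
  case True
  assume z: "0 < z"
  then have "ln (1 + z) \<le> ln 2" using True by simp
  then show ?thesis using ln_2_less_1 by simp
next
  case False
  then have "ln (1 + z) \<le> ln (2 * z)" by simp
  also have "\<dots> = ln 2 + ln z" using False by (simp add: ln_mult)
  finally show ?thesis using ln_2_less_1 by simp
qed

context
  fixes n :: nat and l \<mu> \<rho> \<Delta> \<epsilon> p :: real
  assumes n: "1 \<le> n" and \<mu>: "0 < \<mu>" "\<mu> \<le> l" and \<rho>: "0 < \<rho>" and \<Delta>: "0 \<le> \<Delta>"
    and \<epsilon>: "0 < \<epsilon>" "\<epsilon> \<le> 1" and p: "0 < p" "p < 1"
    and chi: "sqrt (L2 l \<mu> \<rho> * \<epsilon>) \<le> L1 l \<mu>" and small: "\<epsilon> powr (3/2) \<le> sqrt (L2 l \<mu> \<rho>)"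
begin

private definition "\<Lambda> = log_factor n l \<mu> \<rho> \<Delta> \<epsilon> p"
private definition "m1 = L1 l \<mu>"
private definition "m2 = L2 l \<mu> \<rho>"
private definition "kp = kappa l \<mu>"
text \<open>\<open>ch\<close> is the order of the condition numbers in both Krylov methods;
  \<open>X\<close> is, up to the factor 500, the reciprocal of the guaranteed decrease.\<close>

private definition "ch = m1 / sqrt (m2 * \<epsilon>)"
private definition "X = sqrt m2 / sqrt \<epsilon> ^ 3"
private definition "lk = ln (1 + kp)"

private lemma l: "0 < l" using \<mu> by simp
private lemma kp: "1 \<le> kp" using \<mu> by (simp add: kp_def kappa_def)
private lemma m: "0 < m1" "0 < m2"
  using kp l \<rho> by (simp_all add: m1_def m2_def L1_def L2_def kp_def)

private lemma ch1: "1 \<le> ch" unfolding ch_def using chi m \<epsilon> by (simp add: m1_def m2_def)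
private lemma X1: "1 \<le> X" unfolding X_def using small \<epsilon> by (simp add: m2_def powr_three_halves)

text \<open>Hides the absolute value, so that linear arithmetic sees an atom governed by the two
  inequalities in \<open>lam_parts\<close>.\<close>

private definition "abs_ln z = \<bar>ln z\<bar>" for z :: real

private lemma lam_parts:
  "\<Lambda> = 1 + ln (real n) + abs_ln l + abs_ln \<mu> + abs_ln \<rho> + ln (1 + \<Delta>) + abs_ln \<epsilon> + ln (1 / p)"
  "0 \<le> ln (real n)" "0 \<le> ln (1 + \<Delta>)" "0 \<le> ln (1 / p)"
  "ln l \<le> abs_ln l" "- ln l \<le> abs_ln l" "ln \<mu> \<le> abs_ln \<mu>" "- ln \<mu> \<le> abs_ln \<mu>"
  "ln \<rho> \<le> abs_ln \<rho>" "- ln \<rho> \<le> abs_ln \<rho>" "ln \<epsilon> \<le> abs_ln \<epsilon>" "- ln \<epsilon> \<le> abs_ln \<epsilon>"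
  using n \<Delta> p by (simp_all add: \<Lambda>_def log_factor_def abs_ln_def)

private lemma lam1: "1 \<le> \<Lambda>" using lam_parts by linarith

private lemma lk: "0 \<le> lk" "lk \<le> 1 + ln l - ln \<mu>"
proof -
  show "0 \<le> lk" using kp by (simp add: lk_def)
  have "lk \<le> ln (2 * kp)" unfolding lk_def using kp by simp
  also have "\<dots> = ln 2 + (ln l - ln \<mu>)" using kp \<mu> l by (simp add: ln_mult kp_def kappa_def ln_div)
  finally show "lk \<le> 1 + ln l - ln \<mu>" using ln_2_less_1 by simp
qed

private lemma ln_m: "ln m1 = lk + ln l" "ln m2 = ln \<rho> + 3 * lk"
  using kp l \<rho> by (simp_all add: m1_def m2_def L1_def L2_def kp_def[symmetric] lk_def ln_mult ln_realpow add.commute)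

private lemma ln_ch: "ln ch \<le> \<Lambda>"
proof -
  have "ln ch = ln m1 - (ln m2 + ln \<epsilon>) / 2"
    using m \<epsilon> by (simp add: ch_def ln_div ln_sqrt ln_mult)
  also have "\<dots> = ln l - lk / 2 + (- ln \<rho> / 2) + (- ln \<epsilon> / 2)" unfolding ln_m by (simp add: field_simps)
  also have "\<dots> \<le> abs_ln l + abs_ln \<rho> + abs_ln \<epsilon>" using lk(1) lam_parts(5-12) by linarith
  also have "\<dots> \<le> \<Lambda>" using lam_parts by linarith
  finally show ?thesis .
qed

private lemma ln_X: "ln X \<le> 2 * \<Lambda>"
proof -
  have "ln X = ln m2 / 2 - 3 * (ln \<epsilon> / 2)"
    using m \<epsilon> by (simp add: X_def ln_div ln_sqrt ln_realpow)
  then show ?thesis using ln_m lk lam_parts by linarith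
qed

private definition "G = sqrt (2 * m1 * \<Delta>) + \<epsilon>"
private definition "ib = (log 2 (2 * G / \<epsilon>) + 1) * (\<Delta> / (sqrt \<epsilon> ^ 3 / (500 * sqrt m2)) + 1)"

private lemma log_G: "0 \<le> log 2 (2 * G / \<epsilon>)" "log 2 (2 * G / \<epsilon>) + 1 \<le> 8 * \<Lambda>"
proof -
  define z where "z = 2 * m1 * \<Delta>"
  have z: "0 \<le> z" using m \<Delta> by (simp add: z_def)
  have "2 * sqrt z \<le> 1 + z"
  proof -
    have "0 \<le> (sqrt z - 1)\<^sup>2" by simp
    then show ?thesis using z by (simp add: power2_diff)
  qed
  then have "2 * G \<le> 1 + z + 2" using \<epsilon> by (simp add: G_def z_def)
  also have "\<dots> \<le> 3 * ((1 + m1) * (1 + \<Delta>))" using m \<Delta> by (simp add: z_def algebra_simps)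
  finally have "2 * G / \<epsilon> \<le> 3 * ((1 + m1) * (1 + \<Delta>)) / \<epsilon>" using \<epsilon> by (intro divide_right_mono) auto
  moreover have "1 \<le> 2 * G / \<epsilon>" using z \<epsilon> by (simp add: G_def z_def field_simps)
  ultimately have "ln (2 * G / \<epsilon>) \<le> ln (3 * ((1 + m1) * (1 + \<Delta>)) / \<epsilon>)" by (intro ln_mono) auto
  also have "\<dots> = ln 3 + (ln (1 + m1) + ln (1 + \<Delta>)) - ln \<epsilon>"
    using m \<Delta> \<epsilon> by (simp add: ln_div ln_mult)
  also have "\<dots> \<le> 2 + (1 + \<bar>ln m1\<bar> + ln (1 + \<Delta>)) - ln \<epsilon>"
    using ln_add_one_le[OF m(1)] ln_le_exponent[of 3 2] by simp
  also have "\<dots> \<le> 4 * \<Lambda>" using ln_m lk lam_parts by linarith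
  finally have le: "ln (2 * G / \<epsilon>) \<le> 4 * \<Lambda>" .
  show "0 \<le> log 2 (2 * G / \<epsilon>)" using \<open>1 \<le> 2 * G / \<epsilon>\<close> by simp
  have "log 2 (2 * G / \<epsilon>) = ln (2 * G / \<epsilon>) / ln 2" by (simp add: log_def)
  also have "\<dots> \<le> 4 * \<Lambda> / (2/3)"
    using le \<open>1 \<le> 2 * G / \<epsilon>\<close> ln2_ge_two_thirds lam1 by (intro frac_le) auto
  finally show "log 2 (2 * G / \<epsilon>) + 1 \<le> 8 * \<Lambda>" using lam1 by simp
qed

text \<open>\<open>8 * 500 = 4000\<close>; the value 4096 leaves room for the summand 2 and is a
  power of two, which helps with its logarithm in \<open>ln_delta\<close>.\<close>

private lemma ib: "0 \<le> ib" "ib + 2 \<le> 4096 * (\<Lambda> * ((1 + \<Delta>) * X))"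
proof -
  have eq: "\<Delta> / (sqrt \<epsilon> ^ 3 / (500 * sqrt m2)) = 500 * X * \<Delta>" by (simp add: X_def)
  show "0 \<le> ib" unfolding ib_def eq using log_G X1 \<Delta> by (intro mult_nonneg_nonneg add_nonneg_nonneg) auto
  have "ib \<le> (8 * \<Lambda>) * (500 * X * \<Delta> + 1)"
    unfolding ib_def eq using log_G X1 \<Delta> by (intro mult_right_mono) auto
  also have "\<dots> \<le> (8 * \<Lambda>) * (500 * ((1 + \<Delta>) * X))"
    using X1 lam1 by (intro mult_left_mono) (auto simp: algebra_simps)
  finally have "ib \<le> 4000 * (\<Lambda> * ((1 + \<Delta>) * X))" by simp
  moreover have "1 * (1 * 1) \<le> \<Lambda> * ((1 + \<Delta>) * X)" using lam1 X1 \<Delta> by (intro mult_mono) auto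
  ultimately show "ib + 2 \<le> 4096 * (\<Lambda> * ((1 + \<Delta>) * X))" by simp
qed

text \<open>Shares \<open>p\<close> among at most \<open>ib + 1\<close> iterations.\<close>

private definition "\<delta> = p / (ib + 2)"

private lemma \<delta>: "0 < \<delta>" "\<delta> < 1" using p ib(1) by (simp_all add: \<delta>_def field_simps)

private lemma ln_delta: "- ln \<delta> \<le> 16 * \<Lambda>"
proof -
  have "- ln \<delta> = ln (ib + 2) + ln (1 / p)" using p ib(1) by (simp add: \<delta>_def ln_div)
  moreover have "ln (ib + 2) \<le> ln (4096 * (\<Lambda> * ((1 + \<Delta>) * X)))"
    using ib lam1 X1 \<Delta> by simp
  moreover have "ln (4096 * (\<Lambda> * ((1 + \<Delta>) * X))) = ln 4096 + (ln \<Lambda> + (ln (1 + \<Delta>) + ln X))"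
    using lam1 X1 \<Delta> by (simp add: ln_mult)
  moreover have "ln (4096::real) \<le> 12" using ln_le_exponent[of 4096 12] by simp
  moreover have "ln \<Lambda> \<le> \<Lambda> - 1" using lam1 by (intro ln_le_minus_one) auto
  ultimately show ?thesis using ln_X lam_parts lam1 by linarith
qed

private definition "LB = Suc (nat \<lceil>sqrt (17 * ch) * ln (17 * ch * (17 * ch + 1) * (96 * real n / \<delta>\<^sup>2))\<rceil>)"
private definition "CB = nat \<lceil>sqrt (5 * ch) * ln (5 * ch * (5 * ch + 1) * (6 * (5 * ch))\<^sup>2)\<rceil>"

private lemma LB: "real LB \<le> 400 * (\<Lambda> * sqrt ch)"
proof -
  define c where "c = 17 * ch * (17 * ch + 1) * (96 * real n / \<delta>\<^sup>2)"
  \<comment> \<open>\<open>1632 = 17 * 96\<close>; the failure probability of a single Lanczos call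
    enters through the last term.\<close>
  have "ln c = ln 1632 + ln ch + ln (17 * ch + 1) + ln (real n) - 2 * ln \<delta>"
    unfolding c_def using ch1 \<delta> n by (simp add: ln_mult ln_div ln_realpow)
  moreover have "ln (17 * ch + 1) \<le> ln (18 * ch)" using ch1 by simp
  moreover have "ln (18 * ch) = ln 18 + ln ch" using ch1 by (simp add: ln_mult)
  moreover have "ln (1632::real) \<le> 11" "ln (18::real) \<le> 5"
    using ln_le_exponent[of 1632 11] ln_le_exponent[of 18 5] by simp_all
  ultimately have c: "ln c \<le> 52 * \<Lambda>" using ln_ch ln_delta lam_parts lam1 by linarith
  have s: "sqrt (17 * ch) \<le> 5 * sqrt ch" using ch1 by (simp add: real_sqrt_mult real_le_lsqrt)
  have one: "1 * 1 \<le> \<Lambda> * sqrt ch" using lam1 ch1 by (intro mult_mono) auto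
  have "sqrt (17 * ch) * ln c \<le> sqrt (17 * ch) * (52 * \<Lambda>)" using c ch1 by (intro mult_left_mono) auto
  also have "\<dots> \<le> (5 * sqrt ch) * (52 * \<Lambda>)" using s lam1 by (intro mult_right_mono) auto
  finally have "sqrt (17 * ch) * ln c \<le> 260 * (\<Lambda> * sqrt ch)" by (simp add: mult_ac)
  then show ?thesis unfolding LB_def c_def[symmetric] using one by linarith
qed

private lemma CB: "real CB \<le> 100 * (\<Lambda> * sqrt ch)"
proof -
  define c where "c = 5 * ch * (5 * ch + 1) * (6 * (5 * ch))\<^sup>2"
  have "ln c = ln 4500 + ln ch + ln (5 * ch + 1) + 2 * ln ch"
    unfolding c_def using ch1 by (simp add: ln_mult ln_realpow)
  moreover have "ln (5 * ch + 1) \<le> ln (6 * ch)" using ch1 by simp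
  moreover have "ln (6 * ch) = ln 6 + ln ch" using ch1 by (simp add: ln_mult)
  moreover have "ln (4500::real) \<le> 13" "ln (6::real) \<le> 3"
    using ln_le_exponent[of 4500 13] ln_le_exponent[of 6 3] by simp_all
  ultimately have c: "ln c \<le> 20 * \<Lambda>" using ln_ch lam1 by linarith
  have s: "sqrt (5 * ch) \<le> 3 * sqrt ch" using ch1 by (simp add: real_sqrt_mult real_le_lsqrt)
  have one: "1 * 1 \<le> \<Lambda> * sqrt ch" using lam1 ch1 by (intro mult_mono) auto
  have "sqrt (5 * ch) * ln c \<le> sqrt (5 * ch) * (20 * \<Lambda>)" using c ch1 by (intro mult_left_mono) auto
  also have "\<dots> \<le> (3 * sqrt ch) * (20 * \<Lambda>)" using s lam1 by (intro mult_right_mono) auto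
  finally have "sqrt (5 * ch) * ln c \<le> 60 * (\<Lambda> * sqrt ch)" by (simp add: mult_ac)
  then show ?thesis unfolding CB_def c_def[symmetric] using one by linarith
qed

private definition "tgt = l powr (9/4) * \<rho> powr (1/4) * \<mu> powr (- 7/4) * \<epsilon> powr (- 7/4)"

text \<open>Fourth powers turn the comparison of fractional powers into \<open>(1 + kp)\<^sup>5 \<le> 32 kp\<^sup>5\<close>.\<close>

private lemma rate: "X * sqrt kp * sqrt ch \<le> 4 * tgt"
proof -
  have tgt0: "0 \<le> tgt" by (simp add: tgt_def)
  have "tgt ^ 4 = l ^ 9 * \<rho> * (1 / \<mu> ^ 7) * (1 / \<epsilon> ^ 7)"
  proof -
    have pow: "(z powr r) ^ 4 = z powr (4 * r)" if "0 < z" for z r :: real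
      using that by (simp add: powr_realpow[symmetric] powr_powr mult.commute)
    have "l powr 9 = l ^ 9" "\<mu> powr (-7) = 1 / \<mu> ^ 7" "\<epsilon> powr (-7) = 1 / \<epsilon> ^ 7" "\<rho> powr 1 = \<rho>"
      using l \<mu> \<epsilon> \<rho> by (simp_all add: powr_minus_divide)
    then show ?thesis unfolding tgt_def power_mult_distrib using l \<mu> \<epsilon> \<rho> by (simp add: pow)
  qed
  moreover have "(X * sqrt kp * sqrt ch) ^ 4 = \<rho> * (1 + kp) ^ 5 * kp\<^sup>2 * l\<^sup>2 / \<epsilon> ^ 7"
  proof -
    have sq4: "sqrt z ^ 4 = z\<^sup>2" if "0 \<le> z" for z :: real
      using that by (metis numeral_Bit0_eq_double power_mult real_sqrt_pow2 mult_2)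
    have X4: "X ^ 4 = m2\<^sup>2 / \<epsilon> ^ 6"
    proof -
      have "(sqrt \<epsilon> ^ 3) ^ 4 = (sqrt \<epsilon> ^ 4) ^ 3" by (simp only: power_mult[symmetric] mult.commute)
      then show ?thesis using m \<epsilon> by (simp add: X_def power_divide sq4 power_mult[symmetric])
    qed
    have ch2: "ch\<^sup>2 = m1\<^sup>2 / (m2 * \<epsilon>)" using m \<epsilon> by (simp add: ch_def power_divide)
    have "(X * sqrt kp * sqrt ch) ^ 4 = m2\<^sup>2 / \<epsilon> ^ 6 * kp\<^sup>2 * (m1\<^sup>2 / (m2 * \<epsilon>))"
      using kp ch1 by (simp add: power_mult_distrib X4 sq4 ch2)
    also have "\<dots> = m2 * m1\<^sup>2 * kp\<^sup>2 / \<epsilon> ^ 7"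
      using m \<epsilon> by (simp add: field_simps power2_eq_square power_numeral_reduce)
    also have "m2 * m1\<^sup>2 = \<rho> * (1 + kp) ^ 5 * l\<^sup>2"
      by (simp add: m1_def m2_def L1_def L2_def kp_def[symmetric] power_mult_distrib add.commute[of kp]
          power2_eq_square power3_eq_cube power_numeral_reduce mult_ac)
    finally show ?thesis by (simp add: mult_ac)
  qed
  moreover have "\<rho> * (1 + kp) ^ 5 * kp\<^sup>2 * l\<^sup>2 / \<epsilon> ^ 7 \<le> \<rho> * (2 * kp) ^ 5 * kp\<^sup>2 * l\<^sup>2 / \<epsilon> ^ 7"
    using kp \<rho> \<epsilon> by (intro divide_right_mono mult_right_mono mult_left_mono power_mono) auto
  moreover have "\<rho> * (2 * kp) ^ 5 * kp\<^sup>2 * l\<^sup>2 / \<epsilon> ^ 7 = 32 * (l ^ 9 * \<rho> * (1 / \<mu> ^ 7) * (1 / \<epsilon> ^ 7))"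
    using \<mu> \<epsilon> by (simp add: kp_def kappa_def field_simps power2_eq_square power_numeral_reduce)
  moreover have "0 \<le> tgt ^ 4" using tgt0 by simp
  ultimately have "(X * sqrt kp * sqrt ch) ^ 4 \<le> 256 * tgt ^ 4" by linarith
  also have "\<dots> = (4 * tgt) ^ 4" by (simp add: power_mult_distrib)
  finally have "(X * sqrt kp * sqrt ch) ^ 4 \<le> (4 * tgt) ^ 4" .
  moreover have "0 \<le> X * sqrt kp * sqrt ch" using X1 kp ch1 by simp
  ultimately show ?thesis using tgt0 by (subst (asm) power_mono_iff) auto
qed

text \<open>One power of the logarithmic factor comes from the iteration count, one from the Krylov
  methods and \<open>a\<close> from the Chebyshev terms. The constants multiply to
  \<open>4096 * 3 * 500 * 4\<close>, well below \<open>10 ^ 15\<close>.\<close>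

private lemma total:
  assumes c: "0 < c"
  shows "(ib + 1) * (c * sqrt kp * \<Lambda> ^ a + 3) * (real LB + real CB)
    \<le> 10 ^ 15 * (1 + \<Delta>) * (1 + c) * \<Lambda> ^ (a + 3) * tgt"
proof -
  have La: "1 \<le> \<Lambda> ^ a" using lam1 by (rule one_le_power)
  have "1 * 1 \<le> sqrt kp * \<Lambda> ^ a" using kp La by (intro mult_mono) auto
  then have K: "c * sqrt kp * \<Lambda> ^ a + 3 \<le> 3 * (1 + c) * (sqrt kp * \<Lambda> ^ a)"
  proof -
    assume h: "1 * 1 \<le> sqrt kp * \<Lambda> ^ a"
    have "0 \<le> c * (sqrt kp * \<Lambda> ^ a)" using c kp La by (intro mult_nonneg_nonneg) auto
    then show ?thesis using h by (simp add: algebra_simps)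
  qed
  have "(ib + 1) * (c * sqrt kp * \<Lambda> ^ a + 3) * (real LB + real CB)
      \<le> (4096 * (\<Lambda> * ((1 + \<Delta>) * X))) * (3 * (1 + c) * (sqrt kp * \<Lambda> ^ a)) * (500 * (\<Lambda> * sqrt ch))"
    using ib K LB CB c kp La X1 \<Delta> lam1 ch1 by (intro mult_mono) auto
  also have "\<dots> = 6144000 * ((1 + \<Delta>) * (1 + c) * \<Lambda> ^ (a + 2)) * (X * sqrt kp * sqrt ch)"
    by (simp add: power_add power2_eq_square mult_ac)
  also have "\<dots> \<le> 6144000 * ((1 + \<Delta>) * (1 + c) * \<Lambda> ^ (a + 2)) * (4 * tgt)"
    using c \<Delta> lam1 by (intro mult_left_mono rate) auto
  also have "\<dots> \<le> 6144000 * ((1 + \<Delta>) * (1 + c) * \<Lambda> ^ (a + 3)) * (4 * tgt)"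
    using c \<Delta> lam1 by (intro mult_right_mono mult_left_mono power_increasing) (auto simp: tgt_def)
  also have "\<dots> = 24576000 * ((1 + \<Delta>) * (1 + c) * \<Lambda> ^ (a + 3) * tgt)" by simp
  also have "\<dots> \<le> 10 ^ 15 * ((1 + \<Delta>) * (1 + c) * \<Lambda> ^ (a + 3) * tgt)"
    using c \<Delta> lam1 by (intro mult_right_mono mult_nonneg_nonneg) (auto simp: tgt_def)
  finally show ?thesis by (simp only: mult.assoc)
qed

lemmas complexity_bound = total[unfolded LB_def CB_def \<delta>_def ib_def G_def ch_def m1_def m2_def kp_def \<Lambda>_def tgt_def]

end

section \<open>The random process\<close>

context minimax_problem
begin

text \<open>Outside the bad events up to the iteration bound, Lanczos succeeds at every active
  iteration, and the deterministic analysis of a trajectory applies sample by sample.\<close>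

lemma process_bound:
  fixes M :: "'w measure" and F :: "nat \<Rightarrow> 'w measure" and b x u s :: "nat \<Rightarrow> 'w \<Rightarrow> real^'n"
    and y :: "nat \<Rightarrow> 'w \<Rightarrow> real^'m" and N K :: "nat \<Rightarrow> 'w \<Rightarrow> nat" and lam :: "nat \<Rightarrow> 'w \<Rightarrow> real"
  assumes \<epsilon>: "0 < \<epsilon>" "\<epsilon> \<le> 1" "sqrt (M2 * \<epsilon>) \<le> M1" and \<delta>: "0 < \<delta>" "\<delta> \<le> 1"
    and proc: "ilm_process f l \<mu> \<rho> \<epsilon> \<delta> x0 ym1 M F b N K x y lam u s"
    and K: "\<And>t \<omega>. \<omega> \<in> space M \<Longrightarrow> real (K t \<omega>) \<le> Kmax"
    and fail: "(iteration_bound \<epsilon> x0 + 1) * \<delta> \<le> p"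
    and cost: "(iteration_bound \<epsilon> x0 + 1) * (Kmax + 3) * (real (lanczos_bound \<epsilon> \<delta>) + real (cg_bound \<epsilon>)) \<le> C"
  shows "\<exists>E\<in>sets M. measure M E \<ge> 1 - p \<and> (\<forall>\<omega>\<in>E. \<exists>T.
      (let hit = (\<lambda>t. reaches_target M2 \<epsilon> (grad_x f (x t \<omega>) (y t \<omega>)) (lam t \<omega>))
       in hit T \<and> (\<forall>t<T. \<not> hit t)) \<and>
      second_order_stationary Pf 2 (sqrt M2) \<epsilon> (x T \<omega>) \<and>
      real (hessian_vector_products f l \<mu> \<rho> \<epsilon> \<delta> (\<lambda>t. K t \<omega>) (\<lambda>t. x t \<omega>) (\<lambda>t. y t \<omega>) (\<lambda>t. lam t \<omega>) T) \<le> C)"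
proof -
  have prob: "prob_space M" and sub: "\<And>t. subalgebra M (F t)"
    and meas: "\<And>t. x t \<in> borel_measurable (F t)" "\<And>t. y t \<in> borel_measurable (F t)"
      "\<And>t. K t \<in> measurable (F t) (count_space UNIV)" "\<And>t. b t \<in> borel_measurable (F (Suc t))"
    and dist: "\<And>t. distr M borel (b t) = uniform_sphere"
    and ind: "\<And>t. prob_space.indep_set M (sets (F t)) {b t -` B \<inter> space M | B. B \<in> sets borel}"
    and run: "AE \<omega> in M. ilm_run f l \<mu> \<rho> \<epsilon> \<delta> x0 ym1 (\<lambda>t. b t \<omega>) (\<lambda>t. N t \<omega>) (\<lambda>t. K t \<omega>)
        (\<lambda>t. x t \<omega>) (\<lambda>t. y t \<omega>) (\<lambda>t. lam t \<omega>) (\<lambda>t. u t \<omega>) (\<lambda>t. s t \<omega>)"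
    using proc unfolding ilm_process_def by auto
  interpret M: prob_space M by (rule prob)
  define A where "A t \<omega> = approx_hess f l \<mu> (K t \<omega>) (x t \<omega>, y t \<omega>)" for t \<omega>
  define g where "g t \<omega> = grad_x f (x t \<omega>) (y t \<omega>)" for t \<omega>
  define tol where "tol t \<omega> = curvature_threshold M2 \<epsilon> (g t \<omega>)" for t \<omega>
  define B where "B = M1 + e2 \<epsilon>"
  \<comment> \<open>Formulated without reference to the run being active; the norm condition is the
    one consequence of activity that the event needs.\<close>
  define Bad where "Bad t = {\<omega> \<in> space M. spectral_norm (A t \<omega>) \<le> B \<and>
      \<not> (\<exists>lam u. lanczos_output (A t \<omega>) (b t \<omega>) (lanczos_steps TYPE('n) B (tol t \<omega>) \<delta>) lam u
              \<and> lam \<le> lambda_min (A t \<omega>) + tol t \<omega>)}" for t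
  have xy: "(\<lambda>\<omega>. (x t \<omega>, y t \<omega>)) \<in> borel_measurable (F t)" for t
    using meas by (intro borel_measurable_Pair) auto
  \<comment> \<open>Continuous in the iterates for each value of \<open>K t\<close>, and
    \<open>K t\<close> takes countably many values.\<close>
  have A: "A t \<in> borel_measurable (F t)" for t
    unfolding A_def
    by (rule measurable_compose_countable[OF _ meas(3)])
      (rule borel_measurable_continuous_on[OF continuous_approx_hess xy])
  have g: "g t \<in> borel_measurable (F t)" for t
    using borel_measurable_continuous_on[OF continuous_grad_x xy, of t] by (simp add: g_def[abs_def])
  have tol: "tol t \<in> borel_measurable (F t)" for t
    unfolding tol_def curvature_threshold_def using g by measurable
  have tol0: "0 < tol t \<omega>" for t \<omega>
    using M2_pos \<epsilon> by (auto simp: tol_def curvature_threshold_def less_max_iff_disj intro!: mult_pos_pos)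
  have bM: "b t \<in> borel_measurable M" for t
    using measurable_from_subalg[OF sub meas(4)] .
  have Bad: "Bad t \<in> sets M" "measure M (Bad t) \<le> \<delta>" for t
    unfolding Bad_def
    by (rule lanczos_failure_probability[OF prob sub A tol bM dist ind _ tol0 \<delta>(1)],
        simp add: A_def approx_hess_symmetric)+
  \<comment> \<open>The samples with a valid trajectory need not form a measurable set, so the
    complement of a null set is used instead.\<close>
  obtain Z where Z: "Z \<in> null_sets M" and run_Z: "\<And>\<omega>. \<omega> \<in> space M - Z \<Longrightarrow>
      ilm_run f l \<mu> \<rho> \<epsilon> \<delta> x0 ym1 (\<lambda>t. b t \<omega>) (\<lambda>t. N t \<omega>) (\<lambda>t. K t \<omega>)
        (\<lambda>t. x t \<omega>) (\<lambda>t. y t \<omega>) (\<lambda>t. lam t \<omega>) (\<lambda>t. u t \<omega>) (\<lambda>t. s t \<omega>)"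
    using AE_E3[OF run] by blast
  define ib where "ib = iteration_bound \<epsilon> x0"
  have ib0: "0 \<le> ib" unfolding ib_def by (rule iteration_bound_nonneg[OF \<epsilon>(1)])
  \<comment> \<open>Iterations 0 to \<open>m\<close> carry at most \<open>ib + 1\<close> bad
    events.\<close>
  define m where "m = nat \<lfloor>ib\<rfloor>"
  define U where "U = (\<Union>t\<in>{..m}. Bad t)"
  have U: "U \<in> sets M" unfolding U_def using Bad(1) by auto
  have "measure M U \<le> (\<Sum>t\<in>{..m}. measure M (Bad t))"
    unfolding U_def using Bad(1) by (intro M.finite_measure_subadditive_finite) auto
  also have "\<dots> \<le> (\<Sum>t\<in>{..m}. \<delta>)" by (intro sum_mono Bad(2))
  also have "\<dots> = (real m + 1) * \<delta>" by (simp add: add.commute)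
  also have "\<dots> \<le> (ib + 1) * \<delta>"
    using \<delta> ib0 unfolding m_def by (intro mult_right_mono) (auto simp: of_nat_floor)
  also have "\<dots> \<le> p" using fail by (simp add: ib_def)
  finally have Up: "measure M U \<le> p" .
  define E where "E = space M - (U \<union> Z)"
  have UZ: "U \<union> Z \<in> sets M" using U Z by auto
  have E: "E \<in> sets M" unfolding E_def using UZ by auto
  have "measure M E = 1 - measure M (U \<union> Z)" unfolding E_def by (rule M.prob_compl[OF UZ])
  also have "measure M (U \<union> Z) = measure M U" by (rule measure_Un_null_set[OF U Z])
  finally have ME: "1 - p \<le> measure M E" using Up by simp
  have "\<exists>T. (let hit = (\<lambda>t. reaches_target M2 \<epsilon> (grad_x f (x t \<omega>) (y t \<omega>)) (lam t \<omega>))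
       in hit T \<and> (\<forall>t<T. \<not> hit t)) \<and>
      second_order_stationary Pf 2 (sqrt M2) \<epsilon> (x T \<omega>) \<and>
      real (hessian_vector_products f l \<mu> \<rho> \<epsilon> \<delta> (\<lambda>t. K t \<omega>) (\<lambda>t. x t \<omega>) (\<lambda>t. y t \<omega>) (\<lambda>t. lam t \<omega>) T) \<le> C"
    if \<omega>: "\<omega> \<in> E" for \<omega>
  proof -
    have sp: "\<omega> \<in> space M" and "\<omega> \<notin> U" using \<omega> by (auto simp: E_def)
    have R: "ilm_run f l \<mu> \<rho> \<epsilon> \<delta> x0 ym1 (\<lambda>t. b t \<omega>) (\<lambda>t. N t \<omega>) (\<lambda>t. K t \<omega>)
        (\<lambda>t. x t \<omega>) (\<lambda>t. y t \<omega>) (\<lambda>t. lam t \<omega>) (\<lambda>t. u t \<omega>) (\<lambda>t. s t \<omega>)"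
      using \<omega> by (intro run_Z) (auto simp: E_def)
    let ?K = "\<lambda>t. K t \<omega>" and ?x = "\<lambda>t. x t \<omega>" and ?y = "\<lambda>t. y t \<omega>" and ?lam = "\<lambda>t. lam t \<omega>"
    note ctx = \<epsilon> R
    have ok: "lanczos_succeeds \<epsilon> ?K ?x ?y ?lam t"
      if t: "real t \<le> ib" and run_t: "running \<epsilon> ?x ?y ?lam t" for t
    proof -
      have "t \<le> m" using t by (simp add: m_def le_nat_floor)
      then have "\<omega> \<notin> Bad t" using \<open>\<omega> \<notin> U\<close> by (auto simp: U_def)
      moreover have "spectral_norm (A t \<omega>) \<le> B"
      proof (rule spectral_norm_le)
        fix v :: "real^'n"
        define D where "D = A t \<omega> - hess Pf (x t \<omega>)"
        have D: "spectral_norm D \<le> e2 \<epsilon>" using run_hess[OF ctx run_t] by (simp add: D_def A_def)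
        have "A t \<omega> *v v = D *v v + hess Pf (x t \<omega>) *v v" by (simp add: D_def matrix_vector_mult_diff_rdistrib)
        then have "norm (A t \<omega> *v v) \<le> norm (D *v v) + norm (hess Pf (x t \<omega>) *v v)"
          using norm_triangle_ineq by metis
        also have "\<dots> \<le> e2 \<epsilon> * norm v + M1 * norm v"
          using spectral_norm_bound[of D v] mult_right_mono[OF D, of "norm v"] hess_max_fun_bound[of "x t \<omega>" v]
          by simp
        finally show "norm (A t \<omega> *v v) \<le> B * norm v" by (simp add: B_def algebra_simps)
      qed
      ultimately have ex: "\<exists>lam u. lanczos_output (A t \<omega>) (b t \<omega>) (lanczos_steps TYPE('n) B (tol t \<omega>) \<delta>) lam u
              \<and> lam \<le> lambda_min (A t \<omega>) + tol t \<omega>"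
        using sp by (auto simp: Bad_def)
      have out: "lanczos_output (A t \<omega>) (b t \<omega>) (lanczos_steps TYPE('n) B (tol t \<omega>) \<delta>) (lam t \<omega>) (u t \<omega>)"
        using run_lanczos[OF ctx run_t] by (simp add: A_def B_def tol_def g_def lanczos_budget_def)
      have "lam t \<omega> \<le> lambda_min (A t \<omega>) + tol t \<omega>" by (rule lanczos_output_le[OF out ex])
      then show ?thesis unfolding lanczos_succeeds_def[OF ctx] by (simp add: A_def tol_def g_def)
    qed
    obtain T where T: "hit \<epsilon> ?x ?y ?lam T" "\<And>t. t < T \<Longrightarrow> \<not> hit \<epsilon> ?x ?y ?lam t" and T_ib: "real T \<le> ib"
      using hit_exists[OF ctx] ok unfolding ib_def by blast
    have running: "running \<epsilon> ?x ?y ?lam t" if "t \<le> T" for t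
      using that T(2) by (intro running_if_not_hit[OF ctx]) auto
    have ok': "lanczos_succeeds \<epsilon> ?K ?x ?y ?lam t" if "t \<le> T" for t
      using that T_ib by (intro ok running) auto
    have "real (hessian_vector_products f l \<mu> \<rho> \<epsilon> \<delta> ?K ?x ?y ?lam T)
        \<le> (real T + 1) * (Kmax + 3) * (real (lanczos_bound \<epsilon> \<delta>) + real (cg_bound \<epsilon>))"
      by (rule product_count[OF ctx \<delta>]) (use K[OF sp] T(2) ok' in auto)
    also have "\<dots> \<le> (ib + 1) * (Kmax + 3) * (real (lanczos_bound \<epsilon> \<delta>) + real (cg_bound \<epsilon>))"
    proof -
      have "0 \<le> Kmax" using K[OF sp, of 0] of_nat_0_le_iff order_trans by blast
      then show ?thesis using T_ib by (intro mult_right_mono) auto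
    qed
    also have "\<dots> \<le> C" using cost by (simp add: ib_def)
    finally show ?thesis
      using T hit_stationary[OF ctx running[OF order_refl] T(1) ok'[OF order_refl]]
      by (intro exI[of _ T]) (auto simp: Let_def)
  qed
  then show ?thesis using E ME by blast
qed

lemma high_probability_bound:
  fixes \<epsilon> p c :: real and a :: nat
  assumes \<epsilon>: "0 < \<epsilon>" "\<epsilon> \<le> 1" "sqrt (M2 * \<epsilon>) \<le> M1" "\<epsilon> powr (3/2) \<le> sqrt M2"
    and p: "0 < p" "p < 1" and c: "0 < c"
  shows "let \<Delta> = Pf x0 - Pstar; \<Lambda> = log_factor CARD('n) l \<mu> \<rho> \<Delta> \<epsilon> p in
     \<exists>\<delta>. 0 < \<delta> \<and> \<delta> < 1 \<and>
       (\<forall>(M :: 'w measure) F b N K x y lam u s.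
          ilm_process f l \<mu> \<rho> \<epsilon> \<delta> x0 ym1 M F b N K x y lam u s \<and>
          (\<forall>t. \<forall>\<omega>\<in>space M. real (K t \<omega>) \<le> c * sqrt (kappa l \<mu>) * \<Lambda> ^ a) \<longrightarrow>
          (\<exists>E\<in>sets M. measure M E \<ge> 1 - p \<and>
             (\<forall>\<omega>\<in>E. \<exists>T.
                (let hit = (\<lambda>t. reaches_target M2 \<epsilon> (grad_x f (x t \<omega>) (y t \<omega>)) (lam t \<omega>))
                 in hit T \<and> (\<forall>t<T. \<not> hit t)) \<and>
                second_order_stationary Pf 2 (sqrt M2) \<epsilon> (x T \<omega>) \<and>
                real (hessian_vector_products f l \<mu> \<rho> \<epsilon> \<delta> (\<lambda>t. K t \<omega>) (\<lambda>t. x t \<omega>)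
                    (\<lambda>t. y t \<omega>) (\<lambda>t. lam t \<omega>) T)
                  \<le> 10 ^ 15 * (1 + \<Delta>) * (1 + c) * \<Lambda> ^ (a + 3) *
                    (l powr (9/4) * \<rho> powr (1/4) * \<mu> powr (- 7/4) * \<epsilon> powr (- 7/4)))))"
proof -
  let ?\<Delta> = "Pf x0 - Pstar"
  let ?\<Lambda> = "log_factor CARD('n) l \<mu> \<rho> ?\<Delta> \<epsilon> p"
  define ib where "ib = iteration_bound \<epsilon> x0"
  \<comment> \<open>Depends only on the problem, \<open>x0\<close>, \<epsilon> and \<open>p\<close>,
    so it can be chosen before the process is given.\<close>
  define \<delta> where "\<delta> = p / (ib + 2)"
  have \<Delta>: "0 \<le> ?\<Delta>" using bounded_below[of x0] by simp
  have ib: "0 \<le> ib" unfolding ib_def by (rule iteration_bound_nonneg[OF \<epsilon>(1)])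
  have \<delta>: "0 < \<delta>" "\<delta> < 1" using p ib by (simp_all add: \<delta>_def field_simps)
  have fail: "(iteration_bound \<epsilon> x0 + 1) * \<delta> \<le> p"
    using p ib unfolding ib_def[symmetric] by (simp add: \<delta>_def field_simps)
  have n: "1 \<le> CARD('n)" by (simp add: Suc_leI)
  have cost: "(iteration_bound \<epsilon> x0 + 1) * (c * sqrt (kappa l \<mu>) * ?\<Lambda> ^ a + 3)
        * (real (lanczos_bound \<epsilon> \<delta>) + real (cg_bound \<epsilon>))
      \<le> 10 ^ 15 * (1 + ?\<Delta>) * (1 + c) * ?\<Lambda> ^ (a + 3) *
        (l powr (9/4) * \<rho> powr (1/4) * \<mu> powr (- 7/4) * \<epsilon> powr (- 7/4))"
    using complexity_bound[OF n mu_pos mu_le_l rho_pos \<Delta> \<epsilon>(1,2) p \<epsilon>(3,4) c, of a]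
    unfolding \<delta>_def ib_def iteration_bound_def gradient_bound_def lanczos_bound_def cg_bound_def .
  show ?thesis
    unfolding Let_def[of ?\<Delta>] Let_def[of ?\<Lambda>]
    by (intro exI[of _ \<delta>] conjI allI impI \<delta>, elim conjE)
      (rule process_bound[OF \<epsilon>(1-3) \<delta>(1) less_imp_le[OF \<delta>(2)] _ _ fail cost]; blast)
qed

end

theorem corollary3p1:
  fixes f :: "(real^'n) \<times> (real^'m) \<Rightarrow> real" and l \<mu> \<rho> Pstar :: real
  assumes "minimax_problem f l \<mu> \<rho> Pstar"
  shows "\<exists>\<xi>>0. \<exists>\<theta>>0. \<forall>x0 ym1 \<epsilon> p c (a::nat).
    0 < \<epsilon> \<and> \<epsilon> \<le> 1 \<and> sqrt (L2 l \<mu> \<rho> * \<epsilon>) \<le> L1 l \<mu> \<and> \<epsilon> powr (3/2) \<le> sqrt (L2 l \<mu> \<rho>) \<and>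
    0 < p \<and> p < 1 \<and> 0 < c \<longrightarrow>
    (let \<Delta> = max_fun f x0 - Pstar; \<Lambda> = log_factor CARD('n) l \<mu> \<rho> \<Delta> \<epsilon> p in
     \<exists>\<delta>. 0 < \<delta> \<and> \<delta> < 1 \<and>
       (\<forall>(M :: 'w measure) F b N K x y lam u s.
          ilm_process f l \<mu> \<rho> \<epsilon> \<delta> x0 ym1 M F b N K x y lam u s \<and>
          (\<forall>t. \<forall>\<omega>\<in>space M. real (K t \<omega>) \<le> c * sqrt (kappa l \<mu>) * \<Lambda> ^ a) \<longrightarrow>
          (\<exists>E\<in>sets M. measure M E \<ge> 1 - p \<and>
             (\<forall>\<omega>\<in>E. \<exists>T.
                (let hit = (\<lambda>t. reaches_target (L2 l \<mu> \<rho>) \<epsilon> (grad_x f (x t \<omega>) (y t \<omega>)) (lam t \<omega>))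
                 in hit T \<and> (\<forall>t<T. \<not> hit t)) \<and>
                second_order_stationary (max_fun f) \<xi> \<theta> \<epsilon> (x T \<omega>) \<and>
                real (hessian_vector_products f l \<mu> \<rho> \<epsilon> \<delta> (\<lambda>t. K t \<omega>) (\<lambda>t. x t \<omega>)
                    (\<lambda>t. y t \<omega>) (\<lambda>t. lam t \<omega>) T)
                  \<le> 10 ^ 15 * (1 + \<Delta>) * (1 + c) * \<Lambda> ^ (a + 3) *
                    (l powr (9/4) * \<rho> powr (1/4) * \<mu> powr (- 7/4) * \<epsilon> powr (- 7/4))))))"
proof -
  interpret minimax_problem f l \<mu> \<rho> Pstar by (rule assms)
  show ?thesis
    \<comment> \<open>Both constants come from \<open>hit_stationary\<close>; \<open>sqrt M2\<close>
      depends on the problem but not on \<epsilon>.\<close>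
    by (rule exI[of _ "2::real"], rule conjI, simp, rule exI[of _ "sqrt M2"], rule conjI, simp add: M2_pos,
        intro allI impI, elim conjE, rule high_probability_bound; assumption)
qed

end
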